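(* There is a probability distribution on the nonnegative integers (a waiting time distribution) such that the associated directionally reinforced random walk $(R_m)_{m\ge 0}$ on $\mathbb{Z}^2$ is recurrent, i.e. almost surely $R_m=0$ for infinitely many $m$, but for every lattice point $x\in\mathbb{Z}^2$ the walk almost surely changes direction at $x$ only finitely often.
   Context: Let $T$ be a random variable with values in $\{0,1,2,\dots\}$ and $P(T>0)>0$. The directionally reinforced random walk on $\mathbb{Z}^2$ with waiting time distribution $\mathcal{L}(T)$ is defined as follows. A particle starts at the origin with an initial direction among $\pm e_1,\pm e_2$ (the standard unit vectors and their negatives), horizontal. It moves in its current direction by unit size steps, one per unit of time, for a random time distributed as $T$; then it changes to a different direction chosen with equal probability among the three directions different from the current one, moves in the new direction for a new random time distributed as $T$, and so on. Each choice of direction and each waiting time is completely independent of the past (so the waiting times are i.i.d. with law $\mathcal{L}(T)$). If a waiting time equals $0$, the particle changes direction again at the same location without moving. $R_m$ denotes the position of the particle at time $m$ (after $m$ unit steps). *)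

theory Defs
  imports "HOL-Probability.Probability"
begin

definition axis_directions :: "(int \<times> int) set" where
  "axis_directions = {(1, 0), (0, 1), (-1, 0), (0, -1)}"

definition horizontal_directions :: "(int \<times> int) set" where
  "horizontal_directions = {(1, 0), (-1, 0)}"

definition quarter_turn :: "int \<times> int \<Rightarrow> int \<times> int" where
  "quarter_turn v = (- snd v, fst v)"

text \<open>
  The canonical sample space. The coordinates of \<open>\<omega>\<close> are independent, and \<open>\<omega> k\<close> is a pair of
  independent components: the waiting time of the \<open>k\<close>-th leg (starting from leg 0), and the number
  of quarter turns, uniform on \<open>{1, 2, 3}\<close>, made at its end. Making a uniform number of
  quarter turns in \<open>{1, 2, 3}\<close> is the same as choosing uniformly among the three other directions;
  see \<open>turn_uniform_on_other_directions\<close> below.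
\<close>

definition drrw_space :: "nat pmf \<Rightarrow> (nat \<Rightarrow> nat \<times> nat) measure" where
  "drrw_space p = (\<Pi>\<^sub>M k\<in>UNIV. measure_pmf (pair_pmf p (pmf_of_set {1, 2, 3})))"

definition waiting_time :: "nat \<Rightarrow> (nat \<Rightarrow> nat \<times> nat) \<Rightarrow> nat" where
  "waiting_time k \<omega> = fst (\<omega> k)"

primrec leg_direction :: "int \<times> int \<Rightarrow> nat \<Rightarrow> (nat \<Rightarrow> nat \<times> nat) \<Rightarrow> int \<times> int" where
  "leg_direction d 0 \<omega> = d"
| "leg_direction d (Suc k) \<omega> = (quarter_turn ^^ snd (\<omega> k)) (leg_direction d k \<omega>)"

lemma turn_uniform_on_other_directions:
  assumes "v \<in> axis_directions"
  shows "map_pmf (\<lambda>j. (quarter_turn ^^ j) v) (pmf_of_set {1, 2, 3 :: nat})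
           = pmf_of_set (axis_directions - {v})"
proof -
  have *: "(quarter_turn ^^ 1) v = quarter_turn v"
    "(quarter_turn ^^ 2) v = quarter_turn (quarter_turn v)"
    "(quarter_turn ^^ 3) v = quarter_turn (quarter_turn (quarter_turn v))"
    by (simp_all add: numeral_eq_Suc)
  have "inj_on (\<lambda>j. (quarter_turn ^^ j) v) {1, 2, 3 :: nat}"
    using assms by (auto simp: inj_on_def * axis_directions_def quarter_turn_def numeral_eq_Suc)
  moreover have "(\<lambda>j. (quarter_turn ^^ j) v) ` {1, 2, 3 :: nat} = axis_directions - {v}"
    using assms by (auto simp: axis_directions_def quarter_turn_def numeral_eq_Suc)
  ultimately show ?thesis
    by (subst map_pmf_of_set_inj) auto
qed

text \<open>Leg \<open>k\<close> occupies the times from \<open>change_time k\<close> to \<open>change_time (Suc k)\<close>. For \<open>k \<ge> 1\<close>,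
  the \<open>k\<close>-th change of direction takes place at time \<open>change_time k\<close>.\<close>

definition change_time :: "nat \<Rightarrow> (nat \<Rightarrow> nat \<times> nat) \<Rightarrow> nat" where
  "change_time k \<omega> = (\<Sum>i<k. waiting_time i \<omega>)"

text \<open>The unit step made between times \<open>m\<close> and \<open>m + 1\<close> belongs to the unique leg \<open>k\<close> with
  \<open>change_time k \<omega> \<le> m < change_time (Suc k) \<omega>\<close>. Such a leg exists unless the total waiting time
  is at most \<open>m\<close>, which has probability 0 when the waiting time is not almost surely 0; on that
  event the value is irrelevant.\<close>

definition leg_at :: "nat \<Rightarrow> (nat \<Rightarrow> nat \<times> nat) \<Rightarrow> nat" where
  "leg_at m \<omega> = (LEAST k. m < change_time (Suc k) \<omega>)"

primrec drrw_position :: "int \<times> int \<Rightarrow> nat \<Rightarrow> (nat \<Rightarrow> nat \<times> nat) \<Rightarrow> int \<times> int" where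
  "drrw_position d 0 \<omega> = (0, 0)"
| "drrw_position d (Suc m) \<omega> = drrw_position d m \<omega> + leg_direction d (leg_at m \<omega>) \<omega>"

text \<open>Indices of direction changes are counted rather than times, so successive changes
  at the same place separated by waiting times 0 count separately.\<close>

definition changes_at :: "int \<times> int \<Rightarrow> int \<times> int \<Rightarrow> (nat \<Rightarrow> nat \<times> nat) \<Rightarrow> nat set" where
  "changes_at d x \<omega> = {k. 1 \<le> k \<and> drrw_position d (change_time k \<omega>) \<omega> = x}"

end

theory Submission
  imports Defs
begin

text \<open>
  The waiting time is a mixture over scales: scale \<open>n\<close> has probability \<open>q\<^sub>n\<close>, and given the scale the
  waiting time is uniform on \<open>{0..<2 h\<^sub>n}\<close>. Both sequences are extremely sparse: \<open>1 / q\<^sub>n\<close> is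
  much larger than \<open>2 ^ h\<^sub>n\<^sub>-\<^sub>1\<close>, and \<open>h\<^sub>n\<close> is much larger than \<open>h\<^sub>n\<^sub>-\<^sub>1 / q\<^sub>n\<close>. Phase \<open>n\<close> of the walk
  lasts for \<open>2 ^ h\<^sub>n\<close> legs; in it, scale \<open>n\<close> dominates, and with high probability no higher
  scale has occurred.

  After \<open>k\<close> legs, with \<open>k\<close> in the main part of phase \<open>n\<close>, the walk is spread over a square
  of side \<open>h\<^sub>n * sqrt (q\<^sub>n k)\<close>. The probability that a given lattice point is the place of
  the \<open>k\<close>-th change of direction is therefore of the order of \<open>1 / (h\<^sub>n\<^sup>2 q\<^sub>n k)\<close>. Summed over the phase
  this gives \<open>ln (2 ^ h\<^sub>n) / (h\<^sub>n\<^sup>2 q\<^sub>n)\<close>, of the order of \<open>1 / (h\<^sub>n q\<^sub>n)\<close>, which is summable over \<open>n\<close>: by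
  Borel-Cantelli there are only finitely many changes at the point. On the other hand,
  a leg of scale \<open>n\<close> crosses the origin from about \<open>h\<^sub>n\<close> different starting points, so the \<open>k\<close>-th leg
  crosses the origin with probability of the order of \<open>q\<^sub>n * h\<^sub>n / (h\<^sub>n\<^sup>2 q\<^sub>n k) = 1 / (h\<^sub>n k)\<close>. Summed over the
  phase this is of order 1: the expected number of crossings in a phase is
  bounded below, and it is bounded above from every starting state. This forces a crossing with
  a probability bounded below in every phase, hence infinitely many crossings. The two sums differ by
  the factor \<open>h\<^sub>n q\<^sub>n\<close>, the contribution of scale \<open>n\<close> to the mean waiting time, which tends to
  infinity.

  The upper bound on the law of the position is \<open>prob_walk_position_le\<close>. It rests on an explicit
  feature of uniform variables on \<open>{0..<2h}\<close>: they split into a uniform residue below \<open>h\<close> and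
  \<open>h\<close> times a fair coin, so that sums of them are controlled by residues modulo \<open>h\<close> and the central
  binomial coefficient. The lower bound is \<open>pmf_walk_from_ge\<close>. It combines the upper bound and the
  second moment with unimodality of the law of the position, which holds
  because the waiting time has decreasing weights: along one axis
  the walk alternates between the two directions, so that the legs pair up to
  symmetric differences. Crossings are treated by \<open>mean_crossings_le_hit_prob\<close>
  and \<open>hit_prob_tendsto_1\<close>, visits by \<open>summable_visit_prob\<close>.
\<close>

section \<open>The walk observed at its changes of direction\<close>

type_synonym site = "int \<times> int"
type_synonym walk_state = "site \<times> site"

abbreviation (input) mean :: "'a pmf \<Rightarrow> ('a \<Rightarrow> real) \<Rightarrow> real" where
  "mean \<equiv> measure_pmf.expectation"

abbreviation (input) prob_of :: "'a pmf \<Rightarrow> 'a set \<Rightarrow> real" where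
  "prob_of \<equiv> measure_pmf.prob"

definition along :: "int \<Rightarrow> site \<Rightarrow> site" where
  "along t v = (t * fst v, t * snd v)"

definition turn_law :: "nat pmf" where
  "turn_law = pmf_of_set {1, 2, 3 :: nat}"

abbreviation leg_law :: "nat pmf \<Rightarrow> (nat \<times> nat) pmf" where
  "leg_law p \<equiv> pair_pmf p turn_law"

text \<open>One leg: the particle at \<open>fst sd\<close> facing \<open>snd sd\<close> travels for the waiting time
  \<open>fst x\<close> and then makes \<open>snd x\<close> quarter turns.\<close>
definition advance :: "walk_state \<Rightarrow> nat \<times> nat \<Rightarrow> walk_state" where
  "advance sd x = (fst sd + along (fst x) (snd sd), (quarter_turn ^^ snd x) (snd sd))"

text \<open>The recursion splits off the first leg, which suits inductions over the starting state;
  \<open>walk_law_Suc_last\<close> splits off the last one.\<close>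
primrec walk_law :: "nat pmf \<Rightarrow> nat \<Rightarrow> walk_state \<Rightarrow> walk_state pmf" where
  "walk_law p 0 sd = return_pmf sd"
| "walk_law p (Suc k) sd = bind_pmf (leg_law p) (\<lambda>x. walk_law p k (advance sd x))"

lemma walk_law_Suc_last:
  "walk_law p (Suc k) sd = bind_pmf (walk_law p k sd) (\<lambda>sd'. map_pmf (advance sd') (leg_law p))"
proof (induction k arbitrary: sd)
  case 0
  then show ?case by (simp add: bind_return_pmf map_pmf_def)
next
  case (Suc k)
  have "walk_law p (Suc (Suc k)) sd
    = bind_pmf (leg_law p) (\<lambda>x. bind_pmf (walk_law p k (advance sd x)) (\<lambda>sd'. map_pmf (advance sd') (leg_law p)))"
    by (subst walk_law.simps(2), subst Suc.IH) simp
  then show ?case by (simp add: bind_assoc_pmf)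
qed

lemma integrable_pmf_bounded:
  fixes f :: "'a \<Rightarrow> real"
  assumes "\<And>x. \<bar>f x\<bar> \<le> B"
  shows "integrable (measure_pmf M) f"
  by (rule measure_pmf.integrable_const_bound[where B=B]) (use assms in auto)

lemma expectation_bind_pmf:
  fixes f :: "'b \<Rightarrow> real"
  assumes "\<And>y. 0 \<le> f y" "\<And>y. f y \<le> B"
  shows "mean (bind_pmf M N) f
    = mean M (\<lambda>x. mean (N x) f)"
proof -
  have i: "integrable (measure_pmf K) f" for K :: "'b pmf"
    by (rule integrable_pmf_bounded[where B=B]) (use assms in \<open>simp add: abs_of_nonneg\<close>)
  have b: "0 \<le> mean (N x) f" "mean (N x) f \<le> B" for x
    subgoal by (simp add: assms)
    subgoal using integral_mono[OF i, of "N x" "\<lambda>_. B"] assms by simp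
    done
  have i2: "integrable (measure_pmf M) (\<lambda>x. mean (N x) f)"
    by (rule integrable_pmf_bounded[where B=B]) (use b in \<open>simp add: abs_of_nonneg\<close>)
  have "ennreal (mean (bind_pmf M N) f) = (\<integral>\<^sup>+x. f x \<partial>bind_pmf M N)"
    by (rule nn_integral_eq_integral[symmetric]) (use i assms in auto)
  also have "\<dots> = (\<integral>\<^sup>+x. ennreal (mean (N x) f) \<partial>M)"
    by (simp, intro nn_integral_cong nn_integral_eq_integral) (use i assms in auto)
  also have "\<dots> = ennreal (mean M (\<lambda>x. mean (N x) f))"
    by (intro nn_integral_eq_integral) (use i2 b in auto)
  finally show ?thesis
    by (subst (asm) ennreal_inj) (auto intro!: integral_nonneg_AE simp: assms b)
qed

lemma prob_bind_pmf:
  "prob_of (bind_pmf M N) A = mean M (\<lambda>x. prob_of (N x) A)"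
proof -
  show ?thesis
    using expectation_bind_pmf[of "indicator A" 1 M N] by simp
qed

lemma expectation_turn_law:
  "mean turn_law f = (f 1 + f 2 + f 3) / (3::real)"
  unfolding turn_law_def by (subst integral_pmf_of_set) auto

lemma expectation_le_const:
  fixes f :: "'a \<Rightarrow> real"
  assumes "\<And>x. x \<in> set_pmf M \<Longrightarrow> f x \<le> B" "\<And>x. 0 \<le> f x" 
  shows "mean M f \<le> B"
proof (cases "integrable (measure_pmf M) f")
  case True
  then have "mean M f \<le> mean M (\<lambda>_. B)"
    by (intro integral_mono_AE) (use assms in \<open>auto simp: AE_measure_pmf_iff\<close>)
  then show ?thesis by simp
next
  case False
  have "B \<ge> 0" using assms set_pmf_not_empty[of M] by (metis all_not_in_conv order_trans)
  with False show ?thesis by (simp add: not_integrable_integral_eq)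
qed

section \<open>Concentration of sums of uniform variables on the line\<close>

text \<open>The class of laws that the sum of \<open>j\<close> independent signed variables, each uniform on
  \<open>{0..<2h}\<close>, belongs to. Writing such a variable as a uniform residue below \<open>h\<close> plus \<open>h\<close> times
  a fair bit, the bits add up to a binomial variable (up to a shift), while a single uniform
  residue already makes the remaining part \<open>\<nu>\<close> equidistributed modulo \<open>h\<close>. The two effects
  together give the factors \<open>1 / sqrt j\<close> and \<open>1 / h\<close> of \<open>pmf_spread_le\<close>.\<close>
definition spread_pmf :: "nat \<Rightarrow> nat \<Rightarrow> int pmf \<Rightarrow> bool" where
  "spread_pmf h j \<mu> \<longleftrightarrow> (\<exists>\<nu>. \<mu> = bind_pmf (binomial_pmf j (1/2)) (\<lambda>w. map_pmf (\<lambda>v. int h * int w + v) \<nu>) \<and>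
     (j > 0 \<longrightarrow> (\<forall>r. prob_of \<nu> {v. v mod int h = r} \<le> 1 / real h)))"

lemma spread_pmf_return: "spread_pmf h 0 (return_pmf x)"
  unfolding spread_pmf_def
  by (intro exI[of _ "return_pmf x"]) (auto simp: binomial_pmf_0 bind_return_pmf)

lemma mod_eq_iff_diff: "v mod m = ((v + c) mod m - c) mod (m::int)"
  by (simp add: mod_diff_left_eq)

lemma spread_pmf_shift:
  assumes "spread_pmf h j \<mu>"
  shows "spread_pmf h j (map_pmf (\<lambda>x. x + c) \<mu>)"
proof -
  obtain \<nu> where \<nu>: "\<mu> = bind_pmf (binomial_pmf j (1/2)) (\<lambda>w. map_pmf (\<lambda>v. int h * int w + v) \<nu>)"
    "j > 0 \<Longrightarrow> prob_of \<nu> {v. v mod int h = r} \<le> 1 / real h" for r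
    using assms unfolding spread_pmf_def by auto
  show ?thesis unfolding spread_pmf_def
  proof (intro exI[of _ "map_pmf (\<lambda>v. v + c) \<nu>"] conjI impI allI)
    show "map_pmf (\<lambda>x. x + c) \<mu> =
      bind_pmf (binomial_pmf j (1/2)) (\<lambda>w. map_pmf (\<lambda>v. int h * int w + v) (map_pmf (\<lambda>v. v + c) \<nu>))"
      by (simp add: \<nu> map_bind_pmf pmf.map_comp o_def add_ac)
    fix r assume "j > 0"
    have "prob_of (map_pmf (\<lambda>v. v + c) \<nu>) {v. v mod int h = r}
      \<le> prob_of \<nu> {v. v mod int h = (r - c) mod int h}"
      by (auto intro!: measure_pmf.finite_measure_mono mod_eq_iff_diff)
    also have "\<dots> \<le> 1 / real h" using \<nu> \<open>j > 0\<close> by auto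
    finally show "prob_of (map_pmf (\<lambda>v. v + c) \<nu>) {v. v mod int h = r} \<le> 1 / real h" .
  qed
qed

text \<open>At most one \<open>u < h\<close> solves a congruence \<open>v \<plusminus> u = r\<close> modulo \<open>h\<close>.\<close>
lemma uniform_residue_unique:
  assumes "h > 0" "\<sigma> = 1 \<or> \<sigma> = (-1::int)"
  shows "prob_of (pmf_of_set {..<h}) {u. (v + \<sigma> * int u) mod int h = r} \<le> 1 / real h"
proof -
  have "card ({..<h} \<inter> {u. (v + \<sigma> * int u) mod int h = r}) \<le> Suc 0"
  proof (rule card_le_Suc0_iff_eq[THEN iffD2], simp, intro ballI)
    fix a b assume ab: "a \<in> {..<h} \<inter> {u. (v + \<sigma> * int u) mod int h = r}"
      "b \<in> {..<h} \<inter> {u. (v + \<sigma> * int u) mod int h = r}"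
    then have "int h dvd (v + \<sigma> * int a) - (v + \<sigma> * int b)"
      by (intro mod_eq_dvd_iff[THEN iffD1]) simp
    then have "int h dvd \<sigma> * (int a - int b)" by (simp add: algebra_simps)
    then have "int h dvd int a - int b" using assms(2) by (auto simp: dvd_diff_commute)
    moreover have "\<bar>int a - int b\<bar> < int h" using ab by auto
    ultimately have "int a - int b = 0" using dvd_imp_le_int[of "int a - int b" "int h"] by force
    then show "a = b" by simp
  qed
  then show ?thesis using assms
    by (subst measure_pmf_of_set) (auto simp: divide_right_mono)
qed

lemma uniform_double:
  fixes h :: nat
  assumes "h > 0"
  shows "pmf_of_set {..<2 * h} = bind_pmf (bernoulli_pmf (1/2))
     (\<lambda>b. map_pmf (\<lambda>u. u + (if b then h else 0)) (pmf_of_set {..<h}))" (is "_ = ?R")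
proof (rule pmf_eqI)
  fix i
  have step_range_nonempty: "{..<h} \<noteq> {}" "{..<2*h} \<noteq> {}" using assms by (auto simp: lessThan_empty_iff)
  have 1: "pmf (map_pmf (\<lambda>u. u + c) (pmf_of_set {..<h})) i = indicator {c..<c+h} i / real h" for c
  proof (cases "i \<ge> c")
    case True
    then have "pmf (map_pmf (\<lambda>u. u + c) (pmf_of_set {..<h})) ((i - c) + c) = pmf (pmf_of_set {..<h}) (i - c)"
      by (intro pmf_map_inj') (auto simp: inj_def)
    with True step_range_nonempty show ?thesis by (auto simp: indicator_def)
  next
    case False
    then have "i \<notin> set_pmf (map_pmf (\<lambda>u. u + c) (pmf_of_set {..<h}))" using step_range_nonempty by auto
    then have "pmf (map_pmf (\<lambda>u. u + c) (pmf_of_set {..<h})) i = 0"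
      by (rule pmf_eq_0_set_pmf[THEN iffD2])
    then show ?thesis using False by simp
  qed
  have "pmf ?R i = 1/2 * (indicator {h..<h+h} i / real h) + 1/2 * (indicator {0..<0+h} i / real h)"
    using 1[of h] 1[of 0] by (simp add: pmf_bind)
  also have "\<dots> = pmf (pmf_of_set {..<2*h}) i" using step_range_nonempty assms by (auto simp: indicator_def)
  finally show "pmf (pmf_of_set {..<2 * h}) i = pmf ?R i" by simp
qed

text \<open>For \<open>\<sigma> = -1\<close> the fair bit \<open>b\<close> enters as \<open>-h b = -h + h (1 - b)\<close>, and \<open>1 - b\<close>
  is again a fair bit; hence the shift \<open>c\<close> in the proof.\<close>
lemma spread_pmf_add_uniform:
  assumes "spread_pmf h j \<mu>" "h > 0" "\<sigma> = 1 \<or> \<sigma> = (-1::int)"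
  shows "spread_pmf h (Suc j) (bind_pmf \<mu> (\<lambda>x. map_pmf (\<lambda>t. x + \<sigma> * int t) (pmf_of_set {..<2 * h})))"
proof -
  obtain \<nu> where \<nu>: "\<mu> = bind_pmf (binomial_pmf j (1/2)) (\<lambda>w. map_pmf (\<lambda>v. int h * int w + v) \<nu>)"
    using assms unfolding spread_pmf_def by auto
  define c where "c = (if \<sigma> = 1 then 0 else - int h)"
  \<comment> \<open>one more uniform residue below \<open>h\<close> enters, together with the shift for a negative sign\<close>
  define \<nu>' where "\<nu>' = bind_pmf \<nu> (\<lambda>v. map_pmf (\<lambda>u. v + c + \<sigma> * int u) (pmf_of_set {..<h}))"
  have bern: "bind_pmf (bernoulli_pmf (1/2)) (\<lambda>b. f (if b then h else 0))
    = bind_pmf (bernoulli_pmf (1/2)) (\<lambda>b. f (if b then 0 else h))" for f :: "nat \<Rightarrow> int pmf"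
    by (rule pmf_eqI) (simp add: pmf_bind)
  have c_eq: "bind_pmf (bernoulli_pmf (1/2)) (\<lambda>b. f (\<sigma> * int (if b then h else 0)))
    = bind_pmf (bernoulli_pmf (1/2)) (\<lambda>b. f (c + int h * int (if b then 1 else 0)))"
    for f :: "int \<Rightarrow> int pmf"
  proof (cases "\<sigma> = 1")
    case True then show ?thesis by (intro bind_pmf_cong refl) (simp add: c_def)
  next
    case False
    then have s: "\<sigma> = -1" using assms by auto
    show ?thesis
      using bern[of "\<lambda>n. f (\<sigma> * int n)"]
      by (rule trans) (intro bind_pmf_cong refl arg_cong[of _ _ f], simp add: s c_def)
  qed
  have "bind_pmf \<mu> (\<lambda>x. map_pmf (\<lambda>t. x + \<sigma> * int t) (pmf_of_set {..<2 * h})) =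
    bind_pmf (binomial_pmf j (1/2)) (\<lambda>w. bind_pmf \<nu> (\<lambda>v. bind_pmf (pmf_of_set {..<h}) (\<lambda>u. 
      bind_pmf (bernoulli_pmf (1/2)) (\<lambda>b. return_pmf (int h * int w + v + \<sigma> * int u + \<sigma> * int (if b then h else 0))))))"
    unfolding \<nu> uniform_double[OF assms(2)]
    apply (simp add: map_pmf_def bind_assoc_pmf bind_return_pmf)
    apply (intro bind_pmf_cong refl)
    apply (subst bind_commute_pmf)
    apply (intro bind_pmf_cong refl)
    apply (simp add: algebra_simps)
    done
  also have "\<dots> = bind_pmf (binomial_pmf j (1/2)) (\<lambda>w. bind_pmf \<nu> (\<lambda>v. bind_pmf (pmf_of_set {..<h}) (\<lambda>u. 
      bind_pmf (bernoulli_pmf (1/2)) (\<lambda>b. return_pmf (int h * int w + v + \<sigma> * int u + (c + int h * int (if b then 1 else 0)))))))"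
    by (intro bind_pmf_cong refl c_eq[of "\<lambda>x. return_pmf (_ + x)"])
  also have "\<dots> = bind_pmf (binomial_pmf (Suc j) (1/2)) (\<lambda>w. map_pmf (\<lambda>v. int h * int w + v) \<nu>')"
    apply (simp add: binomial_pmf_Suc \<nu>'_def map_pmf_def bind_assoc_pmf bind_return_pmf)
    apply (subst bind_commute_pmf[of "bernoulli_pmf (1/2)"])
    apply (intro bind_pmf_cong refl)
    apply (subst bind_commute_pmf[of "bernoulli_pmf (1/2)"])
    apply (intro bind_pmf_cong refl)
    apply (subst bind_commute_pmf[of "bernoulli_pmf (1/2)"])
    apply (intro bind_pmf_cong refl)
    apply (simp add: algebra_simps)
    done
  finally have eq: "bind_pmf \<mu> (\<lambda>x. map_pmf (\<lambda>t. x + \<sigma> * int t) (pmf_of_set {..<2 * h})) = \<dots>" .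
  have "prob_of \<nu>' {v. v mod int h = r} \<le> 1 / real h" for r
    unfolding \<nu>'_def prob_bind_pmf
  proof (rule expectation_le_const)
    fix v show "prob_of (map_pmf (\<lambda>u. v + c + \<sigma> * int u) (pmf_of_set {..<h})) {v. v mod int h = r} \<le> 1 / real h"
      using uniform_residue_unique[OF assms(2,3), of "v + c" r] by (simp add: vimage_def)
  qed simp
  then show ?thesis unfolding spread_pmf_def by (intro exI[of _ \<nu>'] conjI impI allI eq)
qed

text \<open>The ratio of consecutive central binomial coefficients is \<open>2 (2m + 1) / (m + 1)\<close>, so the
  induction step amounts to \<open>sqrt (2m + 1) * sqrt (2m + 3) \<le> 2m + 2\<close>.\<close>
lemma central_binomial_upper: "real (2 * m choose m) * sqrt (2 * real m + 1) \<le> 4 ^ m"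
proof (induction m)
  case (Suc m)
  have rec: "real (Suc m) * real (2 * Suc m choose Suc m) = 2 * (2 * real m + 1) * real (2 * m choose m)"
  proof -
    have "Suc m * (2 * Suc m choose Suc m) = (2 * Suc m) * ((2*m+1) choose m)"
      using Suc_times_binomial_eq[of "2*m+1" m] by (simp add: algebra_simps)
    moreover have "Suc m * ((2*m+1) choose m) = (2*m+1) * (2 * m choose m)"
    proof -
      have "(2*m+1) choose m = (2*m+1) choose (Suc m)" by (subst binomial_symmetric) auto
      then show ?thesis using Suc_times_binomial_eq[of "2*m" m] by (simp add: algebra_simps)
    qed
    ultimately have "Suc m * (2 * Suc m choose Suc m) = 2 * (2*m+1) * (2 * m choose m)"
      by (simp add: algebra_simps)
    then have "real (Suc m * (2 * Suc m choose Suc m)) = real (2 * (2*m+1) * (2 * m choose m))" by (rule arg_cong)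
    then show ?thesis by (simp only: of_nat_mult of_nat_add of_nat_numeral of_nat_1)
  qed
  define a b where "a = sqrt (2 * real m + 1)" and "b = sqrt (2 * real m + 3)"
  define C where "C = real (2 * m choose m)"
  have aa: "a * a = 2 * real m + 1" and bb: "b * b = 2 * real m + 3" and ab0: "a \<ge> 0" "b \<ge> 0" "C \<ge> 0"
    by (simp_all add: a_def b_def C_def)
  have ab: "a * b \<le> 2 * real m + 2"
    using sum_squares_bound[of a b] aa bb by (simp add: power2_eq_square)
  have "2 * ((2 * real m + 1) * C) * b = 2 * (C * a) * (a * b)"
    unfolding aa[symmetric] by (simp add: mult_ac)
  also have "\<dots> \<le> 2 * (C * a) * (2 * real m + 2)"
    using ab ab0 by (intro mult_left_mono) auto
  also have "\<dots> \<le> 2 * 4 ^ m * (2 * real m + 2)" using Suc.IH unfolding a_def C_def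
    by (intro mult_right_mono mult_left_mono) auto
  also have "\<dots> = real (Suc m) * 4 ^ Suc m" by (simp add: algebra_simps)
  finally have le: "2 * ((2 * real m + 1) * C) * b \<le> real (Suc m) * 4 ^ Suc m" .
  have "2 * ((2 * real m + 1) * C) * b = real (Suc m) * (real (2 * Suc m choose Suc m) * b)"
    unfolding mult.assoc[of "real (Suc m)", symmetric] rec C_def by simp
  with le have "real (Suc m) * (real (2 * Suc m choose Suc m) * b) \<le> real (Suc m) * 4 ^ Suc m"
    by (simp only:)
  then have le2: "real (2 * Suc m choose Suc m) * b \<le> 4 ^ Suc m"
    by (rule mult_left_le_imp_le) simp
  have b: "sqrt (2 * real (Suc m) + 1) = b" unfolding b_def by simp
  show ?case unfolding b by (rule le2)
qed simp

text \<open>An odd number of coins is no more concentrated than the even number obtained by fixing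
  one of them.\<close>
lemma pmf_half_binomial_le:
  assumes "j > 0"
  shows "pmf (binomial_pmf j (1/2)) w \<le> 1 / sqrt (real j)"
proof -
  have even: "pmf (binomial_pmf (2*m) (1/2)) w \<le> 1 / sqrt (2 * real m + 1)" for m w
  proof (cases "w \<le> 2 * m")
    case False
    then show ?thesis by (simp add: binomial_eq_0)
  next
    case True
    have "pmf (binomial_pmf (2*m) (1/2)) w = real (2 * m choose w) / 4 ^ m"
      using True by (simp add: power_add[symmetric] mult.assoc power_mult power_divide)
    also have "\<dots> \<le> real (2 * m choose m) / 4 ^ m"
      using binomial_maximum'[of m w] by (simp add: divide_right_mono)
    also have "\<dots> \<le> 1 / sqrt (2 * real m + 1)"
      using central_binomial_upper[of m] by (simp add: field_simps)
    finally show ?thesis .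
  qed
  show ?thesis
  proof (cases "even j")
    case True
    then obtain m where m: "j = 2 * m" by auto
    have "1 / sqrt (2 * real m + 1) \<le> 1 / sqrt (real j)" using assms m by (intro divide_left_mono) auto
    then show ?thesis using even[of m w] unfolding m by (rule order_trans[rotated])
  next
    case False
    then obtain m where m: "j = Suc (2 * m)" by (auto elim: oddE)
    have "pmf (binomial_pmf j (1/2)) w \<le> 1 / sqrt (2 * real m + 1)"
      unfolding m binomial_pmf_Suc[of "1/2", simplified] pmf_bind
    proof (rule expectation_le_const)
      fix b
      have "bind_pmf (binomial_pmf (2*m) (1/2)) (\<lambda>k. return_pmf ((if b then 1 else 0) + k)) = map_pmf ((+) (if b then 1 else 0)) (binomial_pmf (2*m) (1/2))"
        by (simp add: map_pmf_def)
      also have "pmf \<dots> w \<le> 1 / sqrt (2 * real m + 1)"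
      proof (cases "w \<ge> (if b then 1 else 0)")
        case True
        then obtain w' where w': "w = (if b then 1 else 0) + w'" using le_Suc_ex by blast
        show ?thesis unfolding w' by (subst pmf_map_inj', simp add: inj_def, rule even)
      next
        case False
        then have "w \<notin> set_pmf (map_pmf ((+) (if b then 1 else 0)) (binomial_pmf (2*m) (1/2)))"
          by auto
        then have "pmf (map_pmf ((+) (if b then 1 else 0)) (binomial_pmf (2*m) (1/2))) w = 0"
          by (rule pmf_eq_0_set_pmf[THEN iffD2])
        then show ?thesis by simp
      qed
      finally show "mean (binomial_pmf (2 * m) (1 / 2)) (\<lambda>x. pmf (return_pmf ((if b then 1 else 0) + x)) w)
         \<le> 1 / sqrt (2 * real m + 1)" by (simp add: pmf_bind)
    qed simp
    moreover have "2 * real m + 1 = real j" using m by simp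
    ultimately show ?thesis by (simp only:)
  qed
qed

text \<open>Given \<open>\<nu> = v\<close>, the point \<open>x\<close> is reached by at most one value of the binomial variable, and
  by none unless \<open>v\<close> is congruent to \<open>x\<close> modulo \<open>h\<close>.\<close>
lemma pmf_spread_le:
  assumes "spread_pmf h j \<mu>" "h > 0" "j > 0"
  shows "pmf \<mu> x \<le> 1 / (real h * sqrt (real j))"
proof -
  obtain \<nu> where \<nu>: "\<mu> = bind_pmf (binomial_pmf j (1/2)) (\<lambda>w. map_pmf (\<lambda>v. int h * int w + v) \<nu>)"
    "prob_of \<nu> {v. v mod int h = r} \<le> 1 / real h" for r
    using assms unfolding spread_pmf_def by auto
  have \<mu>: "\<mu> = bind_pmf \<nu> (\<lambda>v. map_pmf (\<lambda>w. int h * int w + v) (binomial_pmf j (1/2)))"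
    unfolding \<nu> map_pmf_def by (rule bind_commute_pmf)
  have *: "pmf (map_pmf (\<lambda>w. int h * int w + v) (binomial_pmf j (1/2))) x
     \<le> 1 / sqrt (real j) * indicator {v. v mod int h = x mod int h} v" for v
  proof (cases "\<exists>w. x = int h * int w + v")
    case True
    then obtain w where w: "x = int h * int w + v" by auto
    have "pmf (map_pmf (\<lambda>w. int h * int w + v) (binomial_pmf j (1/2))) x \<le> 1 / sqrt (real j)"
      unfolding w using assms by (subst pmf_map_inj', simp add: inj_def, intro pmf_half_binomial_le)
    then show ?thesis using w by simp
  next
    case False
    then have "x \<notin> set_pmf (map_pmf (\<lambda>w. int h * int w + v) (binomial_pmf j (1/2)))" by auto
    then have "pmf (map_pmf (\<lambda>w. int h * int w + v) (binomial_pmf j (1/2))) x = 0" by (rule pmf_eq_0_set_pmf[THEN iffD2])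
    then show ?thesis by (simp add: indicator_def)
  qed
  have "pmf \<mu> x \<le> mean \<nu> (\<lambda>v. 1 / sqrt (real j) * indicator {v. v mod int h = x mod int h} v)"
    unfolding \<mu> pmf_bind
    by (intro integral_mono * integrable_pmf_bounded[where B=1] integrable_pmf_bounded[where B="1 / sqrt (real j)"])
       (auto simp: pmf_le_1 indicator_def)
  also have "\<dots> \<le> 1 / sqrt (real j) * (1 / real h)"
    using mult_left_mono[OF \<nu>(2)[of "x mod int h"], of "1 / sqrt (real j)"] by simp
  finally show ?thesis by (simp add: mult.commute)
qed

section \<open>Concentration of the walk in the plane\<close>

text \<open>Given the directions of all legs, the two coordinates are independent, so that product
  measures suffice.\<close>
definition spread2_pmf :: "nat \<Rightarrow> nat \<Rightarrow> nat \<Rightarrow> site pmf \<Rightarrow> bool" where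
  "spread2_pmf h jx jy \<mu> \<longleftrightarrow> (\<exists>\<mu>x \<mu>y. spread_pmf h jx \<mu>x \<and> spread_pmf h jy \<mu>y \<and> \<mu> = pair_pmf \<mu>x \<mu>y)"

lemma spread2_pmf_return: "spread2_pmf h 0 0 (return_pmf s)"
  unfolding spread2_pmf_def using spread_pmf_return[of h] by (metis pair_return_pmf surj_pair)

text \<open>The product \<open>1 / sqrt (jx * jy)\<close> is replaced by a sum with the arithmetic-geometric mean
  inequality. A sum of a function of \<open>jx\<close> and a function of \<open>jy\<close> can be averaged over random
  counts one coordinate at a time. The indicators cover the case that a coordinate has not
  yet been spread out.\<close>
lemma prob_spread2_le:
  assumes "spread2_pmf h jx jy \<mu>" "h > 0" "finite A"
  shows "prob_of \<mu> A \<le> of_bool (jx = 0) + of_bool (jy = 0)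
    + real (card A) / (real h)\<^sup>2 * (1 / (real jx + 1) + 1 / (real jy + 1))"
proof (cases "jx = 0 \<or> jy = 0")
  case True
  have "prob_of \<mu> A \<le> 1" by simp
  also have "\<dots> \<le> of_bool (jx = 0) + of_bool (jy = 0)" using True by auto
  finally show ?thesis by (rule order_trans) simp
next
  case False
  then have j: "jx > 0" "jy > 0" by auto
  obtain \<mu>x \<mu>y where \<mu>: "spread_pmf h jx \<mu>x" "spread_pmf h jy \<mu>y" "\<mu> = pair_pmf \<mu>x \<mu>y"
    using assms unfolding spread2_pmf_def by auto
  define a b where "a = 1 / sqrt (real jx)" and "b = 1 / sqrt (real jy)"
  have a2: "a\<^sup>2 \<le> 2 * (1 / (real jx + 1))" and b2: "b\<^sup>2 \<le> 2 * (1 / (real jy + 1))"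
    using j by (auto simp: a_def b_def power_divide field_simps)
  have pt: "pmf \<mu> x \<le> 1 / (real h)\<^sup>2 * (1 / (real jx + 1) + 1 / (real jy + 1))" for x
  proof -
    have "pmf \<mu> x = pmf \<mu>x (fst x) * pmf \<mu>y (snd x)"
      unfolding \<mu> by (metis pmf_pair prod.collapse)
    also have "\<dots> \<le> (1 / (real h * sqrt (real jx))) * (1 / (real h * sqrt (real jy)))"
      by (intro mult_mono pmf_spread_le \<mu> assms j) auto
    also have "\<dots> = 1 / (real h)\<^sup>2 * (a * b)" by (simp add: a_def b_def power2_eq_square)
    also have "\<dots> \<le> 1 / (real h)\<^sup>2 * (1 / (real jx + 1) + 1 / (real jy + 1))"
      using sum_squares_bound[of a b] a2 b2 by (intro mult_left_mono) auto
    finally show ?thesis .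
  qed
  have "prob_of \<mu> A = (\<Sum>x\<in>A. pmf \<mu> x)" by (rule measure_measure_pmf_finite) fact
  also have "\<dots> \<le> (\<Sum>x\<in>A. 1 / (real h)\<^sup>2 * (1 / (real jx + 1) + 1 / (real jy + 1)))"
    by (intro sum_mono pt)
  also have "\<dots> = real (card A) / (real h)\<^sup>2 * (1 / (real jx + 1) + 1 / (real jy + 1))" by simp
  finally show ?thesis using False by simp
qed

lemma spread2_pmf_shift:
  assumes "spread2_pmf h jx jy \<mu>"
  shows "spread2_pmf h jx jy (map_pmf (\<lambda>s. s + c) \<mu>)"
proof -
  obtain \<mu>x \<mu>y where \<mu>: "spread_pmf h jx \<mu>x" "spread_pmf h jy \<mu>y" "\<mu> = pair_pmf \<mu>x \<mu>y"
    using assms unfolding spread2_pmf_def by auto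
  have "map_pmf (\<lambda>s. s + c) \<mu> = map_pmf (\<lambda>(x, y). (x + fst c, y + snd c)) \<mu>"
    by (intro map_pmf_cong refl) (auto simp: plus_prod_def)
  also have "\<dots> = pair_pmf (map_pmf (\<lambda>x. x + fst c) \<mu>x) (map_pmf (\<lambda>x. x + snd c) \<mu>y)"
    unfolding \<mu> by (rule map_pair)
  finally show ?thesis using \<mu> spread_pmf_shift unfolding spread2_pmf_def by blast
qed

lemma spread2_pmf_add_uniform:
  assumes "spread2_pmf h jx jy \<mu>" "h > 0" "d \<in> axis_directions"
  shows "spread2_pmf h (jx + of_bool (d \<in> horizontal_directions)) (jy + of_bool (d \<notin> horizontal_directions))
    (bind_pmf \<mu> (\<lambda>s. map_pmf (\<lambda>t. s + along (int t) d) (pmf_of_set {..<2 * h})))"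
proof -
  obtain \<mu>x \<mu>y where \<mu>: "spread_pmf h jx \<mu>x" "spread_pmf h jy \<mu>y" "\<mu> = pair_pmf \<mu>x \<mu>y"
    using assms unfolding spread2_pmf_def by auto
  let ?U = "pmf_of_set {..<2 * h}"
  consider \<sigma> where "d = (\<sigma>, 0)" "\<sigma> = 1 \<or> \<sigma> = -1" "d \<in> horizontal_directions"
    | \<sigma> where "d = (0, \<sigma>)" "\<sigma> = 1 \<or> \<sigma> = -1" "d \<notin> horizontal_directions"
    using assms(3) by (auto simp: axis_directions_def horizontal_directions_def)
  then show ?thesis
  proof cases
    case 1
    have "bind_pmf \<mu> (\<lambda>s. map_pmf (\<lambda>t. s + along (int t) d) ?U)
      = pair_pmf (bind_pmf \<mu>x (\<lambda>x. map_pmf (\<lambda>t. x + \<sigma> * int t) ?U)) \<mu>y"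
      unfolding \<mu> pair_pmf_def map_pmf_def 1 along_def
      apply (simp add: bind_assoc_pmf bind_return_pmf mult_ac)
      apply (subst bind_commute_pmf[of \<mu>y])
      apply simp
      done
    then show ?thesis using spread_pmf_add_uniform[OF \<mu>(1) assms(2) 1(2)] \<mu>(2) 1(3)
      unfolding spread2_pmf_def by auto
  next
    case 2
    have "bind_pmf \<mu> (\<lambda>s. map_pmf (\<lambda>t. s + along (int t) d) ?U)
      = pair_pmf \<mu>x (bind_pmf \<mu>y (\<lambda>x. map_pmf (\<lambda>t. x + \<sigma> * int t) ?U))"
      unfolding \<mu> pair_pmf_def map_pmf_def 2 along_def
      by (simp add: bind_assoc_pmf bind_return_pmf mult_ac)
    then show ?thesis using spread_pmf_add_uniform[OF \<mu>(2) assms(2) 2(2)] \<mu>(1) 2(3)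
      unfolding spread2_pmf_def by auto
  qed
qed

text \<open>The position after \<open>k\<close> rounds in which the turn precedes the leg. With this order the axis of
  every leg is random, each axis having probability at least 1/3; the first leg of the original
  walk, whose direction is given, is split off in \<open>map_fst_walk_law\<close>.\<close>
primrec turned_walk :: "nat pmf \<Rightarrow> nat \<Rightarrow> site \<Rightarrow> site \<Rightarrow> site pmf" where
  "turned_walk p 0 d s = return_pmf s"
| "turned_walk p (Suc k) d s = bind_pmf turn_law (\<lambda>j. bind_pmf p (\<lambda>t.
     turned_walk p k ((quarter_turn ^^ j) d) (s + along (int t) ((quarter_turn ^^ j) d))))"

lemma map_fst_walk_law:
  "map_pmf fst (walk_law p (Suc k) (s, d)) = bind_pmf p (\<lambda>t. turned_walk p k d (s + along (int t) d))"
proof (induction k arbitrary: s d)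
  case 0
  show ?case
    by (simp add: map_bind_pmf pair_pmf_def bind_assoc_pmf bind_return_pmf advance_def)
next
  case (Suc k)
  have "map_pmf fst (walk_law p (Suc (Suc k)) (s, d)) =
    bind_pmf (leg_law p) (\<lambda>x. map_pmf fst (walk_law p (Suc k) (advance (s, d) x)))"
    by (subst walk_law.simps(2)) (simp only: map_bind_pmf)
  also have "\<dots> = bind_pmf p (\<lambda>t. bind_pmf turn_law (\<lambda>j.
      map_pmf fst (walk_law p (Suc k) (advance (s, d) (t, j)))))"
    by (simp only: pair_pmf_def bind_assoc_pmf bind_return_pmf)
  also have "\<dots> = bind_pmf p (\<lambda>t. turned_walk p (Suc k) d (s + along (int t) d))"
    by (simp only: advance_def fst_conv snd_conv Suc.IH turned_walk.simps)
  finally show ?case .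
qed

lemma quarter_turn_axis: "d \<in> axis_directions \<Longrightarrow> (quarter_turn ^^ j) d \<in> axis_directions"
  by (induction j) (auto simp: axis_directions_def quarter_turn_def)

text \<open>The value at one distinguished point is bounded separately, with its probability as weight.\<close>
lemma expectation_le_split:
  fixes f :: "'a \<Rightarrow> real"
  assumes "f n \<le> X" "\<And>i. i \<noteq> n \<Longrightarrow> f i \<le> Y" "\<And>i. 0 \<le> f i" "\<And>i. f i \<le> 1"
  shows "mean \<pi> f \<le> pmf \<pi> n * X + (1 - pmf \<pi> n) * Y"
proof -
  have i: "integrable \<pi> (indicator {n} :: 'a \<Rightarrow> real)"
    by (rule integrable_pmf_bounded[where B=1]) (auto simp: indicator_def)
  have "mean \<pi> f \<le> mean \<pi> (\<lambda>i. Y + (X - Y) * indicator {n} i)"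
  proof (rule integral_mono)
    show "integrable \<pi> f" by (rule integrable_pmf_bounded[where B=1]) (use assms in \<open>simp add: abs_of_nonneg\<close>)
    show "integrable \<pi> (\<lambda>i. Y + (X - Y) * indicator {n} i)"
      by (rule integrable_pmf_bounded[where B="\<bar>Y\<bar> + \<bar>X - Y\<bar>"]) (auto simp: indicator_def)
  qed (use assms in \<open>auto simp: indicator_def\<close>)
  also have "\<dots> = Y + (X - Y) * pmf \<pi> n"
    by (subst Bochner_Integration.integral_add) (auto simp: measure_pmf_single i)
  finally show ?thesis by (simp add: algebra_simps)
qed

text \<open>Whatever the current direction, at least one of the three turns leads to each axis. Here \<open>x0\<close>
  and \<open>y0\<close> are bounds for the two coordinates, which improve to \<open>x1\<close> or \<open>y1\<close> with probability
  \<open>q\<close> when the next leg is horizontal or vertical.\<close>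
lemma turn_average_le:
  fixes x0 x1 y0 y1 q :: real
  assumes "x1 \<le> x0" "y1 \<le> y0" "0 \<le> q" "d \<in> axis_directions"
    and F: "\<And>j. F j \<le> q * ((if (quarter_turn ^^ j) d \<in> horizontal_directions then x1 else x0)
       + (if (quarter_turn ^^ j) d \<in> horizontal_directions then y0 else y1)) + (1 - q) * (x0 + y0)"
  shows "mean turn_law F \<le> (x0 - q / 3 * (x0 - x1)) + (y0 - q / 3 * (y0 - y1))"
proof -
  have t: "quarter_turn ^^ 1 = quarter_turn" "quarter_turn ^^ 2 = quarter_turn \<circ> quarter_turn"
    "quarter_turn ^^ 3 = quarter_turn \<circ> (quarter_turn \<circ> quarter_turn)"
    by (simp_all add: numeral_eq_Suc o_assoc)
  have ge: "q * (x0 - x1) \<ge> 0" "q * (y0 - y1) \<ge> 0" using assms by auto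
  have "F 1 + F 2 + F 3 \<le> 3 * (x0 + y0) - q * (x0 - x1) - q * (y0 - y1)"
    using F[of 1] F[of 2] F[of 3] assms(4) ge unfolding t
    by (auto simp: axis_directions_def horizontal_directions_def quarter_turn_def algebra_simps)
  then show ?thesis unfolding expectation_turn_law by (simp add: field_simps)
qed

text \<open>The function \<open>a k j\<close> bounds the contribution of a coordinate that has been spread by \<open>j\<close> legs
  and has \<open>k\<close> rounds to go, in each of which \<open>j\<close> increases with probability at least
  \<open>q / 3\<close>. Its second summand is the value of \<open>B / (j + 1)\<close> after \<open>j\<close> has grown
  at half that speed; halving the speed compensates the convexity of \<open>1 / (j + 1)\<close>.\<close>
lemma decay_step:
  fixes q B :: real and j k :: nat
  defines "a \<equiv> \<lambda>k j. of_bool (j = 0) * (1 - q/3) ^ k + B / (real j + 1 + q * real k / 6)"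
  assumes "0 \<le> q" "q \<le> 1" "0 \<le> B"
  shows "a k (Suc j) \<le> a k j" "a k j - q / 3 * (a k j - a k (Suc j)) \<le> a (Suc k) j"
proof -
  define M where "M = real j + 1 + q * real k / 6"
  have M: "M \<ge> 1" using assms by (simp add: M_def)
  have e: "a k j = of_bool (j = 0) * (1 - q/3) ^ k + B / M"
    "a k (Suc j) = B / (M + 1)" "a (Suc k) j = of_bool (j = 0) * ((1 - q/3) * (1 - q/3) ^ k) + B / (M + q/6)"
    unfolding a_def M_def by (auto simp: algebra_simps add_divide_distrib)
  have "B / (M + 1) \<le> B / M" using M assms by (intro divide_left_mono) auto
  moreover have "0 \<le> (1 - q/3) ^ k" using assms by simp
  ultimately show "a k (Suc j) \<le> a k j" unfolding e by (simp add: add_increasing)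
  have "1 / M - q/3 * (1/M - 1/(M+1)) \<le> 1 / (M + q/6)"
  proof -
    have "1 / M - 1 / (M + q/6) = q/6 / (M * (M + q/6))" using M assms by (simp add: field_simps)
    also have "\<dots> \<le> q/3 / (M * (M + 1))"
    proof -
      have "(M + 1) * q \<le> 2 * (M + q / 6) * q" using M assms by (intro mult_right_mono) auto
      then show ?thesis using M assms by (simp add: frac_le_eq divide_simps) (simp add: algebra_simps)
    qed
    also have "\<dots> = q/3 * (1/M - 1/(M+1))" using M by (simp add: field_simps)
    finally show ?thesis by linarith
  qed
  then have "B * (1 / M - q/3 * (1/M - 1/(M+1))) \<le> B * (1 / (M + q/6))"
    using assms by (intro mult_left_mono)
  then show "a k j - q / 3 * (a k j - a k (Suc j)) \<le> a (Suc k) j"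
    unfolding e by (auto simp: algebra_simps)
qed

context
  fixes p :: "nat pmf" and \<pi> :: "nat pmf" and W :: "nat \<Rightarrow> nat pmf" and n h :: nat
  assumes mixture: "p = bind_pmf \<pi> W" and W: "W n = pmf_of_set {..<2 * h}" and h: "h > 0"
begin

text \<open>Induction over the rounds, with the initial law ranging over the whole class: a leg of the
  distinguished scale increases a count, and every other leg is, given its length, a
  translation, under which the class is closed.\<close>
lemma prob_turned_walk_le:
  assumes "spread2_pmf h jx jy \<mu>" "d \<in> axis_directions" "finite A"
  defines "a \<equiv> \<lambda>k j. of_bool (j = 0) * (1 - pmf \<pi> n/3) ^ k + (real (card A) / (real h)\<^sup>2) / (real j + 1 + pmf \<pi> n * real k / 6)"
  shows "prob_of (bind_pmf \<mu> (turned_walk p k d)) A \<le> a k jx + a k jy"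
  using assms(1,2)
proof (induction k arbitrary: jx jy \<mu> d)
  case 0
  have "prob_of \<mu> A \<le> a 0 jx + a 0 jy"
    using prob_spread2_le[OF 0(1) h \<open>finite A\<close>] by (simp add: a_def algebra_simps)
  then show ?case by (simp add: bind_return_pmf')
next
  case (Suc k)
  let ?d = "\<lambda>j. (quarter_turn ^^ j) d"
  let ?H = "\<lambda>j. ?d j \<in> horizontal_directions"
  let ?q = "pmf \<pi> n"
  \<comment> \<open>the next turn and the scale of the next leg are fixed to \<open>j\<close> and \<open>i\<close>\<close>
  define K where "K j i = bind_pmf (bind_pmf \<mu> (\<lambda>s. map_pmf (\<lambda>t. s + along (int t) (?d j)) (W i))) (turned_walk p k (?d j))" for j i
  have tw: "turned_walk p (Suc k) d = (\<lambda>s. bind_pmf turn_law (\<lambda>j. bind_pmf (bind_pmf \<pi> W) (\<lambda>t.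
     turned_walk p k (?d j) (s + along (int t) (?d j)))))"
    by (rule ext) (simp only: turned_walk.simps mixture[symmetric])
  have eq: "bind_pmf \<mu> (turned_walk p (Suc k) d) = bind_pmf turn_law (\<lambda>j. bind_pmf \<pi> (K j))"
    unfolding K_def tw
    apply (simp add: bind_assoc_pmf map_pmf_def bind_return_pmf)
    apply (subst bind_commute_pmf[of \<mu>])
    apply (intro bind_pmf_cong refl)
    apply (subst bind_commute_pmf[of \<mu>])
    apply simp
    done
  have Kn: "prob_of (K j n) A \<le> a k (jx + of_bool (?H j)) + a k (jy + of_bool (\<not> ?H j))" for j
    unfolding K_def W
    by (intro Suc.IH spread2_pmf_add_uniform Suc.prems h quarter_turn_axis)
  have Ki: "prob_of (K j i) A \<le> a k jx + a k jy" for j i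
  proof -
    have "K j i = bind_pmf (W i) (\<lambda>t. bind_pmf (map_pmf (\<lambda>s. s + along (int t) (?d j)) \<mu>) (turned_walk p k (?d j)))"
      unfolding K_def
      apply (simp add: bind_assoc_pmf map_pmf_def bind_return_pmf)
      apply (subst bind_commute_pmf[of \<mu>])
      apply simp
      done
    then show ?thesis
      by (simp only: prob_bind_pmf[of "W i"], intro expectation_le_const Suc.IH spread2_pmf_shift Suc.prems quarter_turn_axis) simp
  qed
  have q: "0 \<le> ?q" "?q \<le> 1" by (auto simp: pmf_le_1)
  have B: "0 \<le> real (card A) / (real h)\<^sup>2" by simp
  have step: "mean \<pi> (\<lambda>i. prob_of (K j i) A) \<le>
     ?q * (a k (jx + of_bool (?H j)) + a k (jy + of_bool (\<not> ?H j))) + (1 - ?q) * (a k jx + a k jy)" for j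
    by (rule expectation_le_split) (use Kn Ki in auto)
  have "prob_of (bind_pmf \<mu> (turned_walk p (Suc k) d)) A =
     mean turn_law (\<lambda>j. mean \<pi> (\<lambda>i. prob_of (K j i) A))"
    unfolding eq by (simp only: prob_bind_pmf)
  also have "\<dots> \<le> (a k jx - ?q / 3 * (a k jx - a k (Suc jx))) + (a k jy - ?q / 3 * (a k jy - a k (Suc jy)))"
  proof (rule turn_average_le)
    show "a k (Suc jx) \<le> a k jx" "a k (Suc jy) \<le> a k jy"
      unfolding a_def using decay_step(1)[OF q B] by blast+
    fix j
    show "mean \<pi> (\<lambda>i. prob_of (K j i) A)
         \<le> ?q * ((if ?H j then a k (Suc jx) else a k jx) + (if ?H j then a k jy else a k (Suc jy)))
           + (1 - ?q) * (a k jx + a k jy)"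
      using step[of j] by (cases "?H j") simp_all
  qed (use q Suc.prems in auto)
  also have "\<dots> \<le> a (Suc k) jx + a (Suc k) jy"
    unfolding a_def by (intro add_mono decay_step(2)[OF q B])
  finally show ?case .
qed

text \<open>After \<open>k\<close> legs about \<open>q k\<close> legs have the scale \<open>h\<close>, where \<open>q\<close> is the probability of that scale,
  and they alone limit the mass of any single point to the order of \<open>1 / (h\<^sup>2 q k)\<close>. The first
  summand is the probability that some coordinate has not been moved by such a leg.\<close>
theorem prob_walk_position_le:
  assumes "d \<in> axis_directions" "finite A"
  shows "prob_of (walk_law p (Suc k) (s, d)) {sd. fst sd \<in> A}
    \<le> 2 * (1 - pmf \<pi> n/3) ^ k + 2 * (real (card A) / (real h)\<^sup>2) / (1 + pmf \<pi> n * real k / 6)"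
proof -
  have "prob_of (walk_law p (Suc k) (s, d)) {sd. fst sd \<in> A}
    = prob_of (map_pmf fst (walk_law p (Suc k) (s, d))) A"
    by (simp add: vimage_def)
  also have "\<dots> = mean p (\<lambda>t. prob_of (bind_pmf (return_pmf (s + along (int t) d)) (turned_walk p k d)) A)"
    unfolding map_fst_walk_law by (simp add: prob_bind_pmf bind_return_pmf)
  also have "\<dots> \<le> 2 * (1 - pmf \<pi> n/3) ^ k + 2 * (real (card A) / (real h)\<^sup>2) / (1 + pmf \<pi> n * real k / 6)"
  proof (rule expectation_le_const)
    fix t
    show "prob_of (bind_pmf (return_pmf (s + along (int t) d)) (turned_walk p k d)) A
      \<le> 2 * (1 - pmf \<pi> n/3) ^ k + 2 * (real (card A) / (real h)\<^sup>2) / (1 + pmf \<pi> n * real k / 6)"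
      using prob_turned_walk_le[OF spread2_pmf_return assms, of "s + along (int t) d" k] by simp
  qed simp
  finally show ?thesis .
qed

end

section \<open>Unimodal functions on the plane\<close>

text \<open>A function of the absolute values of the two coordinates that decreases in each. The
  single monotonicity condition includes both reflection symmetries.\<close>
definition unimodal :: "(site \<Rightarrow> real) \<Rightarrow> bool" where
  "unimodal f \<longleftrightarrow> (\<forall>s. 0 \<le> f s) \<and>
     (\<forall>x y x' y'. \<bar>x\<bar> \<le> \<bar>x'\<bar> \<longrightarrow> \<bar>y\<bar> \<le> \<bar>y'\<bar> \<longrightarrow> f (x', y') \<le> f (x, y))"

lemma unimodal_nonneg: "unimodal f \<Longrightarrow> 0 \<le> f s"
  unfolding unimodal_def by blast

lemma unimodalD: "unimodal f \<Longrightarrow> \<bar>x\<bar> \<le> \<bar>x'\<bar> \<Longrightarrow> \<bar>y\<bar> \<le> \<bar>y'\<bar> \<Longrightarrow> f (x', y') \<le> f (x, y)"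
  by (simp add: unimodal_def)

lemma unimodal_add: "unimodal f \<Longrightarrow> unimodal g \<Longrightarrow> unimodal (\<lambda>s. f s + g s)"
  unfolding unimodal_def by (auto intro: add_mono)

lemma unimodal_mult: "unimodal f \<Longrightarrow> 0 \<le> c \<Longrightarrow> unimodal (\<lambda>s. c * f s)"
  unfolding unimodal_def by (auto intro: mult_left_mono)

lemma unimodal_sum: "finite I \<Longrightarrow> (\<And>i. i \<in> I \<Longrightarrow> unimodal (f i)) \<Longrightarrow> unimodal (\<lambda>s. \<Sum>i\<in>I. f i s)"
  unfolding unimodal_def by (auto intro!: sum_mono sum_nonneg)

lemma unimodal_point: "0 \<le> c \<Longrightarrow> unimodal (\<lambda>s. c * of_bool (s = (0, 0)))"
  unfolding unimodal_def by auto

lemma unimodal_swap: "unimodal f \<Longrightarrow> unimodal (f \<circ> prod.swap)"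
  unfolding unimodal_def by auto

text \<open>Moving the window from \<open>x\<close> to \<open>x + 1\<close> with \<open>x \<ge> 0\<close> adds a point and drops one that is not
  farther from the axis.\<close>
lemma unimodal_window_sum:
  assumes f: "unimodal f"
  shows "unimodal (\<lambda>(x, y). \<Sum>u\<in>{-int m..int m}. f (x + u, y))"
proof -
  define g where "g x y = (\<Sum>u\<in>{-int m..int m}. f (x + u, y))" for x y
  have even: "g (- x) y = g x y" for x y
    unfolding g_def
    by (rule sum.reindex_bij_witness[of _ uminus uminus])
       (auto intro!: antisym unimodalD[OF f])
  have step: "g (x + 1) y \<le> g x y" if "x \<ge> 0" for x y
  proof -
    have shift: "g x y = (\<Sum>v\<in>{x - int m..x + int m}. f (v, y))" for x
      unfolding g_def
      by (rule sum.reindex_bij_witness[of _ "\<lambda>v. v - x" "\<lambda>u. x + u"]) auto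
    have "g (x + 1) y = (\<Sum>v\<in>{x - int m + 1..x + int m}. f (v, y)) + f (x + int m + 1, y)"
      unfolding shift
    proof -
      have "{x + 1 - int m..x + 1 + int m} = insert (x + int m + 1) {x - int m + 1..x + int m}" by auto
      then show "(\<Sum>v\<in>{x + 1 - int m..x + 1 + int m}. f (v, y)) =
        (\<Sum>v\<in>{x - int m + 1..x + int m}. f (v, y)) + f (x + int m + 1, y)" by simp
    qed
    moreover have "g x y = f (x - int m, y) + (\<Sum>v\<in>{x - int m + 1..x + int m}. f (v, y))"
    proof -
      have "{x - int m..x + int m} = insert (x - int m) {x - int m + 1..x + int m}" by auto
      then show ?thesis unfolding shift by simp
    qed
    moreover have "f (x + int m + 1, y) \<le> f (x - int m, y)"
      using that by (intro unimodalD[OF f]) auto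
    ultimately show ?thesis by simp
  qed
  have dec: "g (int a + int b) y \<le> g (int a) y" for a b y
  proof (induction b)
    case (Suc b)
    have "int a + int (Suc b) = (int a + int b) + 1" by simp
    then show ?case using order_trans[OF step[of "int a + int b" y] Suc.IH] by (simp only:)
  qed simp
  have "g x' y' \<le> g x y" if "\<bar>x\<bar> \<le> \<bar>x'\<bar>" "\<bar>y\<bar> \<le> \<bar>y'\<bar>" for x y x' y'
  proof -
    have abs: "g x y = g \<bar>x\<bar> y" for x y using even[of x y] by (cases "x \<ge> 0") auto
    have "g x' y' \<le> g x' y" unfolding g_def by (intro sum_mono unimodalD[OF f] that) simp
    also have "\<dots> \<le> g x y"
      using dec[of "nat \<bar>x\<bar>" "nat (\<bar>x'\<bar> - \<bar>x\<bar>)" y] that(1) by (subst abs, subst (2) abs) simp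
    finally show ?thesis .
  qed
  moreover have "0 \<le> g x y" for x y unfolding g_def by (intro sum_nonneg unimodal_nonneg[OF f])
  ultimately show ?thesis unfolding unimodal_def g_def by auto
qed

lemma along_simps [simp]: "along t (a, b) = (t * a, t * b)"
  by (simp add: along_def)

text \<open>A symmetric decreasing kernel is a combination of indicators of symmetric windows with
  nonnegative coefficients.\<close>
lemma unimodal_convolution:
  assumes f: "unimodal f" and v: "v = (1, 0) \<or> v = (0, 1)"
    and \<kappa>: "\<And>n. \<kappa> (Suc n) \<le> \<kappa> n" "\<And>n. n \<ge> M \<Longrightarrow> \<kappa> n = (0::real)"
  shows "unimodal (\<lambda>s. \<Sum>u\<in>{-int M..int M}. \<kappa> (nat \<bar>u\<bar>) * f (s + along u v))"
proof -
  \<comment> \<open>summation by parts: \<open>\<kappa>\<close> as a combination of indicators of \<open>{..m}\<close>\<close>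
  have tele: "\<kappa> n = (\<Sum>m\<le>M. (\<kappa> m - \<kappa> (Suc m)) * of_bool (n \<le> m))" for n
  proof -
    have *: "\<kappa> n - \<kappa> (n + l) = (\<Sum>m\<in>{n..<n+l}. \<kappa> m - \<kappa> (Suc m))" for l
      by (induction l) auto
    show ?thesis
    proof (cases "n \<le> M")
      case True
      have "(\<Sum>m\<le>M. (\<kappa> m - \<kappa> (Suc m)) * of_bool (n \<le> m)) = (\<Sum>m\<in>{n..<Suc M}. \<kappa> m - \<kappa> (Suc m))"
        by (rule sum.mono_neutral_cong_right) auto
      also have "\<dots> = \<kappa> n" using *[of "Suc M - n"] True \<kappa>(2)[of "Suc M"] by simp
      finally show ?thesis by simp
    next
      case False
      then have "(\<Sum>m\<le>M. (\<kappa> m - \<kappa> (Suc m)) * of_bool (n \<le> m)) = 0" by (intro sum.neutral) auto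
      then show ?thesis using \<kappa>(2)[of n] False by simp
    qed
  qed
  have box: "unimodal (\<lambda>s. \<Sum>u\<in>{-int m..int m}. f (s + along u v))" for m
    using v
  proof
    assume "v = (1, 0)"
    then show ?thesis using unimodal_window_sum[OF f, of m] by (simp add: case_prod_unfold plus_prod_def)
  next
    assume "v = (0, 1)"
    then show ?thesis using unimodal_swap[OF unimodal_window_sum[OF unimodal_swap[OF f], of m]]
      by (simp add: case_prod_unfold plus_prod_def o_def prod.swap_def)
  qed
  have "(\<Sum>u\<in>{-int M..int M}. \<kappa> (nat \<bar>u\<bar>) * f (s + along u v))
    = (\<Sum>m\<le>M. (\<kappa> m - \<kappa> (Suc m)) * (\<Sum>u\<in>{-int m..int m}. f (s + along u v)))" for s
  proof -
    have "(\<Sum>u\<in>{-int M..int M}. \<kappa> (nat \<bar>u\<bar>) * f (s + along u v)) =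
      (\<Sum>u\<in>{-int M..int M}. \<Sum>m\<le>M. (\<kappa> m - \<kappa> (Suc m)) * (of_bool (nat \<bar>u\<bar> \<le> m) * f (s + along u v)))"
      by (subst tele) (simp only: sum_distrib_right mult.assoc)
    also have "\<dots> = (\<Sum>m\<le>M. (\<kappa> m - \<kappa> (Suc m)) * (\<Sum>u\<in>{-int M..int M}. of_bool (nat \<bar>u\<bar> \<le> m) * f (s + along u v)))"
      by (subst sum.swap) (simp only: sum_distrib_left)
    also have "\<dots> = (\<Sum>m\<le>M. (\<kappa> m - \<kappa> (Suc m)) * (\<Sum>u\<in>{-int m..int m}. f (s + along u v)))"
      by (intro sum.cong refl arg_cong2[of _ _ _ _ "(*)"] sum.mono_neutral_cong_right) auto
    finally show ?thesis .
  qed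
  then show ?thesis
    by (auto intro!: unimodal_sum unimodal_mult box \<kappa>(1))
qed

context
  fixes r :: "nat \<Rightarrow> real" and M :: nat and v :: "site"
  assumes r: "\<And>n. 0 \<le> r n" "\<And>n. r (Suc n) \<le> r n" "\<And>n. n \<ge> M \<Longrightarrow> r n = 0"
    and v: "v = (1, 0) \<or> v = (0, 1)"
begin

text \<open>A decreasing law on the nonnegative integers added to its reflection is symmetric and
  decreasing in the distance from 0; only the weight of 0 is counted twice.\<close>
lemma unimodal_conv_symmetrized:
  assumes f: "unimodal f"
  shows "unimodal (\<lambda>s. (\<Sum>t<M. r t * f (s + along (int t) v)) + (\<Sum>t<M. r t * f (s - along (int t) v)))"
proof -
  have neg: "s - along t v = s + along (- t) v" for s t by (simp add: along_def prod_eq_iff)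
  have "(\<Sum>t<M. r t * f (s + along (int t) v)) + (\<Sum>t<M. r t * f (s - along (int t) v)) =
     (\<Sum>u\<in>{-int M..int M}. r (nat \<bar>u\<bar>) * f (s + along u v)) + r 0 * f s" for s
  proof -
    have 1: "(\<Sum>t<M. r t * f (s + along (int t) v)) = (\<Sum>u\<in>{0..int M}. r (nat \<bar>u\<bar>) * f (s + along u v))"
    proof -
      have "(\<Sum>t<M. r t * f (s + along (int t) v)) = (\<Sum>u\<in>{0..<int M}. r (nat \<bar>u\<bar>) * f (s + along u v))"
        by (rule sum.reindex_bij_witness[of _ nat int]) auto
      also have "\<dots> = (\<Sum>u\<in>{0..int M}. r (nat \<bar>u\<bar>) * f (s + along u v))"
        by (rule sum.mono_neutral_cong_left) (auto simp: r(3))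
      finally show ?thesis .
    qed
    have 2: "(\<Sum>t<M. r t * f (s - along (int t) v)) = (\<Sum>u\<in>{-int M..0}. r (nat \<bar>u\<bar>) * f (s + along u v))"
    proof -
      have "(\<Sum>t<M. r t * f (s - along (int t) v)) = (\<Sum>u\<in>{-int M<..0}. r (nat \<bar>u\<bar>) * f (s + along u v))"
        unfolding neg by (rule sum.reindex_bij_witness[of _ "\<lambda>u. nat (-u)" "\<lambda>t. - int t"]) auto
      also have "\<dots> = (\<Sum>u\<in>{-int M..0}. r (nat \<bar>u\<bar>) * f (s + along u v))"
        by (rule sum.mono_neutral_cong_left) (auto simp: r(3))
      finally show ?thesis .
    qed
    have "{-int M..int M} = {-int M..0} \<union> {0..int M}" "{-int M..0} \<inter> {0..int M} = {0}" by auto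
    then have "(\<Sum>u\<in>{-int M..0}. r (nat \<bar>u\<bar>) * f (s + along u v)) + (\<Sum>u\<in>{0..int M}. r (nat \<bar>u\<bar>) * f (s + along u v))
      = (\<Sum>u\<in>{-int M..int M}. r (nat \<bar>u\<bar>) * f (s + along u v)) + r 0 * f (s + along 0 v)"
      using sum.union_inter[of "{-int M..0}" "{0..int M}" "\<lambda>u. r (nat \<bar>u\<bar>) * f (s + along u v)"] by simp
    moreover have "s + along 0 v = s" by (simp add: along_def prod_eq_iff)
    ultimately show ?thesis unfolding 1 2 by simp
  qed
  then show ?thesis
    by (simp, intro unimodal_add unimodal_mult f unimodal_convolution v r)
qed

text \<open>The difference of two independent variables with a common decreasing law on the
  nonnegative integers is symmetric, and its weights
  \<open>\<Sum>t. r t * r (t + n)\<close> decrease in \<open>n\<close>. The common law is essential for the symmetry.\<close>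
lemma unimodal_conv_difference:
  assumes f: "unimodal f"
  shows "unimodal (\<lambda>s. \<Sum>t<M. r t * (\<Sum>t'<M. r t' * f (s + along (int t) v - along (int t') v)))"
proof -
  define \<kappa> where "\<kappa> n = (\<Sum>t<M. r t * r (t + n))" for n
  have \<kappa>1: "\<kappa> (Suc n) \<le> \<kappa> n" for n
    unfolding \<kappa>_def using r by (intro sum_mono mult_left_mono) auto
  have \<kappa>2: "n \<ge> M \<Longrightarrow> \<kappa> n = 0" for n unfolding \<kappa>_def using r(3) by (intro sum.neutral) auto
  have diag: "(\<Sum>tt\<in>{tt\<in>{..<M}\<times>{..<M}. int (fst tt) - int (snd tt) = u}. r (fst tt) * r (snd tt)) = \<kappa> (nat \<bar>u\<bar>)" for u
  proof (cases "u \<ge> 0")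
    case True
    have "(\<Sum>tt\<in>{tt\<in>{..<M}\<times>{..<M}. int (fst tt) - int (snd tt) = u}. r (fst tt) * r (snd tt))
      = (\<Sum>t\<in>{t. t + nat u < M}. r t * r (t + nat \<bar>u\<bar>))"
      by (rule sum.reindex_bij_witness[of _ "\<lambda>t. (t + nat u, t)" snd])
         (use True in \<open>auto simp flip: of_nat_diff\<close>)
    also have "\<dots> = \<kappa> (nat \<bar>u\<bar>)"
      unfolding \<kappa>_def by (rule sum.mono_neutral_cong_left) (use r(3) True in auto)
    finally show ?thesis .
  next
    case False
    have "(\<Sum>tt\<in>{tt\<in>{..<M}\<times>{..<M}. int (fst tt) - int (snd tt) = u}. r (fst tt) * r (snd tt))
      = (\<Sum>t\<in>{t. t + nat (-u) < M}. r t * r (t + nat \<bar>u\<bar>))"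
      by (rule sum.reindex_bij_witness[of _ "\<lambda>t. (t, t + nat (-u))" fst])
         (use False in \<open>auto simp: not_le less_imp_le simp flip: of_nat_diff\<close>)
    also have "\<dots> = \<kappa> (nat \<bar>u\<bar>)"
      unfolding \<kappa>_def by (rule sum.mono_neutral_cong_left) (use r(3) False in auto)
    finally show ?thesis .
  qed
  have al: "s + along a v - along b v = s + along (a - b) v" for s a b
    by (simp add: along_def prod_eq_iff algebra_simps)
  have "(\<Sum>t<M. r t * (\<Sum>t'<M. r t' * f (s + along (int t) v - along (int t') v)))
    = (\<Sum>u\<in>{-int M..int M}. \<kappa> (nat \<bar>u\<bar>) * f (s + along u v))" for s
  proof -
    have "(\<Sum>t<M. r t * (\<Sum>t'<M. r t' * f (s + along (int t) v - along (int t') v)))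
     = (\<Sum>tt\<in>{..<M}\<times>{..<M}. r (fst tt) * r (snd tt) * f (s + along (int (fst tt) - int (snd tt)) v))"
      by (simp add: sum_distrib_left sum.cartesian_product case_prod_unfold mult.assoc al)
    also have "\<dots> = (\<Sum>u\<in>{-int M..int M}. \<Sum>tt\<in>{tt\<in>{..<M}\<times>{..<M}. int (fst tt) - int (snd tt) = u}.
        r (fst tt) * r (snd tt) * f (s + along (int (fst tt) - int (snd tt)) v))"
      by (rule sum.group[symmetric]) auto
    also have "\<dots> = (\<Sum>u\<in>{-int M..int M}. \<kappa> (nat \<bar>u\<bar>) * f (s + along u v))"
      unfolding diag[symmetric] sum_distrib_right by (intro sum.cong refl) auto
    finally show ?thesis .
  qed
  then show ?thesis by (simp, intro unimodal_convolution f v \<kappa>1 \<kappa>2)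
qed

end

section \<open>The joint law of position and direction\<close>

text \<open>The recursion by the last leg, which follows the law of the current state from a random
  initial one.\<close>
primrec walk_from :: "nat pmf \<Rightarrow> walk_state pmf \<Rightarrow> nat \<Rightarrow> walk_state pmf" where
  "walk_from p \<mu> 0 = \<mu>"
| "walk_from p \<mu> (Suc k) = bind_pmf (walk_from p \<mu> k) (\<lambda>sd. map_pmf (advance sd) (leg_law p))"

lemma walk_from_eq: "walk_from p \<mu> k = bind_pmf \<mu> (walk_law p k)"
proof (induction k)
  case 0
  show ?case by (simp add: bind_return_pmf')
next
  case (Suc k)
  show ?case by (simp only: walk_from.simps Suc.IH bind_assoc_pmf walk_law_Suc_last)
qed

lemma quarter_turn_4: "(quarter_turn ^^ 4) d = d"
  by (simp add: numeral_eq_Suc quarter_turn_def prod_eq_iff)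

lemma quarter_turn_back: 
  "j \<le> 4 \<Longrightarrow> (quarter_turn ^^ j) ((quarter_turn ^^ (4 - j)) d) = d"
proof -
  assume "j \<le> 4"
  have "(quarter_turn ^^ j) ((quarter_turn ^^ (4 - j)) d) = (quarter_turn ^^ (j + (4 - j))) d"
    unfolding funpow_add o_apply ..
  also have "\<dots> = d" using \<open>j \<le> 4\<close> quarter_turn_4 by simp
  finally show ?thesis .
qed

lemma inj_advance: "j \<le> 4 \<Longrightarrow> inj (\<lambda>sd. advance sd (t, j))"
proof (rule injI)
  fix x y assume "j \<le> 4" and eq: "advance x (t, j) = advance y (t, j)"
  then have "(quarter_turn ^^ (4 - j)) ((quarter_turn ^^ j) (snd x)) = (quarter_turn ^^ (4 - j)) ((quarter_turn ^^ j) (snd y))"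
    by (simp add: advance_def)
  then have "snd x = snd y"
    using quarter_turn_back[of "4 - j"] \<open>j \<le> 4\<close> by simp
  moreover from this have "fst x = fst y" using eq by (simp add: advance_def)
  ultimately show "x = y" by (simp add: prod_eq_iff)
qed

text \<open>A leg can be undone: the state before it is determined by the state after it, the waiting time
  and the turn.\<close>
lemma pmf_advance:
  fixes r :: "nat pmf"
  assumes M: "\<And>t. t \<ge> M \<Longrightarrow> pmf r t = 0"
  shows "pmf (bind_pmf \<mu> (\<lambda>sd. map_pmf (advance sd) (leg_law r))) (s, d)
    = ((\<Sum>t<M. pmf r t * pmf \<mu> (s - along (int t) ((quarter_turn ^^ 1) d), (quarter_turn ^^ 1) d))
     + (\<Sum>t<M. pmf r t * pmf \<mu> (s - along (int t) ((quarter_turn ^^ 2) d), (quarter_turn ^^ 2) d))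
     + (\<Sum>t<M. pmf r t * pmf \<mu> (s - along (int t) ((quarter_turn ^^ 3) d), (quarter_turn ^^ 3) d))) / 3"
proof -
  have swap: "bind_pmf \<mu> (\<lambda>sd. map_pmf (advance sd) (leg_law r))
    = bind_pmf turn_law (\<lambda>j. bind_pmf r (\<lambda>t. map_pmf (\<lambda>sd. advance sd (t, j)) \<mu>))"
    unfolding pair_pmf_def map_pmf_def
    apply (simp only: bind_assoc_pmf bind_return_pmf)
    apply (subst bind_commute_pmf[of \<mu>])
    apply (subst bind_commute_pmf[of \<mu>])
    apply (subst bind_commute_pmf[of r])
    apply (rule refl)
    done
  have pt: "pmf (map_pmf (\<lambda>sd. advance sd (t, j)) \<mu>) (s, d) =
     pmf \<mu> (s - along (int t) ((quarter_turn ^^ (4 - j)) d), (quarter_turn ^^ (4 - j)) d)" if "j \<le> 4" for t j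
  proof -
    have "(s, d) = advance (s - along (int t) ((quarter_turn ^^ (4 - j)) d), (quarter_turn ^^ (4 - j)) d) (t, j)"
      using that by (simp add: advance_def quarter_turn_back)
    then show ?thesis using pmf_map_inj'[OF inj_advance[OF that]] by metis
  qed
  have r: "pmf (bind_pmf r (\<lambda>t. map_pmf (\<lambda>sd. advance sd (t, j)) \<mu>)) (s, d) =
     (\<Sum>t<M. pmf r t * pmf \<mu> (s - along (int t) ((quarter_turn ^^ (4 - j)) d), (quarter_turn ^^ (4 - j)) d))" if "j \<le> 4" for j
    unfolding pmf_bind pt[OF that]
    by (subst integral_measure_pmf[of "{..<M}"]) (use M in \<open>auto simp: set_pmf_iff not_le[symmetric]\<close>)
  show ?thesis unfolding swap pmf_bind[of turn_law] expectation_turn_law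
    using r[of 1] r[of 2] r[of 3] by (simp add: numeral_eq_Suc)
qed

text \<open>The laws \<open>f\<close> and \<open>g\<close> of the position on the events of facing \<open>v\<close> and \<open>-v\<close>. On entering the axis
  of \<open>v\<close> the sign is a fair coin, which gives the common symmetric part \<open>A\<close>. As long as the
  walk stays on this axis the sign alternates, and the lengths of the legs enter with
  alternating signs; pairs of them form symmetric differences, and at most one leg, in the
  direction opposite to the current one, remains unpaired. It is responsible for the second
  summand.\<close>
definition alternating_form :: "nat pmf \<Rightarrow> nat \<Rightarrow> (site \<Rightarrow> real) \<Rightarrow> (site \<Rightarrow> real) \<Rightarrow> site \<Rightarrow> bool" where
  "alternating_form r M f g v \<longleftrightarrow> (\<exists>A B. unimodal A \<and> unimodal B \<and>
     (\<forall>s. f s = A s + (\<Sum>t<M. pmf r t * B (s + along (int t) v))) \<and>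
     (\<forall>s. g s = A s + (\<Sum>t<M. pmf r t * B (s - along (int t) v))))"

lemma sum_weighted_add:
  "(\<Sum>t<M. (r t::real) * (f t + (\<Sum>t'<M. r t' * g t t'))) = (\<Sum>t<M. r t * f t) + (\<Sum>t<M. r t * (\<Sum>t'<M. r t' * g t t'))"
  by (simp add: distrib_left sum.distrib)

lemma quarter_turn_powers:
  "(quarter_turn ^^ 1) (a, b) = (- b, a)" "(quarter_turn ^^ 2) (a, b) = (- a, - b)" "(quarter_turn ^^ 3) (a, b) = (b, - a)"
  by (simp_all add: numeral_eq_Suc quarter_turn_def)

text \<open>A fair sign along the axis of \<open>v\<close> makes the initial law symmetric. An actual start with a given
  direction reaches such a state by a turn to the other axis.\<close>
definition signed_start :: "site \<Rightarrow> site \<Rightarrow> walk_state pmf" where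
  "signed_start z v = map_pmf (\<lambda>b. (z, if b then v else - v)) (bernoulli_pmf (1/2))"

lemma pmf_signed_start:
  assumes "v \<noteq> - v"
  shows "pmf (signed_start z v) (s, d) = of_bool (s = z) * of_bool (d = v \<or> d = - v) / 2"
  unfolding signed_start_def map_pmf_def pmf_bind
  using assms by (auto simp: indicator_def)

text \<open>The law of the position after the next leg on the event that this leg is along the axis of \<open>v\<close>.\<close>
definition cross_law :: "nat pmf \<Rightarrow> nat \<Rightarrow> walk_state pmf \<Rightarrow> site \<Rightarrow> site \<Rightarrow> real" where
  "cross_law r M \<mu> v s = (\<Sum>t<M. pmf r t * pmf \<mu> (s - along (int t) v, v)) + (\<Sum>t<M. pmf r t * pmf \<mu> (s + along (int t) v, - v))"

context
  fixes r :: "nat pmf" and M :: nat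
  assumes dec: "\<And>n. pmf r (Suc n) \<le> pmf r n" and M: "\<And>n. n \<ge> M \<Longrightarrow> pmf r n = 0"
begin

text \<open>The difference of two independent variables with the same law is symmetric.\<close>
lemma conv_difference_swap:
  "(\<Sum>t<M. pmf r t * (\<Sum>t'<M. pmf r t' * f (s - along (int t) v + along (int t') v)))
   = (\<Sum>t<M. pmf r t * (\<Sum>t'<M. pmf r t' * f (s + along (int t) v - along (int t') v)))"
  unfolding sum_distrib_left
  by (subst sum.swap) (simp add: algebra_simps)

text \<open>In the next leg the unpaired leg is completed to a symmetric difference, and the common
  part is convolved with a symmetrized waiting time.\<close>
lemma alternating_form_cross:
  assumes "alternating_form r M f g v" and v: "v = (1, 0) \<or> v = (0, 1)"
  shows "unimodal (\<lambda>s. (\<Sum>t<M. pmf r t * f (s - along (int t) v)) + (\<Sum>t<M. pmf r t * g (s + along (int t) v)))"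
proof -
  obtain A B where AB: "unimodal A" "unimodal B"
    "f = (\<lambda>s. A s + (\<Sum>t<M. pmf r t * B (s + along (int t) v)))"
    "g = (\<lambda>s. A s + (\<Sum>t<M. pmf r t * B (s - along (int t) v)))"
    using assms(1) unfolding alternating_form_def by blast
  let ?D = "\<lambda>s. \<Sum>t<M. pmf r t * (\<Sum>t'<M. pmf r t' * B (s + along (int t) v - along (int t') v))"
  have "(\<Sum>t<M. pmf r t * f (s - along (int t) v)) + (\<Sum>t<M. pmf r t * g (s + along (int t) v))
    = ((\<Sum>t<M. pmf r t * A (s + along (int t) v)) + (\<Sum>t<M. pmf r t * A (s - along (int t) v))) + (?D s + ?D s)" for s
    unfolding AB(3,4) sum_weighted_add conv_difference_swap by simp
  moreover have "unimodal \<dots>"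
    by (intro unimodal_add unimodal_conv_symmetrized unimodal_conv_difference AB v dec M) auto
  ultimately show ?thesis by simp
qed

text \<open>The walk faces \<open>v\<close> after a turn either because it faced \<open>-v\<close> before and reversed, or because
  it came from the other axis; the latter contributes \<open>m\<close>, equally to both signs.\<close>
lemma alternating_form_step:
  assumes "alternating_form r M f g v" and v: "v = (1, 0) \<or> v = (0, 1)" and m: "unimodal m"
  shows "alternating_form r M
     (\<lambda>s. ((\<Sum>t<M. pmf r t * g (s + along (int t) v)) + m s) / 3)
     (\<lambda>s. ((\<Sum>t<M. pmf r t * f (s - along (int t) v)) + m s) / 3) v"
proof -
  obtain A B where AB: "unimodal A" "unimodal B"
    "f = (\<lambda>s. A s + (\<Sum>t<M. pmf r t * B (s + along (int t) v)))"
    "g = (\<lambda>s. A s + (\<Sum>t<M. pmf r t * B (s - along (int t) v)))"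
    using assms(1) unfolding alternating_form_def by blast
  let ?D = "\<lambda>s. \<Sum>t<M. pmf r t * (\<Sum>t'<M. pmf r t' * B (s + along (int t) v - along (int t') v))"
  show ?thesis unfolding alternating_form_def
  proof (intro exI conjI allI)
    show "unimodal (\<lambda>s. 1/3 * (m s + ?D s))" "unimodal (\<lambda>s. 1/3 * A s)"
      by (intro unimodal_mult unimodal_add unimodal_conv_difference AB v dec M m; simp)+
    fix s
    show "((\<Sum>t<M. pmf r t * g (s + along (int t) v)) + m s) / 3 =
      1/3 * (m s + ?D s) + (\<Sum>t<M. pmf r t * (1/3 * A (s + along (int t) v)))"
      unfolding AB(4) sum_weighted_add by (simp add: sum_divide_distrib add_divide_distrib)
    show "((\<Sum>t<M. pmf r t * f (s - along (int t) v)) + m s) / 3 =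
      1/3 * (m s + ?D s) + (\<Sum>t<M. pmf r t * (1/3 * A (s - along (int t) v)))"
      unfolding AB(3) sum_weighted_add conv_difference_swap by (simp add: sum_divide_distrib add_divide_distrib)
  qed
qed

lemma pmf_walk_from_Suc:
  assumes "v = (1, 0) \<and> w = (0, 1) \<or> v = (0, 1) \<and> w = (1, 0)"
  shows "pmf (walk_from r \<mu> (Suc k)) (s, v) =
      ((\<Sum>t<M. pmf r t * pmf (walk_from r \<mu> k) (s + along (int t) v, - v)) + cross_law r M (walk_from r \<mu> k) w s) / 3"
    "pmf (walk_from r \<mu> (Suc k)) (s, - v) =
      ((\<Sum>t<M. pmf r t * pmf (walk_from r \<mu> k) (s - along (int t) v, v)) + cross_law r M (walk_from r \<mu> k) w s) / 3"
proof -
  have adv: "pmf (walk_from r \<mu> (Suc k)) (s, d)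
    = ((\<Sum>t<M. pmf r t * pmf (walk_from r \<mu> k) (s - along (int t) ((quarter_turn ^^ 1) d), (quarter_turn ^^ 1) d))
     + (\<Sum>t<M. pmf r t * pmf (walk_from r \<mu> k) (s - along (int t) ((quarter_turn ^^ 2) d), (quarter_turn ^^ 2) d))
     + (\<Sum>t<M. pmf r t * pmf (walk_from r \<mu> k) (s - along (int t) ((quarter_turn ^^ 3) d), (quarter_turn ^^ 3) d))) / 3" for s d
    unfolding walk_from.simps by (rule pmf_advance) (rule M)
  show "pmf (walk_from r \<mu> (Suc k)) (s, v) =
      ((\<Sum>t<M. pmf r t * pmf (walk_from r \<mu> k) (s + along (int t) v, - v)) + cross_law r M (walk_from r \<mu> k) w s) / 3"
    "pmf (walk_from r \<mu> (Suc k)) (s, - v) =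
      ((\<Sum>t<M. pmf r t * pmf (walk_from r \<mu> k) (s - along (int t) v, v)) + cross_law r M (walk_from r \<mu> k) w s) / 3"
  unfolding adv cross_law_def using assms
  by (auto simp: quarter_turn_powers quarter_turn_def along_def minus_prod_def plus_prod_def algebra_simps)
qed

lemma walk_from_alternating_form:
  assumes \<mu>: "\<mu> = signed_start z v0" and v0: "v0 \<in> {(1, 0), (0, 1)}"
    and v: "v \<in> {(1, 0), (0, 1)}"
  shows "alternating_form r M (\<lambda>s. pmf (walk_from r \<mu> k) (z + s, v)) (\<lambda>s. pmf (walk_from r \<mu> k) (z + s, - v)) v"
  using v
proof (induction k arbitrary: v)
  case 0
  have "v0 \<noteq> - v0" using v0 by auto
  note p = pmf_signed_start[OF this]
  have "alternating_form r M (\<lambda>s. of_bool (v = v0) / 2 * of_bool (s = (0,0))) (\<lambda>s. of_bool (v = v0) / 2 * of_bool (s = (0,0))) v"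
    unfolding alternating_form_def
    by (intro exI[of _ "\<lambda>s. of_bool (v = v0) / 2 * of_bool (s = (0,0))"] exI[of _ "\<lambda>s. 0 * of_bool (s = (0,0))"] conjI unimodal_point) auto
  moreover have eqs: "pmf (walk_from r \<mu> 0) (z + s, v) = of_bool (v = v0) / 2 * of_bool (s = (0,0))"
     "pmf (walk_from r \<mu> 0) (z + s, - v) = of_bool (v = v0) / 2 * of_bool (s = (0,0))" for s
    unfolding walk_from.simps \<mu> p using 0 v0 by (auto simp: prod_eq_iff)
  ultimately show ?case by (simp only: eqs)
next
  case (Suc k)
  obtain w :: "site" where w: "w \<in> {(1, 0), (0, 1)}" "v = (1, 0) \<and> w = (0, 1) \<or> v = (0, 1) \<and> w = (1, 0)"
    using Suc.prems by auto
  have v': "v = (1, 0) \<or> v = (0, 1)" and w': "w = (1, 0) \<or> w = (0, 1)" using Suc.prems w by auto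
  have m: "unimodal (\<lambda>s. cross_law r M (walk_from r \<mu> k) w (z + s))"
    using alternating_form_cross[OF Suc.IH[OF w(1)] w'] unfolding cross_law_def
    by (simp add: algebra_simps)
  show ?case
    using alternating_form_step[OF Suc.IH[OF Suc.prems] v' m]
    unfolding pmf_walk_from_Suc[OF w(2)] by (simp add: algebra_simps)
qed

lemma unimodal_cross_law:
  assumes \<mu>: "\<mu> = signed_start z v0" and v0: "v0 \<in> {(1, 0), (0, 1)}" and w: "w \<in> {(1, 0), (0, 1)}"
  shows "unimodal (\<lambda>s. cross_law r M (walk_from r \<mu> k) w (z + s))"
proof -
  have w': "w = (1, 0) \<or> w = (0, 1)" using w by auto
  show ?thesis
    using alternating_form_cross[OF walk_from_alternating_form[OF \<mu> v0 w] w'] unfolding cross_law_def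
    by (simp add: algebra_simps)
qed

end

section \<open>Second moment of the walk\<close>

lemma expectation_bind_finite:
  fixes f :: "'b \<Rightarrow> real"
  assumes "finite (set_pmf M)" "\<And>x. x \<in> set_pmf M \<Longrightarrow> finite (set_pmf (N x))"
  shows "mean (bind_pmf M N) f
    = mean M (\<lambda>x. mean (N x) f)"
  using pmf_expectation_bind[of "set_pmf M" N M f] assms
    integral_measure_pmf[of "set_pmf M" M "\<lambda>x. mean (N x) f"] by simp

lemma finite_set_turn_law [simp]: "finite (set_pmf turn_law)"
  by (simp add: turn_law_def)

lemma expectation_leg_law:
  fixes f :: "nat \<times> nat \<Rightarrow> real"
  assumes "finite (set_pmf r)"
  shows "mean (leg_law r) f
    = mean r (\<lambda>t. mean turn_law (\<lambda>j. f (t, j)))"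
  unfolding pair_pmf_def using assms by (subst expectation_bind_finite; simp add: expectation_bind_finite)

definition sq_dist :: "site \<Rightarrow> walk_state \<Rightarrow> real" where
  "sq_dist z sd = (real_of_int (fst (fst sd) - fst z))\<^sup>2 + (real_of_int (snd (fst sd) - snd z))\<^sup>2"

text \<open>The component of the displacement from \<open>z\<close> in the current direction; its mean controls
  the growth of the mean squared distance.\<close>
definition drift :: "site \<Rightarrow> walk_state \<Rightarrow> real" where
  "drift z sd = real_of_int (fst (fst sd) - fst z) * real_of_int (fst (snd sd))
    + real_of_int (snd (fst sd) - snd z) * real_of_int (snd (snd sd))"

context
  fixes r :: "nat pmf" and z v0 :: "site"
  assumes fin: "finite (set_pmf r)" and v0: "v0 \<in> {(1, 0), (0, 1)}"
begin

abbreviation "walk \<equiv> walk_from r (signed_start z v0)"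

lemma set_walk_axis: "sd \<in> set_pmf (walk k) \<Longrightarrow> snd sd \<in> axis_directions"
proof (induction k arbitrary: sd)
  case 0
  then show ?case using v0 by (auto simp: signed_start_def axis_directions_def split: if_splits)
next
  case (Suc k)
  then show ?case by (auto simp: advance_def intro!: quarter_turn_axis)
qed

lemma finite_walk: "finite (set_pmf (walk k))"
  by (induction k) (auto simp: signed_start_def fin)

lemma expectation_walk_Suc:
  "mean (walk (Suc k)) f = mean (walk k) (\<lambda>sd.
     mean r (\<lambda>t. mean turn_law (\<lambda>j. f (advance sd (t, j)) :: real)))"
  unfolding walk_from.simps
  by (subst expectation_bind_finite) (simp_all add: finite_walk fin expectation_leg_law)

text \<open>The mean of the three directions that differ from the current one is \<open>-1/3\<close> times the current
  direction. Hence the mean of \<open>drift\<close> is never positive, and the mean squared distance grows by at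
  most \<open>E T\<^sup>2\<close> with each leg.\<close>
lemma second_moment:
  "mean (walk k) (sq_dist z) \<le> real k * mean r (\<lambda>t. (real t)\<^sup>2)"
proof -
  define m1 where "m1 = mean r real"
  define m2 where "m2 = mean r (\<lambda>t. (real t)\<^sup>2)"
  have int_r: "integrable r (f :: nat \<Rightarrow> real)" for f by (rule integrable_measure_pmf_finite[OF fin])
  have int_w: "integrable (walk k) (f :: _ \<Rightarrow> real)" for f k by (rule integrable_measure_pmf_finite[OF finite_walk])
  have m1: "m1 \<ge> 0" unfolding m1_def by simp
  have sq: "mean (walk (Suc k)) (sq_dist z)
     = mean (walk k) (sq_dist z) + 2 * m1 * mean (walk k) (drift z) + m2" for k
  proof -
    have "mean (walk (Suc k)) (sq_dist z) = mean (walk k)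
       (\<lambda>sd. sq_dist z sd + 2 * m1 * drift z sd + m2)"
      unfolding expectation_walk_Suc
    proof (intro integral_cong_AE AE_pmfI)
      fix sd assume "sd \<in> set_pmf (walk k)"
      then have "snd sd \<in> axis_directions" by (rule set_walk_axis)
      then have n: "(real_of_int (fst (snd sd)))\<^sup>2 + (real_of_int (snd (snd sd)))\<^sup>2 = 1"
        by (auto simp: axis_directions_def)
      have "sq_dist z (advance sd (t, j)) = sq_dist z sd + real t * (2 * drift z sd) + (real t)\<^sup>2" for t j
      proof -
        have "sq_dist z (advance sd (t, j)) = sq_dist z sd + real t * (2 * drift z sd)
           + (real t)\<^sup>2 * ((real_of_int (fst (snd sd)))\<^sup>2 + (real_of_int (snd (snd sd)))\<^sup>2)"
          by (simp add: sq_dist_def drift_def advance_def along_def power2_eq_square algebra_simps)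
        then show ?thesis using n by simp
      qed
      then show "mean r (\<lambda>t. mean turn_law (\<lambda>j. sq_dist z (advance sd (t, j))))
        = sq_dist z sd + 2 * m1 * drift z sd + m2"
        by (simp add: int_r m1_def m2_def mult_ac)
    qed auto
    then show ?thesis by (simp add: int_w)
  qed
  have dr: "mean (walk (Suc k)) (drift z) = - (mean (walk k) (drift z) + m1) / 3" for k
  proof -
    have "mean (walk (Suc k)) (drift z) = mean (walk k)
       (\<lambda>sd. - (drift z sd + m1) / 3)"
      unfolding expectation_walk_Suc
    proof (intro integral_cong_AE AE_pmfI)
      fix sd assume "sd \<in> set_pmf (walk k)"
      then have "snd sd \<in> axis_directions" by (rule set_walk_axis)
      then have n: "(real_of_int (fst (snd sd))) * (real_of_int (fst (snd sd))) + (real_of_int (snd (snd sd))) * (real_of_int (snd (snd sd))) = 1"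
        by (auto simp: axis_directions_def)
      have "mean turn_law (\<lambda>j. drift z (advance sd (t, j))) = - (drift z sd + real t) / 3" for t
      proof -
        have "mean turn_law (\<lambda>j. drift z (advance sd (t, j))) =
          - (drift z sd + real t * (real_of_int (fst (snd sd)) * real_of_int (fst (snd sd)) + real_of_int (snd (snd sd)) * real_of_int (snd (snd sd)))) / 3"
          unfolding expectation_turn_law
          by (simp add: drift_def advance_def along_def numeral_eq_Suc quarter_turn_def field_simps)
        then show ?thesis using n by simp
      qed
      then show "mean r (\<lambda>t. mean turn_law (\<lambda>j. drift z (advance sd (t, j))))
        = - (drift z sd + m1) / 3"
        by (simp add: int_r m1_def diff_divide_distrib)
    qed auto
    then show ?thesis by (simp add: int_w)
  qed
  have d: "- m1 \<le> mean (walk k) (drift z) \<and> mean (walk k) (drift z) \<le> 0" for k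
  proof (induction k)
    case 0
    have "mean (walk 0) (drift z) = 0"
      by (simp add: signed_start_def drift_def)
    then show ?case using m1 by simp
  next
    case (Suc k)
    then show ?case unfolding dr using m1 by simp
  qed
  show ?thesis unfolding m2_def[symmetric]
  proof (induction k)
    case 0
    show ?case by (simp add: signed_start_def sq_dist_def)
  next
    case (Suc k)
    have "2 * m1 * mean (walk k) (drift z) \<le> 0"
      using d[of k] m1 by (simp add: mult_nonneg_nonpos)
    then show ?case unfolding sq using Suc by (simp add: algebra_simps)
  qed
qed

lemma prob_far:
  assumes "R > 0"
  shows "prob_of (walk k) {sd. \<not> (\<bar>real_of_int (fst (fst sd) - fst z)\<bar> \<le> R \<and> \<bar>real_of_int (snd (fst sd) - snd z)\<bar> \<le> R)}
    \<le> real k * mean r (\<lambda>t. (real t)\<^sup>2) / R\<^sup>2" (is "prob_of _ ?F \<le> _")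
proof -
  have int_w: "integrable (walk k) (f :: _ \<Rightarrow> real)" for f k by (rule integrable_measure_pmf_finite[OF finite_walk])
  have "prob_of (walk k) ?F = mean (walk k) (indicator ?F)" by simp
  also have "\<dots> \<le> mean (walk k) (\<lambda>sd. sq_dist z sd / R\<^sup>2)"
  proof (intro integral_mono int_w)
    fix sd
    have "R\<^sup>2 \<le> sq_dist z sd" if "sd \<in> ?F"
    proof -
      have le: "R\<^sup>2 \<le> x\<^sup>2 + y\<^sup>2" if "\<not> \<bar>x\<bar> \<le> R" for x y :: real
        using power_mono[of R "\<bar>x\<bar>" 2] that assms by (simp add: add_increasing2)
      show ?thesis
        using that le[of "real_of_int (fst (fst sd) - fst z)" "real_of_int (snd (fst sd) - snd z)"]
          le[of "real_of_int (snd (fst sd) - snd z)" "real_of_int (fst (fst sd) - fst z)"]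
        unfolding sq_dist_def by auto
    qed
    moreover have "0 \<le> sq_dist z sd" by (simp add: sq_dist_def)
    ultimately show "indicator ?F sd \<le> sq_dist z sd / R\<^sup>2"
      using assms by (auto simp: indicator_def)
  qed
  also have "\<dots> = mean (walk k) (sq_dist z) / R\<^sup>2" by simp
  also have "\<dots> \<le> real k * mean r (\<lambda>t. (real t)\<^sup>2) / R\<^sup>2"
    by (intro divide_right_mono second_moment) simp
  finally show ?thesis .
qed

text \<open>One or two of the three possible turns lead to a given axis.\<close>
lemma prob_axis_le:
  assumes "w \<in> {(1, 0), (0, 1)}"
  shows "prob_of (walk (Suc k)) {sd. snd sd = w \<or> snd sd = - w} \<le> 2 / 3"
proof -
  let ?A = "{sd. snd sd = w \<or> snd sd = - w}"
  have "prob_of (walk (Suc k)) ?A = mean (walk (Suc k)) (indicator ?A)" by simp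
  also have "\<dots> \<le> 2 / 3"
    unfolding expectation_walk_Suc
  proof (rule expectation_le_const)
    fix sd assume "sd \<in> set_pmf (walk k)"
    then have "snd sd \<in> axis_directions" by (rule set_walk_axis)
    then have le: "mean turn_law (\<lambda>j. indicator ?A (advance sd (t, j))) \<le> (2 / 3 :: real)" for t
      unfolding expectation_turn_law using assms
      by (auto simp: advance_def axis_directions_def numeral_eq_Suc quarter_turn_def indicator_def)
    show "mean r (\<lambda>t. mean turn_law (\<lambda>j. indicator ?A (advance sd (t, j)))) \<le> (2 / 3 :: real)"
      by (rule expectation_le_const, rule le) simp
  qed simp
  finally show ?thesis .
qed

end

section \<open>A local lower bound for the walk\<close>

lemma power_le_inverse_linear:
  fixes x :: real
  assumes "0 \<le> x" "x \<le> 1"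
  shows "(1 - x) ^ k \<le> 1 / (1 + real k * x)"
proof -
  have "(1 - x) ^ k * (1 + real k * x) \<le> (1 - x) ^ k * (1 + x) ^ k"
    using assms by (intro mult_left_mono Bernoulli_inequality) auto
  also have "\<dots> = (1 - x\<^sup>2) ^ k"
    by (simp add: power_mult_distrib[symmetric] power2_eq_square algebra_simps)
  also have "\<dots> \<le> 1" using assms by (intro power_le_one) (auto simp: power_le_one)
  finally show ?thesis using assms by (simp add: field_simps add_pos_nonneg)
qed

lemma card_int_box_le:
  fixes A B :: real and a b :: int
  assumes "A \<ge> 1" "B \<ge> 1"
  defines "X \<equiv> {s :: site. \<bar>real_of_int (fst s - a)\<bar> \<le> A \<and> \<bar>real_of_int (snd s - b)\<bar> \<le> B}"
  shows "finite X" "real (card X) \<le> 9 * A * B"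
proof -
  have X: "X = {a - \<lfloor>A\<rfloor>..a + \<lfloor>A\<rfloor>} \<times> {b - \<lfloor>B\<rfloor>..b + \<lfloor>B\<rfloor>}"
    unfolding X_def by (auto simp: abs_le_iff) linarith+
  then show "finite X" by simp
  have 1: "real (card {c - \<lfloor>C\<rfloor>..c + \<lfloor>C\<rfloor>}) \<le> 3 * C" if "C \<ge> 1" for c :: int and C :: real
    using that by (simp, linarith)
  have "real (card X) = real (card {a - \<lfloor>A\<rfloor>..a + \<lfloor>A\<rfloor>}) * real (card {b - \<lfloor>B\<rfloor>..b + \<lfloor>B\<rfloor>})"
    unfolding X by (simp only: card_cartesian_product of_nat_mult)
  also have "\<dots> \<le> (3 * A) * (3 * B)" using assms by (intro mult_mono 1) auto
  finally show "real (card X) \<le> 9 * A * B" by simp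
qed

lemma sum_pmf_inj_le:
  assumes "finite Q" "inj_on f Q" "f ` Q \<subseteq> A"
  shows "(\<Sum>s\<in>Q. pmf \<mu> (f s)) \<le> prob_of \<mu> A"
proof -
  have "(\<Sum>s\<in>Q. pmf \<mu> (f s)) = (\<Sum>x\<in>f ` Q. pmf \<mu> x)" using assms by (simp add: sum.reindex)
  also have "\<dots> = prob_of \<mu> (f ` Q)" using assms by (intro measure_measure_pmf_finite[symmetric]) simp
  also have "\<dots> \<le> prob_of \<mu> A" using assms by (intro measure_pmf.finite_measure_mono) auto
  finally show ?thesis .
qed

text \<open>Each state before the leg contributes at most its own mass.\<close>
lemma cross_law_mass_le:
  assumes "finite Q" "w \<noteq> - w"
  shows "(\<Sum>s\<in>Q. cross_law r M \<mu> w (z + s)) \<le> prob_of \<mu> {sd. snd sd = w \<or> snd sd = - w}"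
proof -
  let ?P = "\<lambda>d. prob_of \<mu> {sd. snd sd = d}"
  have r1: "(\<Sum>t<M. pmf r t) \<le> 1"
    using measure_measure_pmf_finite[of "{..<M}" r] measure_pmf.prob_le_1[of r "{..<M}"] by simp
  have "(\<Sum>s\<in>Q. cross_law r M \<mu> w (z + s)) =
    (\<Sum>t<M. pmf r t * (\<Sum>s\<in>Q. pmf \<mu> (z + s - along (int t) w, w))) +
    (\<Sum>t<M. pmf r t * (\<Sum>s\<in>Q. pmf \<mu> (z + s + along (int t) w, - w)))"
    unfolding cross_law_def sum.distrib sum_distrib_left
    by (simp add: sum.swap[of _ Q])
  also have "\<dots> \<le> (\<Sum>t<M. pmf r t * ?P w) + (\<Sum>t<M. pmf r t * ?P (- w))"
    by (intro add_mono sum_mono mult_left_mono sum_pmf_inj_le) (auto simp: inj_on_def assms)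
  also have "\<dots> = (\<Sum>t<M. pmf r t) * (?P w + ?P (- w))"
    by (simp add: sum_distrib_right distrib_left sum.distrib)
  also have "\<dots> \<le> 1 * (?P w + ?P (- w))" by (intro mult_right_mono r1) simp
  also have "?P w + ?P (- w) = prob_of \<mu> ({sd. snd sd = w} \<union> {sd. snd sd = - w})"
    using assms(2) by (intro measure_pmf.finite_measure_Union[symmetric]) auto
  also have "{sd. snd sd = w} \<union> {sd. snd sd = - w} = {sd. snd sd = w \<or> snd sd = - w}" by auto
  finally show ?thesis by simp
qed

context
  fixes r \<pi> :: "nat pmf" and W :: "nat \<Rightarrow> nat pmf" and n h :: nat and z v0 :: "site"
  assumes mixture: "r = bind_pmf \<pi> W" and W: "W n = pmf_of_set {..<2 * h}" and h: "h > 0"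
    and dec: "\<And>t. pmf r (Suc t) \<le> pmf r t" and supp: "\<And>t. t \<ge> 2 * h \<Longrightarrow> pmf r t = 0"
    and moment: "mean r (\<lambda>t. (real t)\<^sup>2) \<le> 8 * pmf \<pi> n * (real h)\<^sup>2"
    and v0: "v0 \<in> {(1, 0), (0, 1)}"
begin

lemma finite_support: "finite (set_pmf r)"
proof (rule finite_subset)
  show "set_pmf r \<subseteq> {..<2 * h}" using supp by (auto simp: set_pmf_iff not_le[symmetric])
qed simp

text \<open>The bound of \<open>prob_walk_position_le\<close> does not depend on the initial state.\<close>
lemma prob_walk_from_le:
  assumes "finite A"
  shows "prob_of (walk_from r (signed_start z v0) (Suc k)) {sd. fst sd \<in> A}
    \<le> 2 * (1 - pmf \<pi> n/3) ^ k + 2 * (real (card A) / (real h)\<^sup>2) / (1 + pmf \<pi> n * real k / 6)"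
  unfolding walk_from_eq prob_bind_pmf
proof (rule expectation_le_const)
  fix sd assume "sd \<in> set_pmf (signed_start z v0)"
  then have d: "snd sd \<in> axis_directions"
    using v0 by (auto simp: signed_start_def axis_directions_def split: if_splits)
  show "prob_of (walk_law r (Suc k) sd) {sd. fst sd \<in> A}
    \<le> 2 * (1 - pmf \<pi> n/3) ^ k + 2 * (real (card A) / (real h)\<^sup>2) / (1 + pmf \<pi> n * real k / 6)"
    using prob_walk_position_le[OF mixture W h d assms, of k "fst sd"] by simp
qed simp

text \<open>A unimodal function is, near the origin, at least its average over any set of points farther out
  in both coordinates. The set used here is a square of half-width \<open>R = 9 h sqrt (q K)\<close> without
  the strips of half-width \<open>4 h\<close> around the axes: by the second moment little mass lies outside the
  square, and by the concentration bound little lies in the strips. What is averaged is the law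
  of arriving at time \<open>K\<close> along the other axis, for one third of which the walk then faces \<open>v\<close>.\<close>
theorem pmf_walk_from_ge:
  assumes K: "K \<ge> 2" and X: "pmf \<pi> n * real K \<ge> 10 ^ 10"
    and v: "v \<in> {(1, 0), (0, 1)}" and s0: "\<bar>fst s0\<bar> \<le> 4 * int h" "\<bar>snd s0\<bar> \<le> 4 * int h"
  shows "pmf (walk_from r (signed_start z v0) K) (z + s0, v) \<ge> 1 / (19683 * (real h)\<^sup>2 * (pmf \<pi> n * real K))"
proof -
  let ?q = "pmf \<pi> n"
  let ?\<mu> = "walk_from r (signed_start z v0)"
  obtain k' where k': "K = Suc (Suc k')" using K by (metis add_2_eq_Suc le_Suc_ex)
  define k where "k = Suc k'"
  have Kk: "K = Suc k" using k' k_def by simp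
  obtain w :: "site" where w: "w \<in> {(1, 0), (0, 1)}" "v = (1, 0) \<and> w = (0, 1) \<or> v = (0, 1) \<and> w = (1, 0)"
    using v by auto
  have q: "0 \<le> ?q" "?q \<le> 1" by (auto simp: pmf_le_1)
  define X where "X = ?q * real K"
  have X10: "X \<ge> 10 ^ 10" using X unfolding X_def .
  define m where "m d s = cross_law r (2 * h) (?\<mu> k) d (z + s)" for d s
  have uni: "unimodal (m w)" unfolding m_def
    by (rule unimodal_cross_law[OF dec supp refl v0 w(1)])
  have rec: "pmf (?\<mu> (Suc k)) (s, a) =
      ((\<Sum>t<2 * h. pmf r t * pmf (?\<mu> k) (s + along (int t) a, - a)) + cross_law r (2 * h) (?\<mu> k) b s) / 3"
    "pmf (?\<mu> (Suc k)) (s, - a) =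
      ((\<Sum>t<2 * h. pmf r t * pmf (?\<mu> k) (s - along (int t) a, a)) + cross_law r (2 * h) (?\<mu> k) b s) / 3"
    if "a = (1, 0) \<and> b = (0, 1) \<or> a = (0, 1) \<and> b = (1, 0)" for a b s
    by (rule pmf_walk_from_Suc[OF dec _ that]; use supp in blast)+
  \<comment> \<open>with \<open>E T\<^sup>2 \<le> 8 q h\<^sup>2\<close>, Chebyshev leaves mass at most 8/81 outside the square of half-width \<open>R\<close>\<close>
  define R where "R = 9 * real h * sqrt X"
  have Xpos: "X > 0" using X10 by (rule less_le_trans[rotated]) simp
  have sX: "sqrt X \<ge> 10 ^ 5" using X10 by (intro real_le_rsqrt) simp
  have h1: "real h \<ge> 1" using h by simp
  have R1: "R \<ge> 1"
  proof -
    have "1 * 1 \<le> (9 * real h) * sqrt X" using sX h1 X10 by (intro mult_mono) simp_all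
    then show ?thesis unfolding R_def by simp
  qed
  have R2: "R\<^sup>2 = 81 * (real h)\<^sup>2 * X" unfolding R_def using X10 by (simp add: power_mult_distrib)
  define Q where "Q = {s :: site. \<bar>real_of_int (fst s - 0)\<bar> \<le> R \<and> \<bar>real_of_int (snd s - 0)\<bar> \<le> R
     \<and> 4 * int h \<le> \<bar>fst s\<bar> \<and> 4 * int h \<le> \<bar>snd s\<bar>}"
  define Far where "Far = {sd :: walk_state. \<not> (\<bar>real_of_int (fst (fst sd) - fst z)\<bar> \<le> R \<and> \<bar>real_of_int (snd (fst sd) - snd z)\<bar> \<le> R)}"
  define A1 where "A1 = {s :: site. \<bar>real_of_int (fst s - fst z)\<bar> \<le> 4 * real h \<and> \<bar>real_of_int (snd s - snd z)\<bar> \<le> R}"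
  define A2 where "A2 = {s :: site. \<bar>real_of_int (fst s - fst z)\<bar> \<le> R \<and> \<bar>real_of_int (snd s - snd z)\<bar> \<le> 4 * real h}"
  have finQ: "finite Q" and cardQ: "real (card Q) \<le> 9 * R\<^sup>2"
  proof -
    note b = card_int_box_le[OF R1 R1, of 0 0]
    have sub: "Q \<subseteq> {s :: site. \<bar>real_of_int (fst s - 0)\<bar> \<le> R \<and> \<bar>real_of_int (snd s - 0)\<bar> \<le> R}"
      unfolding Q_def by auto
    show "finite Q" by (rule finite_subset[OF sub b(1)])
    show "real (card Q) \<le> 9 * R\<^sup>2"
      using card_mono[OF b(1) sub] b(2) unfolding power2_eq_square by (simp add: mult.assoc)
  qed
  have far: "prob_of (?\<mu> K) Far \<le> 8 / 81"
  proof -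
    have "prob_of (?\<mu> K) Far \<le> real K * mean r (\<lambda>t. (real t)\<^sup>2) / R\<^sup>2"
      unfolding Far_def using R1 by (intro prob_far finite_support v0) simp
    also have "\<dots> \<le> real K * (8 * ?q * (real h)\<^sup>2) / R\<^sup>2"
      by (intro divide_right_mono mult_left_mono moment) auto
    also have "\<dots> = 8 / 81"
    proof -
      have "real K * (8 * ?q * (real h)\<^sup>2) = 8 * X * (real h)\<^sup>2" by (simp add: X_def)
      then show ?thesis unfolding R2 using Xpos h by simp
    qed
    finally show ?thesis .
  qed
  have thin: "prob_of (?\<mu> K) {sd. fst sd \<in> A} \<le> 1 / 20"
    if A: "finite A" "real (card A) \<le> 9 * (4 * real h) * R" for A
  proof -
    have kX: "1 + ?q * real k / 6 \<ge> X / 6" and kX3: "1 + real k * (?q / 3) \<ge> X / 3"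
      using q unfolding X_def Kk by (auto simp: algebra_simps)
    have "(1 - ?q/3) ^ k \<le> 1 / (1 + real k * (?q / 3))"
      using q by (intro power_le_inverse_linear) auto
    also have "\<dots> \<le> 1 / (X / 3)" using kX3 X10 by (intro divide_left_mono) auto
    also have "\<dots> \<le> 3 / 10 ^ 10" using X10 by (simp add: field_simps)
    finally have 1: "(1 - ?q/3) ^ k \<le> 3 / 10 ^ 10" .
    have "2 * (real (card A) / (real h)\<^sup>2) / (1 + ?q * real k / 6) \<le> 2 * ((9 * (4 * real h) * R) / (real h)\<^sup>2) / (X / 6)"
      using kX A(2) X10 by (intro frac_le mult_left_mono divide_right_mono) auto
    also have "\<dots> = 3888 * sqrt X / X"
      unfolding R_def using h1 by (simp add: power2_eq_square field_simps)
    also have "\<dots> = 3888 / sqrt X"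
      using X10 by (simp add: real_div_sqrt field_simps)
    also have "\<dots> \<le> 3888 / 10 ^ 5" using sX Xpos by (intro divide_left_mono) auto
    finally have 2: "2 * (real (card A) / (real h)\<^sup>2) / (1 + ?q * real k / 6) \<le> 3888 / 10 ^ 5" .
    show ?thesis using prob_walk_from_le[OF A(1), of k] 1 2 unfolding Kk by simp
  qed
  have h4: "4 * real h \<ge> 1" using h1 by simp
  have thin1: "prob_of (?\<mu> K) {sd. fst sd \<in> A1} \<le> 1 / 20"
    using card_int_box_le[OF h4 R1, of "fst z" "snd z"] unfolding A1_def by (intro thin) (simp_all add: mult_ac)
  have thin2: "prob_of (?\<mu> K) {sd. fst sd \<in> A2} \<le> 1 / 20"
    using card_int_box_le[OF R1 h4, of "fst z" "snd z"] unfolding A2_def by (intro thin) (simp_all add: mult_ac)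
  define inQ where "inQ = {sd :: walk_state. fst sd - z \<in> Q}"
  have cover: "1 - 8/81 - 1/20 - 1/20 \<le> prob_of (?\<mu> K) inQ"
  proof -
    let ?B = "(Far \<union> {sd. fst sd \<in> A1}) \<union> {sd. fst sd \<in> A2}"
    have conv: "\<bar>real_of_int a\<bar> \<le> 4 * real h \<longleftrightarrow> \<bar>a\<bar> \<le> 4 * int h" for a
    proof -
      have "\<bar>real_of_int a\<bar> \<le> 4 * real h \<longleftrightarrow> real_of_int \<bar>a\<bar> \<le> real_of_int (4 * int h)" by simp
      then show ?thesis by (simp only: of_int_le_iff)
    qed
    have "sd \<in> inQ" if "sd \<notin> Far" "fst sd \<notin> A1" "fst sd \<notin> A2" for sd
      using that unfolding inQ_def Q_def Far_def A1_def A2_def conv by simp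
    then have "inQ \<union> ?B = UNIV" by blast
    then have "1 = prob_of (?\<mu> K) (inQ \<union> ?B)"
      using measure_pmf.prob_space[of "?\<mu> K"] by simp
    also have "\<dots> \<le> prob_of (?\<mu> K) inQ + prob_of (?\<mu> K) ?B"
      by (rule measure_Un_le) auto
    also have "prob_of (?\<mu> K) ?B \<le> prob_of (?\<mu> K) (Far \<union> {sd. fst sd \<in> A1}) + prob_of (?\<mu> K) {sd. fst sd \<in> A2}"
      by (rule measure_Un_le) auto
    also have "prob_of (?\<mu> K) (Far \<union> {sd. fst sd \<in> A1}) \<le> prob_of (?\<mu> K) Far + prob_of (?\<mu> K) {sd. fst sd \<in> A1}"
      by (rule measure_Un_le) auto
    finally show ?thesis using far thin1 thin2 by linarith
  qed
  have split: "prob_of (?\<mu> K) inQ \<le> (\<Sum>s\<in>Q. m w s) + (\<Sum>s\<in>Q. m v s)"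
  proof -
    let ?D = "{v, - v, w, - w}"
    have D: "axis_directions = ?D" "distinct [v, - v, w, - w]"
      using w(2) by (elim disjE conjE; simp add: axis_directions_def insert_commute)+
    have "prob_of (?\<mu> K) inQ \<le> prob_of (?\<mu> K) ((\<lambda>(s, d). (z + s, d)) ` (Q \<times> ?D))"
    proof (rule measure_pmf.finite_measure_mono_AE)
      show "AE sd in ?\<mu> K. sd \<in> inQ \<longrightarrow> sd \<in> (\<lambda>(s, d). (z + s, d)) ` (Q \<times> ?D)"
      proof (rule AE_pmfI, rule impI)
        fix sd assume sd: "sd \<in> set_pmf (?\<mu> K)" "sd \<in> inQ"
        have "snd sd \<in> ?D" using set_walk_axis[OF finite_support v0 sd(1)] D by simp
        moreover have "sd = (z + (fst sd - z), snd sd)" by simp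
        ultimately show "sd \<in> (\<lambda>(s, d). (z + s, d)) ` (Q \<times> ?D)"
          using sd(2) unfolding inQ_def by (intro image_eqI[of _ _ "(fst sd - z, snd sd)"]) auto
      qed
    qed simp
    also have "\<dots> = (\<Sum>x\<in>(\<lambda>(s, d). (z + s, d)) ` (Q \<times> ?D). pmf (?\<mu> K) x)"
      using finQ by (intro measure_measure_pmf_finite) auto
    also have "\<dots> = (\<Sum>(s, d)\<in>Q \<times> ?D. pmf (?\<mu> K) (z + s, d))"
      by (subst sum.reindex) (auto simp: inj_on_def intro!: sum.cong)
    also have "\<dots> = (\<Sum>s\<in>Q. \<Sum>d\<in>?D. pmf (?\<mu> K) (z + s, d))"
      by (rule sum.cartesian_product[symmetric])
    also have "\<dots> = (\<Sum>s\<in>Q. m w s + m v s)"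
    proof (intro sum.cong refl)
      fix s
      have w2: "w = (1, 0) \<and> v = (0, 1) \<or> w = (0, 1) \<and> v = (1, 0)" using w(2) by auto
      have "(\<Sum>d\<in>?D. pmf (?\<mu> K) (z + s, d)) = pmf (?\<mu> K) (z + s, v) + pmf (?\<mu> K) (z + s, - v)
        + pmf (?\<mu> K) (z + s, w) + pmf (?\<mu> K) (z + s, - w)"
        using D(2) by simp
      also have "\<dots> = m w s + m v s"
        unfolding Kk rec[OF w(2)] rec[OF w2] m_def
        by (simp add: cross_law_def field_simps)
      finally show "(\<Sum>d\<in>?D. pmf (?\<mu> K) (z + s, d)) = m w s + m v s" .
    qed
    finally show ?thesis by (simp add: sum.distrib)
  qed
  have "v \<noteq> - v" using v by auto
  then have "(\<Sum>s\<in>Q. m v s) \<le> prob_of (?\<mu> k) {sd. snd sd = v \<or> snd sd = - v}"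
    unfolding m_def by (intro cross_law_mass_le finQ)
  also have "\<dots> \<le> 2 / 3" unfolding k_def by (rule prob_axis_le[OF finite_support v0 v])
  finally have mass: "1 / 9 \<le> (\<Sum>s\<in>Q. m w s)" using cover split by linarith
  also have "\<dots> \<le> (\<Sum>s\<in>Q. m w s0)"
  proof (rule sum_mono)
    fix s assume "s \<in> Q"
    then show "m w s \<le> m w s0"
      using unimodalD[OF uni, of "fst s0" "fst s" "snd s0" "snd s"] s0 unfolding Q_def by simp
  qed
  also have "\<dots> = real (card Q) * m w s0" by simp
  also have "\<dots> \<le> 9 * R\<^sup>2 * m w s0"
    by (intro mult_right_mono cardQ unimodal_nonneg uni)
  finally have "1 / 9 * 9 \<le> (9 * R\<^sup>2 * m w s0) * 9" by (intro mult_right_mono) auto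
  then have "1 \<le> m w s0 * (81 * R\<^sup>2)" by (simp add: mult_ac)
  moreover have "81 * R\<^sup>2 > 0" using R1 by simp
  ultimately have lower: "1 / (81 * R\<^sup>2) \<le> m w s0" by (simp only: pos_divide_le_eq)
  have upper: "m w s0 / 3 \<le> pmf (?\<mu> K) (z + s0, v)"
    unfolding Kk rec(1)[OF w(2)] m_def
    by (simp add: sum_nonneg)
  have le: "1 / (81 * R\<^sup>2) / 3 \<le> pmf (?\<mu> K) (z + s0, v)"
    by (rule order_trans[OF divide_right_mono[OF lower] upper]) simp
  have "1 / (81 * R\<^sup>2) / 3 = 1 / (19683 * (real h)\<^sup>2 * (?q * real K))"
    unfolding R2 X_def by simp
  with le show ?thesis by (simp only:)
qed

end

section \<open>Crossing the origin within one phase\<close>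

definition crosses_origin :: "walk_state \<Rightarrow> nat \<Rightarrow> bool" where
  "crosses_origin sd t \<longleftrightarrow> (\<exists>x. 1 \<le> x \<and> x \<le> t \<and> fst sd + along (int x) (snd sd) = (0, 0))"

text \<open>The probability that one of the first \<open>N\<close> legs crosses the origin.\<close>
primrec hit_prob :: "nat pmf \<Rightarrow> nat \<Rightarrow> walk_state \<Rightarrow> real" where
  "hit_prob p 0 sd = 0"
| "hit_prob p (Suc N) sd = mean (leg_law p)
     (\<lambda>x. if crosses_origin sd (fst x) then 1 else hit_prob p N (advance sd x))"

lemma hit_prob_bounds: "0 \<le> hit_prob p N sd \<and> hit_prob p N sd \<le> 1"
proof (induction N arbitrary: sd)
  case (Suc N)
  have "0 \<le> hit_prob p (Suc N) sd" using Suc by (auto intro!: integral_nonneg)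
  moreover have "hit_prob p (Suc N) sd \<le> 1"
    unfolding hit_prob.simps by (rule expectation_le_const) (use Suc in auto)
  ultimately show ?case by simp
qed simp

lemma integrable_pmf_nonneg:
  fixes f :: "'a \<Rightarrow> real"
  assumes "\<And>x. 0 \<le> f x" "\<And>x. f x \<le> B"
  shows "integrable (measure_pmf M) f"
  by (rule integrable_pmf_bounded[where B=B]) (use assms in \<open>simp add: abs_of_nonneg\<close>)

text \<open>The positions and directions from which a leg of length at least \<open>h\<close> certainly crosses the
  origin.\<close>
definition near_origin :: "nat \<Rightarrow> walk_state \<Rightarrow> bool" where
  "near_origin h sd \<longleftrightarrow> (\<exists>x. 1 \<le> x \<and> x \<le> h \<and> fst sd + along (int x) (snd sd) = (0, 0))"

lemma advance_axis: "snd sd \<in> axis_directions \<Longrightarrow> snd (advance sd x) \<in> axis_directions"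
  by (simp add: advance_def quarter_turn_axis)

text \<open>The expected number of crossings of the origin by legs of length at least \<open>h\<close>, from starting
  points at distance at most \<open>h\<close>.\<close>
definition mean_crossings :: "nat pmf \<Rightarrow> nat \<Rightarrow> nat \<Rightarrow> walk_state \<Rightarrow> real" where
  "mean_crossings p h N sd = prob_of p {h..} * (\<Sum>k<N. prob_of (walk_law p k sd) {sd. near_origin h sd})"

lemma mean_crossings_nonneg: "0 \<le> mean_crossings p h N sd"
  unfolding mean_crossings_def by (auto intro!: mult_nonneg_nonneg sum_nonneg)

lemma mean_crossings_le: "mean_crossings p h N sd \<le> real N"
proof -
  have "(\<Sum>k<N. prob_of (walk_law p k sd) {sd. near_origin h sd}) \<le> (\<Sum>k<N. 1)"
    by (intro sum_mono) simp
  then show ?thesis unfolding mean_crossings_def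
    using mult_mono[of "prob_of p {h..}" 1 "\<Sum>k<N. prob_of (walk_law p k sd) {sd. near_origin h sd}" "real N"]
    by (simp add: sum_nonneg)
qed

lemma mean_crossings_Suc:
  "mean_crossings p h (Suc N) sd = mean (leg_law p)
     (\<lambda>x. of_bool (h \<le> fst x \<and> near_origin h sd) + mean_crossings p h N (advance sd x))"
proof -
  have i1: "integrable (leg_law p) (\<lambda>x. of_bool (h \<le> fst x \<and> near_origin h sd) :: real)"
    by (rule integrable_pmf_nonneg[where B=1]) auto
  have i2: "integrable (leg_law p) (\<lambda>x. prob_of p {h..} * (\<Sum>k<N. prob_of (walk_law p k (advance sd x)) {sd. near_origin h sd}))"
    by (rule integrable_pmf_nonneg[where B="real N"])
       (use mean_crossings_nonneg mean_crossings_le in \<open>auto simp: mean_crossings_def\<close>)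
  have 1: "mean (leg_law p) (\<lambda>x. of_bool (h \<le> fst x \<and> near_origin h sd) :: real) =
     prob_of p {h..} * of_bool (near_origin h sd)"
  proof -
    have "mean (leg_law p) (\<lambda>x. of_bool (h \<le> fst x \<and> near_origin h sd) :: real) =
      mean (leg_law p) (\<lambda>x. indicator {h..} (fst x) * of_bool (near_origin h sd))"
      by (intro Bochner_Integration.integral_cong refl) (auto simp: indicator_def)
    also have "\<dots> = mean p (\<lambda>t. indicator {h..} t * of_bool (near_origin h sd))"
      using expectation_pair_pmf_fst[of p turn_law "\<lambda>t. indicator {h..} t * of_bool (near_origin h sd) :: real"] by simp
    also have "\<dots> = prob_of p {h..} * of_bool (near_origin h sd)" by simp
    finally show ?thesis .
  qed
  have "mean_crossings p h (Suc N) sd = prob_of p {h..} * of_bool (near_origin h sd) +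
    prob_of p {h..} * (\<Sum>k<N. prob_of (walk_law p (Suc k) sd) {sd. near_origin h sd})"
    unfolding mean_crossings_def sum.lessThan_Suc_shift by (simp add: distrib_left indicator_def)
  also have "(\<Sum>k<N. prob_of (walk_law p (Suc k) sd) {sd. near_origin h sd}) =
     mean (leg_law p) (\<lambda>x. \<Sum>k<N. prob_of (walk_law p k (advance sd x)) {sd. near_origin h sd})"
    unfolding walk_law.simps prob_bind_pmf
    by (subst Bochner_Integration.integral_sum) (auto intro!: integrable_pmf_nonneg[where B=1])
  also have "prob_of p {h..} * of_bool (near_origin h sd) + prob_of p {h..} * \<dots> =
    mean (leg_law p) (\<lambda>x. of_bool (h \<le> fst x \<and> near_origin h sd) + mean_crossings p h N (advance sd x))"
    unfolding mean_crossings_def Bochner_Integration.integral_add[OF i1 i2] 1 by simp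
  finally show ?thesis .
qed

text \<open>Decompose at the first crossing: after it, at most \<open>V\<close> further crossings are expected. So
  many expected crossings can only come from a likely crossing, provided that no starting state
  gives much more of them.\<close>
lemma mean_crossings_le_hit_prob:
  assumes V: "\<And>n sd. n \<le> N \<Longrightarrow> snd sd \<in> axis_directions \<Longrightarrow> mean_crossings p h n sd \<le> V" and V0: "0 \<le> V"
    and "snd sd \<in> axis_directions"
  shows "mean_crossings p h N sd \<le> (1 + V) * hit_prob p N sd"
  using V \<open>snd sd \<in> axis_directions\<close>
proof (induction N arbitrary: sd)
  case 0
  then show ?case by (simp add: mean_crossings_def)
next
  case (Suc N)
  have "mean_crossings p h (Suc N) sd \<le> mean (leg_law p)
     (\<lambda>x. (1 + V) * (if crosses_origin sd (fst x) then 1 else hit_prob p N (advance sd x)))"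
    unfolding mean_crossings_Suc
  proof (rule integral_mono)
    show "integrable (leg_law p) (\<lambda>x. of_bool (h \<le> fst x \<and> near_origin h sd) + mean_crossings p h N (advance sd x))"
      by (rule integrable_pmf_nonneg[where B="1 + real N"])
         (use add_mono[OF _ mean_crossings_le] in \<open>simp_all add: mean_crossings_nonneg\<close>)
    show "integrable (leg_law p) (\<lambda>x. (1 + V) * (if crosses_origin sd (fst x) then 1 else hit_prob p N (advance sd x)))"
      by (rule integrable_pmf_nonneg[where B="1 + V"]) (use V0 hit_prob_bounds in \<open>auto intro: mult_left_le\<close>)
    fix x :: "nat \<times> nat"
    have ax: "snd (advance sd x) \<in> axis_directions" using Suc.prems by (intro advance_axis)
    show "of_bool (h \<le> fst x \<and> near_origin h sd) + mean_crossings p h N (advance sd x)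
      \<le> (1 + V) * (if crosses_origin sd (fst x) then 1 else hit_prob p N (advance sd x))"
    proof (cases "crosses_origin sd (fst x)")
      case True
      have "mean_crossings p h N (advance sd x) \<le> V" using Suc.prems(1) ax by simp
      then show ?thesis using True by (simp add: of_bool_def)
    next
      case False
      then have "\<not> (h \<le> fst x \<and> near_origin h sd)"
        unfolding crosses_origin_def near_origin_def by (meson order_trans)
      then have z: "of_bool (h \<le> fst x \<and> near_origin h sd) = (0 :: real)" by simp
      have "mean_crossings p h N (advance sd x) \<le> (1 + V) * hit_prob p N (advance sd x)"
        using Suc.prems(1) ax by (intro Suc.IH) auto
      then show ?thesis using False unfolding z by simp
    qed
  qed
  then show ?case by simp
qed

lemma harmonic_ge:
  assumes "0 < a" "a \<le> b"
  shows "ln (real b) - ln (real a) \<le> (\<Sum>k\<in>{a..<b}. 1 / real k)"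
  using assms(2)
proof (induction b rule: dec_induct)
  case (step k)
  then have k: "real k > 0" using assms(1) by simp
  have "ln (real (Suc k)) - ln (real k) = ln (1 + 1 / real k)"
  proof -
    have "1 + 1 / real k = real (Suc k) / real k" using k by (simp add: field_simps)
    then show ?thesis using k by (simp add: ln_div)
  qed
  also have "\<dots> \<le> 1 / real k" using k by (intro ln_add_one_self_le_self) simp
  finally show ?case using step by simp
qed auto

lemma harmonic_le: "(\<Sum>i<N. 1 / (real i + 1)) \<le> 1 + ln (real (max 1 N))"
proof (induction N)
  case (Suc N)
  show ?case
  proof (cases "N = 0")
    case False
    have "ln (real N) - ln (real N + 1) = ln (real N / (real N + 1))" using False by (subst ln_div) auto
    also have "\<dots> \<le> real N / (real N + 1) - 1" using False by (intro ln_le_minus_one) simp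
    also have "\<dots> = - (1 / (real N + 1))" by (simp add: field_simps)
    finally show ?thesis using Suc False by (simp add: add.commute max_def)
  qed simp
qed simp

text \<open>The positions lie on the two axes, at distance at most \<open>h\<close>.\<close>
lemma near_origin_subset:
  "\<exists>A. finite A \<and> card A \<le> 4 * h \<and> (\<forall>sd. snd sd \<in> axis_directions \<longrightarrow> near_origin h sd \<longrightarrow> fst sd \<in> A)"
proof -
  define A where "A = (\<Union>d\<in>axis_directions. (\<lambda>x. along (- int x) d) ` {1..h})"
  have fin: "finite axis_directions" and c: "card axis_directions = 4" by (auto simp: axis_directions_def)
  have "card A \<le> (\<Sum>d\<in>axis_directions. card ((\<lambda>x. along (- int x) d) ` {1..h}))"
    unfolding A_def by (rule card_UN_le[OF fin])
  also have "\<dots> \<le> (\<Sum>d\<in>axis_directions. h)"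
    by (intro sum_mono) (use card_image_le[of "{1..h}"] in auto)
  finally have "card A \<le> 4 * h" using c by simp
  moreover have "fst sd \<in> A" if "snd sd \<in> axis_directions" "near_origin h sd" for sd
    using that unfolding near_origin_def A_def
    by (auto simp: along_def prod_eq_iff intro!: bexI[of _ "snd sd"] image_eqI)
  moreover have "finite A" unfolding A_def using fin by auto
  ultimately show ?thesis by blast
qed

lemma set_walk_law_axis: "sd' \<in> set_pmf (walk_law p k sd) \<Longrightarrow> snd sd \<in> axis_directions \<Longrightarrow> snd sd' \<in> axis_directions"
proof (induction k arbitrary: sd)
  case (Suc k)
  then obtain x where "sd' \<in> set_pmf (walk_law p k (advance sd x))" by auto
  then show ?case using Suc.IH Suc.prems(2) advance_axis by blast
qed simp

context
  fixes r \<pi> :: "nat pmf" and W :: "nat \<Rightarrow> nat pmf" and n h :: nat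
  assumes mixture: "r = bind_pmf \<pi> W" and W: "W n = pmf_of_set {..<2 * h}" and h: "h > 0"
    and q0: "pmf \<pi> n > 0"
    and half: "prob_of r {h..} = pmf \<pi> n / 2"
begin

lemma prob_near_origin_le:
  assumes d: "snd sd \<in> axis_directions"
  shows "prob_of (walk_law r (Suc k) sd) {sd. near_origin h sd} \<le>
     2 * (1 - pmf \<pi> n/3) ^ k + 48 / (real h * pmf \<pi> n) * (1 / (real k + 1))"
proof -
  let ?q = "pmf \<pi> n"
  obtain A where A: "finite A" "card A \<le> 4 * h" "\<And>sd. snd sd \<in> axis_directions \<Longrightarrow> near_origin h sd \<Longrightarrow> fst sd \<in> A"
    using near_origin_subset by metis
  have q1: "?q \<le> 1" by (simp add: pmf_le_1)
  have "prob_of (walk_law r (Suc k) sd) {sd. near_origin h sd}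
    \<le> prob_of (walk_law r (Suc k) sd) {sd. fst sd \<in> A}"
    by (rule measure_pmf.finite_measure_mono_AE)
       (auto intro!: AE_pmfI A(3) dest: set_walk_law_axis[OF _ d])
  also have "\<dots> \<le> 2 * (1 - ?q/3) ^ k + 2 * (real (card A) / (real h)\<^sup>2) / (1 + ?q * real k / 6)"
    using prob_walk_position_le[OF mixture W h d A(1), of k "fst sd"] by simp
  also have "2 * (real (card A) / (real h)\<^sup>2) / (1 + ?q * real k / 6) \<le> 2 * ((4 * real h) / (real h)\<^sup>2) / (?q * (real k + 1) / 6)"
  proof (intro frac_le)
    have "real (card A) \<le> 4 * real h" using A(2) by (metis of_nat_mono of_nat_mult of_nat_numeral)
    then show "2 * (real (card A) / (real h)\<^sup>2) \<le> 2 * ((4 * real h) / (real h)\<^sup>2)"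
      by (intro mult_left_mono divide_right_mono) auto
    show "?q * (real k + 1) / 6 \<le> 1 + ?q * real k / 6" using q1 by (simp add: algebra_simps)
    show "0 < ?q * (real k + 1) / 6" using q0 by simp
  qed simp
  also have "\<dots> = 48 / (real h * ?q) * (1 / (real k + 1))"
    using h q0 by (simp add: power2_eq_square field_simps)
  finally show ?thesis by simp
qed

text \<open>A long leg has probability \<open>q / 2\<close> and at most \<open>4 h\<close> possible starting points, each with
  probability of the order of \<open>1 / (h\<^sup>2 q k)\<close> at time \<open>k\<close>. The sum over \<open>k\<close> is of the order of
  \<open>ln N / h\<close>, so \<open>N = 2 ^ h\<close> legs are the right number to consider. The contribution of the
  legs before each coordinate has been spread out is bounded by a geometric series.\<close>
lemma mean_crossings_le_const:
  assumes N: "N \<le> 2 ^ h" and d: "snd sd \<in> axis_directions"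
  shows "mean_crossings r h N sd \<le> 52"
proof -
  let ?q = "pmf \<pi> n"
  let ?f = "\<lambda>k. prob_of (walk_law r k sd) {sd. near_origin h sd}"
  have q1: "?q \<le> 1" by (simp add: pmf_le_1)
  have "(\<Sum>k<N. ?f k) \<le> (\<Sum>k<Suc N. ?f k)" by simp
  also have "\<dots> = ?f 0 + (\<Sum>k<N. ?f (Suc k))" by (rule sum.lessThan_Suc_shift)
  also have "\<dots> \<le> 1 + (\<Sum>k<N. 2 * (1 - ?q/3) ^ k + 48 / (real h * ?q) * (1 / (real k + 1)))"
    by (intro add_mono sum_mono prob_near_origin_le d) (simp only: measure_pmf.prob_le_1)
  also have "\<dots> = 1 + 2 * (\<Sum>k<N. (1 - ?q/3) ^ k) + 48 / (real h * ?q) * (\<Sum>k<N. 1 / (real k + 1))"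
    by (simp add: sum.distrib sum_distrib_left)
  also have "\<dots> \<le> 1 + 2 * (3 / ?q) + 48 / (real h * ?q) * (1 + real h)"
  proof (intro add_mono mult_left_mono order_refl)
    have "(1 - ?q/3) ^ N \<ge> 0" using q1 by simp
    then show "(\<Sum>k<N. (1 - ?q/3) ^ k) \<le> 3 / ?q"
      using q0 by (subst sum_gp_strict) (auto simp: field_simps)
    have "max 1 N \<le> 2 ^ h" using N by simp
    then have "real (max 1 N) \<le> real (2 ^ h)" by (simp only: of_nat_le_iff)
    then have "ln (real (max 1 N)) \<le> ln (2 ^ h)" by (intro ln_mono) simp_all
    also have "\<dots> \<le> real h"
      using ln_2_less_1 by (simp add: ln_realpow mult_left_le)
    finally show "(\<Sum>k<N. 1 / (real k + 1)) \<le> 1 + real h" using harmonic_le[of N] by linarith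
  qed (use q0 in auto)
  finally have "mean_crossings r h N sd \<le> ?q / 2 * (1 + 2 * (3 / ?q) + 48 / (real h * ?q) * (1 + real h))"
    unfolding mean_crossings_def half using q0 by (intro mult_left_mono) auto
  also have "\<dots> = ?q / 2 + 3 + 24 / real h + 24"
    using q0 h by (simp add: field_simps)
  also have "\<dots> \<le> 1 / 2 + 3 + 24 + 24"
    using q1 h by (intro add_mono) (auto simp: field_simps)
  finally show ?thesis by simp
qed

context
  assumes dec: "\<And>t. pmf r (Suc t) \<le> pmf r t" and supp: "\<And>t. t \<ge> 2 * h \<Longrightarrow> pmf r t = 0"
    and moment: "mean r (\<lambda>t. (real t)\<^sup>2) \<le> 8 * pmf \<pi> n * (real h)\<^sup>2"
begin

text \<open>With probability 2/3 the first turn leads to the other axis, with a fair sign, and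
  then \<open>pmf_walk_from_ge\<close> applies to each of the \<open>h\<close> points from which an eastward leg crosses the
  origin. The first leg moves the starting point by less than \<open>2 h\<close>; this is why that bound
  needs to hold up to distance \<open>4 h\<close>.\<close>
lemma prob_near_origin_ge:
  assumes d: "d \<in> axis_directions" and s: "\<bar>fst s\<bar> \<le> int h" "\<bar>snd s\<bar> \<le> int h"
    and K: "K \<ge> 2" and X: "pmf \<pi> n * real K \<ge> 10 ^ 10"
  shows "2 / (59049 * real h * (pmf \<pi> n * real K)) \<le> prob_of (walk_law r (Suc K) (s, d)) {sd. near_origin h sd}"
proof -
  let ?P = "\<lambda>z d. prob_of (walk_law r K (z, d)) {sd. near_origin h sd}"
  define w :: "site" where "w = (if d \<in> horizontal_directions then (0, 1) else (1, 0))"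
  have w: "w \<in> {(1, 0), (0, 1)}" by (simp add: w_def)
  have perp: "(quarter_turn ^^ 1) d = w \<and> (quarter_turn ^^ 3) d = - w \<or> (quarter_turn ^^ 1) d = - w \<and> (quarter_turn ^^ 3) d = w"
    using d by (auto simp: w_def axis_directions_def horizontal_directions_def numeral_eq_Suc quarter_turn_def)
  have point: "1 / (19683 * real h * (pmf \<pi> n * real K)) \<le> (?P z w + ?P z (- w)) / 2"
    if z: "\<bar>fst z\<bar> \<le> 3 * int h" "\<bar>snd z\<bar> \<le> 3 * int h" for z
  proof -
    let ?\<mu> = "walk_from r (signed_start z w) K"
    have "real h * (1 / (19683 * (real h)\<^sup>2 * (pmf \<pi> n * real K))) \<le> (\<Sum>x\<in>{1..h}. pmf ?\<mu> ((- int x, 0), (1, 0)))"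
    proof -
      have "1 / (19683 * (real h)\<^sup>2 * (pmf \<pi> n * real K)) \<le> pmf ?\<mu> ((- int x, 0), (1, 0))" if "x \<in> {1..h}" for x
      proof -
        have "\<bar>fst ((- int x, 0) - z)\<bar> \<le> 4 * int h" "\<bar>snd ((- int x, 0) - z)\<bar> \<le> 4 * int h"
          using z that by auto
        from pmf_walk_from_ge[OF mixture W h dec supp moment w K X _ this, of "(1, 0)" z]
        show ?thesis by simp
      qed
      then have "(\<Sum>x\<in>{1..h}. 1 / (19683 * (real h)\<^sup>2 * (pmf \<pi> n * real K))) \<le> (\<Sum>x\<in>{1..h}. pmf ?\<mu> ((- int x, 0), (1, 0)))"
        by (intro sum_mono)
      then show ?thesis by simp
    qed
    also have "\<dots> \<le> prob_of ?\<mu> {sd. near_origin h sd}"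
      by (intro sum_pmf_inj_le) (auto simp: inj_on_def near_origin_def zero_prod_def)
    also have "\<dots> = (?P z w + ?P z (- w)) / 2"
      unfolding walk_from_eq prob_bind_pmf signed_start_def by simp
    finally show ?thesis using h by (simp add: power2_eq_square field_simps)
  qed
  let ?F = "\<lambda>t j. ?P (s + along (int t) d) ((quarter_turn ^^ j) d)"
  have fin: "finite (set_pmf r)" by (rule finite_support[OF mixture W h dec supp moment w])
  have "2 / (59049 * real h * (pmf \<pi> n * real K)) = mean r (\<lambda>t. 2 / (59049 * real h * (pmf \<pi> n * real K)))"
    by simp
  also have "\<dots> \<le> mean r (\<lambda>t. mean turn_law (?F t))"
  proof (intro integral_mono_AE AE_pmfI integrable_measure_pmf_finite fin)
    fix t assume "t \<in> set_pmf r"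
    then have t: "t < 2 * h" using supp by (auto simp: set_pmf_iff not_le[symmetric])
    have "\<bar>fst (s + along (int t) d)\<bar> \<le> 3 * int h" "\<bar>snd (s + along (int t) d)\<bar> \<le> 3 * int h"
      using d s t by (auto simp: axis_directions_def)
    note pt = point[OF this]
    have "2 / (59049 * real h * (pmf \<pi> n * real K)) = 2 / 3 * (1 / (19683 * real h * (pmf \<pi> n * real K)))" by simp
    also have "\<dots> \<le> 2 / 3 * ((?P (s + along (int t) d) w + ?P (s + along (int t) d) (- w)) / 2)"
      using pt by (intro mult_left_mono) auto
    also have "\<dots> \<le> (?F t 1 + ?F t 2 + ?F t 3) / 3"
      using perp by auto
    finally show "2 / (59049 * real h * (pmf \<pi> n * real K)) \<le> mean turn_law (?F t)"
      unfolding expectation_turn_law .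
  qed
  also have "\<dots> = prob_of (walk_law r (Suc K) (s, d)) {sd. near_origin h sd}"
    unfolding walk_law.simps prob_bind_pmf expectation_leg_law[OF fin] by (simp add: advance_def)
  finally show ?thesis .
qed

text \<open>The lower bound \<open>c / (h k)\<close> for the probability of a crossing in leg \<open>k\<close>, summed over
  \<open>K \<le> k < 2 ^ h\<close>, gives a constant because \<open>K\<^sup>2 \<le> 2 ^ h\<close> leaves at least half of the logarithmic
  range.\<close>
theorem hit_prob_ge:
  assumes d: "d \<in> axis_directions" and s: "\<bar>fst s\<bar> \<le> int h" "\<bar>snd s\<bar> \<le> int h"
    and K: "K \<ge> 2" "pmf \<pi> n * real K \<ge> 10 ^ 10" "K ^ 2 \<le> 2 ^ h" "h \<ge> 8"
  shows "hit_prob r (2 ^ h) (s, d) \<ge> 1 / 10 ^ 8"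
proof -
  let ?q = "pmf \<pi> n" and ?N = "2 ^ h :: nat"
  let ?f = "\<lambda>k. prob_of (walk_law r k (s, d)) {sd. near_origin h sd}"
  have hpos: "real h > 0" using h by simp
  have lnK: "2 * ln (real K) \<le> real h * ln 2"
  proof -
    have "ln (real (K ^ 2)) \<le> ln (real (2 ^ h))" using K(1,3) by (subst ln_le_cancel_iff) (simp_all only: of_nat_le_iff, simp_all)
    then show ?thesis using K(1) by (simp add: ln_realpow)
  qed
  have KN: "K \<le> ?N - 1"
  proof -
    have "2 * K \<le> K ^ 2" using K(1) by (simp add: power2_eq_square)
    then show ?thesis using K by linarith
  qed
  have N1: "(real h - 1) * ln 2 \<le> ln (real (?N - 1))"
  proof -
    have "2 ^ (h - 1) \<le> ?N - 1"
      using \<open>h \<ge> 8\<close> by (cases h) auto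
    then have "real (2 ^ (h - 1)) \<le> real (?N - 1)" by (simp only: of_nat_le_iff)
    then have "ln (real (2 ^ (h - 1))) \<le> ln (real (?N - 1))" by (intro ln_mono) simp_all
    then show ?thesis using \<open>h \<ge> 8\<close> by (simp add: ln_realpow of_nat_diff)
  qed
  have ln2: "ln 2 \<ge> (1/2 :: real)" using ln2_ge_two_thirds by simp
  have "real h / 8 \<le> (real h / 2 - 1) * (1 / 2)" using \<open>h \<ge> 8\<close> by simp
  also have "\<dots> \<le> (real h / 2 - 1) * ln 2" using \<open>h \<ge> 8\<close> ln2 by (intro mult_left_mono) auto
  also have "\<dots> \<le> ln (real (?N - 1)) - ln (real K)" using lnK N1 by (simp add: algebra_simps)
  also have "\<dots> \<le> (\<Sum>k\<in>{K..<?N - 1}. 1 / real k)" using KN K(1) by (intro harmonic_ge) auto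
  finally have "1 / (59049 * real h) * (real h / 8) \<le> 1 / (59049 * real h) * (\<Sum>k\<in>{K..<?N - 1}. 1 / real k)"
    using hpos by (intro mult_left_mono) auto
  then have "1 / 472392 \<le> (\<Sum>k\<in>{K..<?N - 1}. 1 / (59049 * real h) * (1 / real k))"
    using hpos by (simp add: sum_distrib_left)
  also have "\<dots> \<le> (\<Sum>k\<in>{K..<?N - 1}. ?q / 2 * ?f (Suc k))"
  proof (intro sum_mono)
    fix k assume k: "k \<in> {K..<?N - 1}"
    then have "?q * real K \<le> ?q * real k" using q0 by simp
    then have X: "?q * real k \<ge> 10 ^ 10" using K(2) by linarith
    have k2: "k \<ge> 2" using k K(1) by simp
    have "1 / (59049 * real h) * (1 / real k) = ?q / 2 * (2 / (59049 * real h * (?q * real k)))"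
      using q0 k2 by (simp add: field_simps)
    also have "\<dots> \<le> ?q / 2 * ?f (Suc k)"
      using q0 by (intro mult_left_mono prob_near_origin_ge d s k2 X) auto
    finally show "1 / (59049 * real h) * (1 / real k) \<le> ?q / 2 * ?f (Suc k)" .
  qed
  also have "\<dots> = (\<Sum>k\<in>Suc ` {K..<?N - 1}. ?q / 2 * ?f k)" by (subst sum.reindex) auto
  also have "\<dots> \<le> (\<Sum>k<?N. ?q / 2 * ?f k)" using q0 by (intro sum_mono2) auto
  also have "\<dots> = mean_crossings r h ?N (s, d)" unfolding mean_crossings_def half by (simp add: sum_distrib_left)
  also have "\<dots> \<le> (1 + 52) * hit_prob r ?N (s, d)"
    using d by (intro mean_crossings_le_hit_prob mean_crossings_le_const) auto
  finally show ?thesis by simp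
qed

end

end

section \<open>From one phase to almost sure crossing\<close>

definition in_box :: "nat \<Rightarrow> site \<Rightarrow> bool" where
  "in_box H s \<longleftrightarrow> \<bar>fst s\<bar> \<le> int H \<and> \<bar>snd s\<bar> \<le> int H"

lemma expectation_leg_law_bounded:
  fixes f :: "nat \<times> nat \<Rightarrow> real"
  assumes "\<And>x. 0 \<le> f x" "\<And>x. f x \<le> B"
  shows "mean (leg_law p) f = mean p (\<lambda>t. mean turn_law (\<lambda>j. f (t, j)))"
  unfolding pair_pmf_def using assms
  by (simp add: expectation_bind_pmf[of f B])

lemma integrable_hit:
  "integrable (leg_law p) (\<lambda>x. if crosses_origin sd (fst x) then 1 else hit_prob r N (advance sd x))"
  by (rule integrable_pmf_nonneg[where B=1]) (simp_all add: hit_prob_bounds)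

lemma hit_prob_mono: "hit_prob p N sd \<le> hit_prob p (Suc N) sd"
proof (induction N arbitrary: sd)
  case 0
  show ?case using hit_prob_bounds[of p 1 sd] by simp
next
  case (Suc N)
  show ?case
    by (subst (1 2) hit_prob.simps(2), intro integral_mono integrable_hit) (use Suc in auto)
qed

text \<open>If the law \<open>p\<close> contains the fraction \<open>\<kappa>\<close> of the law \<open>r\<close>, then \<open>N\<close> independent waiting times are
  all drawn from that fraction with probability \<open>\<kappa> ^ N\<close>.\<close>
lemma hit_prob_dominated:
  assumes dom: "\<And>f. (\<And>t. 0 \<le> f t) \<Longrightarrow> (\<And>t. f t \<le> 1) \<Longrightarrow>
      \<kappa> * mean r f \<le> mean p (f :: nat \<Rightarrow> real)"
    and \<kappa>: "0 \<le> \<kappa>" "\<kappa> \<le> 1"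
  shows "\<kappa> ^ N * hit_prob r N sd \<le> hit_prob p N sd"
proof (induction N arbitrary: sd)
  case (Suc N)
  let ?F = "\<lambda>p x. if crosses_origin sd (fst x) then 1 else hit_prob p N (advance sd x)"
  let ?G = "\<lambda>t. mean turn_law (\<lambda>j. ?F r (t, j))"
  have F: "0 \<le> ?F p x" "?F p x \<le> 1" for p x by (simp_all add: hit_prob_bounds)
  have G0: "0 \<le> ?G t" for t
    by (rule Bochner_Integration.integral_nonneg) (rule F)
  have G1: "?G t \<le> 1" for t by (rule expectation_le_const) (rule F)+
  have \<kappa>N: "0 \<le> \<kappa> ^ N" "\<kappa> ^ N \<le> 1" using \<kappa> by (auto intro: power_le_one)
  have "\<kappa> ^ Suc N * hit_prob r (Suc N) sd = \<kappa> ^ N * (\<kappa> * mean r ?G)"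
    by (simp add: expectation_leg_law_bounded[of "?F r" 1] F mult_ac)
  also have "\<dots> \<le> \<kappa> ^ N * mean p ?G"
    by (intro mult_left_mono dom G0 G1 \<kappa>N)
  also have "\<dots> = mean (leg_law p) (\<lambda>x. \<kappa> ^ N * ?F r x)"
    by (simp add: expectation_leg_law_bounded[of "?F r" 1] F)
  also have "\<dots> \<le> mean (leg_law p) (?F p)"
    by (intro integral_mono integrable_mult_right integrable_hit) (use Suc \<kappa>N in auto)
  finally show ?case by simp
qed simp

lemma miss_prob_Suc:
  "1 - hit_prob p (Suc N) sd = mean (leg_law p)
     (\<lambda>x. if crosses_origin sd (fst x) then 0 else 1 - hit_prob p N (advance sd x))"
proof -
  have "1 - hit_prob p (Suc N) sd = mean (leg_law p)
     (\<lambda>x. 1 - (if crosses_origin sd (fst x) then 1 else hit_prob p N (advance sd x)))"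
    by (subst Bochner_Integration.integral_diff) (auto simp: integrable_hit)
  also have "\<dots> = mean (leg_law p)
     (\<lambda>x. if crosses_origin sd (fst x) then 0 else 1 - hit_prob p N (advance sd x))"
    by (intro Bochner_Integration.integral_cong) auto
  finally show ?thesis .
qed

text \<open>If the walk has missed the origin for \<open>a\<close> legs and is then in the box, its next \<open>b\<close> legs
  miss with probability at most \<open>1 - c\<close>.\<close>
lemma miss_prob_add_le:
  assumes hit: "\<And>sd. snd sd \<in> axis_directions \<Longrightarrow> in_box H (fst sd) \<Longrightarrow> c \<le> hit_prob p b sd"
    and c: "0 \<le> c" "c \<le> 1" and "snd sd \<in> axis_directions"
  shows "1 - hit_prob p (a + b) sd
    \<le> (1 - c) * (1 - hit_prob p a sd) + prob_of (walk_law p a sd) {sd. \<not> in_box H (fst sd)}"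
  using \<open>snd sd \<in> axis_directions\<close>
proof (induction a arbitrary: sd)
  case 0
  show ?case using hit[OF 0] hit_prob_bounds[of p b sd] c by (auto simp: indicator_def)
next
  case (Suc a)
  let ?F = "\<lambda>x. if crosses_origin sd (fst x) then 0 else 1 - hit_prob p a (advance sd x)"
  let ?Fb = "\<lambda>x. if crosses_origin sd (fst x) then 0 else 1 - hit_prob p (a + b) (advance sd x)"
  let ?B = "\<lambda>x. prob_of (walk_law p a (advance sd x)) {sd. \<not> in_box H (fst sd)}"
  have int: "integrable (leg_law p) ?F" "integrable (leg_law p) ?Fb" "integrable (leg_law p) ?B"
    by (rule integrable_pmf_nonneg[where B=1]; simp add: hit_prob_bounds)+
  have "1 - hit_prob p (Suc a + b) sd = mean (leg_law p) ?Fb"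
    unfolding add_Suc by (rule miss_prob_Suc)
  also have "\<dots> \<le> mean (leg_law p) (\<lambda>x. (1 - c) * ?F x + ?B x)"
  proof (intro integral_mono Bochner_Integration.integrable_add integrable_mult_right int)
    fix x :: "nat \<times> nat"
    show "?Fb x \<le> (1 - c) * ?F x + ?B x"
      using Suc.IH[OF advance_axis[OF Suc.prems]] by simp
  qed
  also have "\<dots> = (1 - c) * mean (leg_law p) ?F + mean (leg_law p) ?B"
    using int by (subst Bochner_Integration.integral_add) auto
  also have "\<dots> = (1 - c) * (1 - hit_prob p (Suc a) sd) + prob_of (walk_law p (Suc a) sd) {sd. \<not> in_box H (fst sd)}"
    unfolding miss_prob_Suc walk_law.simps prob_bind_pmf ..
  finally show ?case .
qed

text \<open>Without a waiting time of length \<open>g\<close> or more the walk cannot get out.\<close>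
lemma prob_leave_box_le:
  assumes "d \<in> axis_directions" "\<bar>fst s\<bar> + int (g * a) \<le> int H" "\<bar>snd s\<bar> + int (g * a) \<le> int H"
  shows "prob_of (walk_law p a (s, d)) {sd. \<not> in_box H (fst sd)} \<le> real a * prob_of p {g..}"
  using assms
proof (induction a arbitrary: s d)
  case 0
  then show ?case by (simp add: in_box_def indicator_def)
next
  case (Suc a)
  let ?B = "\<lambda>x. prob_of (walk_law p a (advance (s, d) x)) {sd. \<not> in_box H (fst sd)}"
  have i1: "integrable (leg_law p) (\<lambda>x. indicator {g..} (fst x) :: real)"
    by (rule integrable_pmf_nonneg[where B=1]) (auto simp: indicator_def)
  have "prob_of (walk_law p (Suc a) (s, d)) {sd. \<not> in_box H (fst sd)} = mean (leg_law p) ?B"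
    by (simp only: walk_law.simps prob_bind_pmf)
  also have "\<dots> \<le> mean (leg_law p) (\<lambda>x. indicator {g..} (fst x) + real a * prob_of p {g..})"
  proof (intro integral_mono)
    show "integrable (leg_law p) ?B" by (rule integrable_pmf_nonneg[where B=1]) auto
    show "integrable (leg_law p) (\<lambda>x. indicator {g..} (fst x) + real a * prob_of p {g..})"
      using i1 by auto
    fix x :: "nat \<times> nat"
    show "?B x \<le> indicator {g..} (fst x) + real a * prob_of p {g..}"
    proof (cases "fst x < g")
      case True
      have ax: "snd (advance (s, d) x) \<in> axis_directions" using Suc.prems by (intro advance_axis) simp
      have "\<bar>fst (fst (advance (s, d) x))\<bar> \<le> \<bar>fst s\<bar> + int g" "\<bar>snd (fst (advance (s, d) x))\<bar> \<le> \<bar>snd s\<bar> + int g"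
        using Suc.prems(1) True by (auto simp: advance_def axis_directions_def)
      then have "\<bar>fst (fst (advance (s, d) x))\<bar> + int (g * a) \<le> int H" "\<bar>snd (fst (advance (s, d) x))\<bar> + int (g * a) \<le> int H"
        using Suc.prems(2,3) by (auto simp: algebra_simps)
      from Suc.IH[OF ax this] True show ?thesis by (simp add: indicator_def)
    next
      case False
      have "?B x \<le> 1" by simp
      also have "1 \<le> indicator {g..} (fst x) + real a * prob_of p {g..}" using False by simp
      finally show ?thesis .
    qed
  qed
  also have "\<dots> = mean (leg_law p) (\<lambda>x. indicator {g..} (fst x)) + real a * prob_of p {g..}"
    using i1 by simp
  also have "mean (leg_law p) (\<lambda>x. indicator {g..} (fst x)) = prob_of p {g..}"
    using expectation_pair_pmf_fst[of p turn_law "indicator {g..} :: nat \<Rightarrow> real"] by simp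
  finally show ?case by (simp add: algebra_simps)
qed

text \<open>The probability \<open>u n\<close> of missing the origin before phase \<open>n\<close> decreases to some \<open>L\<close>, and
  \<open>u (Suc n) \<le> (1 - c) * u n + o(1)\<close> gives \<open>L \<le> (1 - c) * L\<close>.\<close>
lemma hit_prob_tendsto_1:
  fixes a b H :: "nat \<Rightarrow> nat"
  assumes hit: "\<And>n sd. n \<ge> n0 \<Longrightarrow> snd sd \<in> axis_directions \<Longrightarrow> in_box (H n) (fst sd) \<Longrightarrow> c \<le> hit_prob p (b n) sd"
    and c: "0 < c" "c \<le> 1" and a: "\<And>n. a (Suc n) = a n + b n"
    and far: "(\<lambda>n. prob_of (walk_law p (a n) sd) {sd. \<not> in_box (H n) (fst sd)}) \<longlonglongrightarrow> 0"
    and d: "snd sd \<in> axis_directions"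
  shows "(\<lambda>n. hit_prob p (a n) sd) \<longlonglongrightarrow> 1"
proof -
  \<comment> \<open>it suffices to follow the probabilities of a miss\<close>
  define u where "u n = 1 - hit_prob p (a n) sd" for n
  have mono: "hit_prob p N sd \<le> hit_prob p (N + k) sd" for N k
  proof (induction k)
    case (Suc k)
    show ?case using order_trans[OF Suc hit_prob_mono[of p "N + k" sd]] by (simp only: add_Suc_right)
  qed simp
  have u: "0 \<le> u n" "u (Suc n) \<le> u n" for n
    unfolding u_def a using mono hit_prob_bounds by (auto simp: diff_left_mono)
  have "decseq u" using u(2) by (simp add: decseq_Suc_iff)
  then obtain L where L: "u \<longlonglongrightarrow> L" using decseq_convergent[of u 0] u(1) by blast
  have "(\<lambda>n. u (Suc n)) \<longlonglongrightarrow> L" using L by (rule LIMSEQ_Suc)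
  moreover have "(\<lambda>n. (1 - c) * u n + prob_of (walk_law p (a n) sd) {sd. \<not> in_box (H n) (fst sd)}) \<longlonglongrightarrow> (1 - c) * L + 0"
    by (intro tendsto_intros L far)
  moreover have "\<exists>N. \<forall>n\<ge>N. u (Suc n) \<le> (1 - c) * u n + prob_of (walk_law p (a n) sd) {sd. \<not> in_box (H n) (fst sd)}"
    unfolding u_def a using hit c d by (intro exI[of _ n0] allI impI miss_prob_add_le) auto
  ultimately have "L \<le> (1 - c) * L + 0" by (rule LIMSEQ_le)
  then have "c * L \<le> 0" by (simp add: algebra_simps)
  moreover have "0 \<le> L" using L u by (intro LIMSEQ_le_const) auto
  ultimately have "L = 0" using c by (simp add: mult_le_0_iff)
  with L have "(\<lambda>n. 1 - u n) \<longlonglongrightarrow> 1 - 0" by (intro tendsto_intros) simp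
  then show ?thesis by (simp add: u_def)
qed

section \<open>Transfer to the sample space of the walk\<close>

text \<open>Position and direction at the beginning of leg \<open>k\<close>.\<close>
primrec leg_state :: "walk_state \<Rightarrow> nat \<Rightarrow> (nat \<Rightarrow> nat \<times> nat) \<Rightarrow> walk_state" where
  "leg_state sd 0 \<omega> = sd"
| "leg_state sd (Suc k) \<omega> = advance (leg_state sd k \<omega>) (\<omega> k)"

lemma leg_state_case_nat: "leg_state sd (Suc k) (case_nat x \<omega>) = leg_state (advance sd x) k \<omega>"
  by (induction k) simp_all

lemma snd_leg_state: "snd (leg_state (s, d) k \<omega>) = leg_direction d k \<omega>"
  by (induction k) (simp_all add: advance_def)

lemma change_time_mono: "i \<le> j \<Longrightarrow> change_time i \<omega> \<le> change_time j \<omega>"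
  unfolding change_time_def by (intro sum_mono2) auto

text \<open>Legs of length 0 are skipped, because the leg containing a unit step is determined by strict
  inequality at its end.\<close>
lemma leg_at_eq:
  assumes "change_time k \<omega> \<le> m" "m < change_time (Suc k) \<omega>"
  shows "leg_at m \<omega> = k"
  unfolding leg_at_def
proof (rule Least_equality)
  fix j assume "m < change_time (Suc j) \<omega>"
  with assms(1) have "change_time k \<omega> < change_time (Suc j) \<omega>" by simp
  then show "k \<le> j" using change_time_mono[of "Suc j" k \<omega>] by (meson not_less not_less_eq_eq)
qed fact

lemma drrw_position_in_leg:
  "x \<le> waiting_time k \<omega> \<Longrightarrow> drrw_position d (change_time k \<omega> + x) \<omega>
     = fst (leg_state ((0, 0), d) k \<omega>) + along (int x) (leg_direction d k \<omega>)"
proof (induction k arbitrary: x)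
  case 0
  then show ?case
  proof (induction x)
    case (Suc x)
    have "leg_at x \<omega> = 0" using Suc.prems by (intro leg_at_eq) (auto simp: change_time_def)
    then show ?case using Suc by (simp add: change_time_def along_def prod_eq_iff algebra_simps)
  qed (simp add: change_time_def along_def)
next
  case (Suc k)
  have ct: "change_time (Suc k) \<omega> = change_time k \<omega> + waiting_time k \<omega>" by (simp add: change_time_def)
  show ?case using Suc.prems
  proof (induction x)
    case 0
    have "drrw_position d (change_time (Suc k) \<omega>) \<omega> = fst (leg_state ((0, 0), d) k \<omega>) + along (int (waiting_time k \<omega>)) (leg_direction d k \<omega>)"
      unfolding ct by (rule Suc.IH) simp
    then show ?case by (simp add: advance_def waiting_time_def snd_leg_state along_def prod_eq_iff)
  next
    case (Suc x)
    have "leg_at (change_time (Suc k) \<omega> + x) \<omega> = Suc k"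
      using Suc.prems by (intro leg_at_eq) (auto simp: change_time_def)
    then show ?case using Suc by (simp add: along_def prod_eq_iff algebra_simps del: leg_state.simps leg_direction.simps)
  qed
qed

lemma changes_at_eq: "changes_at d x \<omega> = {k. 1 \<le> k \<and> fst (leg_state ((0, 0), d) k \<omega>) = x}"
  unfolding changes_at_def using drrw_position_in_leg[of 0 _ \<omega> d] by (simp add: along_def flip: zero_prod_def)

text \<open>A crossing takes place at a positive time within its leg, so every crossing leg has positive
  length and the times of the crossings tend to infinity with the index of the leg.\<close>
lemma infinite_visits_if_infinite_crossings:
  assumes inf: "\<And>m. \<exists>k\<ge>m. crosses_origin (leg_state ((0, 0), d) k \<omega>) (fst (\<omega> k))"
  shows "infinite {m. drrw_position d m \<omega> = (0, 0)}"
  unfolding infinite_nat_iff_unbounded_le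
proof
  fix m
  let ?C = "\<lambda>k. crosses_origin (leg_state ((0, 0), d) k \<omega>) (fst (\<omega> k))"
  have pos: "\<exists>x\<ge>1. x \<le> waiting_time k \<omega> \<and> drrw_position d (change_time k \<omega> + x) \<omega> = (0, 0)" if "?C k" for k
    using that unfolding crosses_origin_def by (auto simp: drrw_position_in_leg snd_leg_state waiting_time_def)
  have "\<exists>k. ?C k \<and> m \<le> change_time k \<omega>"
  proof (induction m)
    case 0
    then show ?case using inf[of 0] by auto
  next
    case (Suc m)
    then obtain k where k: "?C k" "m \<le> change_time k \<omega>" by auto
    have "waiting_time k \<omega> \<ge> 1" using pos[OF k(1)] by auto
    then have "Suc m \<le> change_time (Suc k) \<omega>" using k(2) by (simp add: change_time_def)
    moreover obtain k' where "k' \<ge> Suc k" "?C k'" using inf by blast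
    ultimately show ?case using change_time_mono[of "Suc k" k' \<omega>] order_trans by blast
  qed
  then obtain k where k: "?C k" "m \<le> change_time k \<omega>" by auto
  obtain x where "drrw_position d (change_time k \<omega> + x) \<omega> = (0, 0)" using pos[OF k(1)] by auto
  then show "\<exists>n\<ge>m. n \<in> {m. drrw_position d m \<omega> = (0, 0)}" using k(2) by (auto intro!: exI[of _ "change_time k \<omega> + x"])
qed

context
  fixes p :: "nat pmf"
begin

interpretation sequence_space "measure_pmf (leg_law p)" ..

lemma drrw_space_eq: "drrw_space p = (\<Pi>\<^sub>M k\<in>UNIV. measure_pmf (leg_law p))"
  by (simp add: drrw_space_def turn_law_def)

interpretation drrw: prob_space "drrw_space p"
  unfolding drrw_space_eq by (rule prob_space_PiM) (rule measure_pmf.prob_space_axioms)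

lemma measurable_coordinate: "(\<lambda>\<omega>. f (\<omega> k)) \<in> measurable (drrw_space p) (count_space UNIV)"
  unfolding drrw_space_eq
  by (rule measurable_compose[OF measurable_component_singleton]) auto

lemma measurable_leg_state [measurable]: "leg_state sd k \<in> measurable (drrw_space p) (count_space UNIV)"
proof (induction k)
  case (Suc k)
  have "(\<lambda>\<omega>. (\<lambda>s \<omega>. advance s (\<omega> k)) (leg_state sd k \<omega>) \<omega>) \<in> measurable (drrw_space p) (count_space UNIV)"
    by (rule measurable_compose_countable[OF measurable_coordinate Suc])
  then show ?case by simp
qed simp

lemma measurable_crosses [measurable]:
  "Measurable.pred (drrw_space p) (\<lambda>\<omega>. crosses_origin (leg_state sd k \<omega>) (fst (\<omega> k)))"
  by (rule measurable_compose_countable[where f="\<lambda>s \<omega>. crosses_origin s (fst (\<omega> k))" and g="leg_state sd k",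
        OF measurable_coordinate measurable_leg_state])

text \<open>The first leg is independent of the sequence of all later ones, which has the same law
  as the whole sequence.\<close>
lemma nn_integral_first_leg:
  assumes f: "f \<in> borel_measurable (drrw_space p)"
  shows "(\<integral>\<^sup>+\<omega>. f \<omega> \<partial>drrw_space p) = (\<integral>\<^sup>+x. \<integral>\<^sup>+\<omega>. f (case_nat x \<omega>) \<partial>drrw_space p \<partial>leg_law p)"
proof -
  have m: "(\<lambda>(x, \<omega>). case_nat x \<omega>) \<in> measurable (measure_pmf (leg_law p) \<Otimes>\<^sub>M S) S" by measurable
  have "(\<integral>\<^sup>+\<omega>. f \<omega> \<partial>drrw_space p) = (\<integral>\<^sup>+\<omega>. f \<omega> \<partial>distr (measure_pmf (leg_law p) \<Otimes>\<^sub>M S) S (\<lambda>(x, \<omega>). case_nat x \<omega>))"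
    unfolding drrw_space_eq PiM_iter ..
  also have "\<dots> = (\<integral>\<^sup>+z. f (case z of (x, \<omega>) \<Rightarrow> case_nat x \<omega>) \<partial>(measure_pmf (leg_law p) \<Otimes>\<^sub>M S))"
    by (rule nn_integral_distr[OF m]) (use f in \<open>simp add: drrw_space_eq\<close>)
  also have "\<dots> = (\<integral>\<^sup>+x. \<integral>\<^sup>+\<omega>. f (case_nat x \<omega>) \<partial>S \<partial>leg_law p)"
    using f by (subst P.nn_integral_fst[symmetric]) (auto simp: drrw_space_eq intro!: measurable_compose[OF m])
  finally show ?thesis unfolding drrw_space_eq .
qed

lemma nn_integral_pred:
  assumes "Measurable.pred M P"
  shows "(\<integral>\<^sup>+\<omega>. indicator {\<omega>. P \<omega>} \<omega> \<partial>M) = emeasure M {\<omega> \<in> space M. P \<omega>}"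
proof -
  have "(\<integral>\<^sup>+\<omega>. indicator {\<omega>. P \<omega>} \<omega> \<partial>M) = (\<integral>\<^sup>+\<omega>. indicator {\<omega> \<in> space M. P \<omega>} \<omega> \<partial>M)"
    by (intro nn_integral_cong) (simp add: indicator_def)
  also have "\<dots> = emeasure M {\<omega> \<in> space M. P \<omega>}"
    using assms by (intro nn_integral_indicator) measurable
  finally show ?thesis .
qed

lemma pred_leg_state [measurable]: "Measurable.pred (drrw_space p) (\<lambda>\<omega>. leg_state sd k \<omega> \<in> A)"
  by (rule measurable_compose[OF measurable_leg_state]) simp

lemma emeasure_leg_state: "emeasure (drrw_space p) {\<omega> \<in> space (drrw_space p). leg_state sd k \<omega> \<in> A} = emeasure (walk_law p k sd) A"
proof (induction k arbitrary: sd)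
  case 0
  show ?case by (auto simp: drrw.emeasure_space_1 indicator_def)
next
  case (Suc k)
  have "emeasure (drrw_space p) {\<omega> \<in> space (drrw_space p). leg_state sd (Suc k) \<omega> \<in> A}
    = (\<integral>\<^sup>+\<omega>. indicator {\<omega>. leg_state sd (Suc k) \<omega> \<in> A} \<omega> \<partial>drrw_space p)"
    by (rule nn_integral_pred[symmetric]) (rule pred_leg_state)
  also have "\<dots> = (\<integral>\<^sup>+x. \<integral>\<^sup>+\<omega>. indicator {\<omega>. leg_state sd (Suc k) \<omega> \<in> A} (case_nat x \<omega>) \<partial>drrw_space p \<partial>leg_law p)"
    by (rule nn_integral_first_leg) (use pred_leg_state[of sd "Suc k" A] in measurable)
  also have "\<dots> = (\<integral>\<^sup>+x. emeasure (walk_law p k (advance sd x)) A \<partial>leg_law p)"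
  proof (intro nn_integral_cong)
    fix x
    have "(\<integral>\<^sup>+\<omega>. indicator {\<omega>. leg_state sd (Suc k) \<omega> \<in> A} (case_nat x \<omega>) \<partial>drrw_space p)
      = (\<integral>\<^sup>+\<omega>. indicator {\<omega>. leg_state (advance sd x) k \<omega> \<in> A} \<omega> \<partial>drrw_space p)"
      by (simp only: indicator_def mem_Collect_eq leg_state_case_nat)
    also have "\<dots> = emeasure (walk_law p k (advance sd x)) A"
      unfolding nn_integral_pred[OF pred_leg_state] by (rule Suc)
    finally show "(\<integral>\<^sup>+\<omega>. indicator {\<omega>. leg_state sd (Suc k) \<omega> \<in> A} (case_nat x \<omega>) \<partial>drrw_space p)
      = emeasure (walk_law p k (advance sd x)) A" .
  qed
  finally show ?case by simp
qed

lemma AE_first_leg: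
  assumes P: "Measurable.pred (drrw_space p) P"
    and AE: "\<And>x. AE \<omega> in drrw_space p. P (case_nat x \<omega>)"
    and Px: "\<And>x. Measurable.pred (drrw_space p) (\<lambda>\<omega>. P (case_nat x \<omega>))"
  shows "AE \<omega> in drrw_space p. P \<omega>"
proof -
  have "(\<integral>\<^sup>+\<omega>. indicator {\<omega>. \<not> P \<omega>} \<omega> \<partial>drrw_space p) = (\<integral>\<^sup>+x. \<integral>\<^sup>+\<omega>. indicator {\<omega>. \<not> P \<omega>} (case_nat x \<omega>) \<partial>drrw_space p \<partial>leg_law p)"
    by (rule nn_integral_first_leg) (use P in measurable)
  also have "\<dots> = (\<integral>\<^sup>+x. 0 \<partial>leg_law p)"
  proof (intro nn_integral_cong)
    fix x
    show "(\<integral>\<^sup>+\<omega>. indicator {\<omega>. \<not> P \<omega>} (case_nat x \<omega>) \<partial>drrw_space p) = 0"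
    proof (subst nn_integral_0_iff_AE)
      show "(\<lambda>\<omega>. indicator {\<omega>. \<not> P \<omega>} (case_nat x \<omega>)) \<in> borel_measurable (drrw_space p)"
        using Px[of x] by (simp add: indicator_def)
      show "AE \<omega> in drrw_space p. indicator {\<omega>. \<not> P \<omega>} (case_nat x \<omega>) = (0 :: ennreal)"
        using AE[of x] by eventually_elim simp
    qed
  qed
  finally have "(\<integral>\<^sup>+\<omega>. indicator {\<omega>. \<not> P \<omega>} \<omega> \<partial>drrw_space p) = 0" by simp
  then have "AE \<omega> in drrw_space p. indicator {\<omega>. \<not> P \<omega>} \<omega> = (0 :: ennreal)"
    by (subst (asm) nn_integral_0_iff_AE) (use P in measurable)
  then show ?thesis by eventually_elim (simp add: indicator_def split: if_splits)
qed

text \<open>Both sides satisfy the recursion that splits off the first leg.\<close>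
lemma emeasure_no_crossing:
  "emeasure (drrw_space p) {\<omega> \<in> space (drrw_space p). \<forall>k<N. \<not> crosses_origin (leg_state sd k \<omega>) (fst (\<omega> k))}
    = ennreal (1 - hit_prob p N sd)"
proof (induction N arbitrary: sd)
  case 0
  show ?case by (simp add: drrw.emeasure_space_1)
next
  case (Suc N)
  let ?Z = "\<lambda>N sd \<omega>. \<forall>k<N. \<not> crosses_origin (leg_state sd k \<omega>) (fst (\<omega> k))"
  have ind: "emeasure (drrw_space p) {\<omega> \<in> space (drrw_space p). ?Z N sd \<omega>} = (\<integral>\<^sup>+\<omega>. indicator {\<omega>. ?Z N sd \<omega>} \<omega> \<partial>drrw_space p)" for N sd
    by (rule nn_integral_pred[symmetric]) measurable
  have shift: "?Z (Suc N) sd (case_nat x \<omega>) \<longleftrightarrow> \<not> crosses_origin sd (fst x) \<and> ?Z N (advance sd x) \<omega>" for x \<omega>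
    by (simp add: All_less_Suc2 leg_state_case_nat del: leg_state.simps(2))
  have "emeasure (drrw_space p) {\<omega> \<in> space (drrw_space p). ?Z (Suc N) sd \<omega>}
    = (\<integral>\<^sup>+x. \<integral>\<^sup>+\<omega>. indicator {\<omega>. ?Z (Suc N) sd \<omega>} (case_nat x \<omega>) \<partial>drrw_space p \<partial>leg_law p)"
    unfolding ind by (rule nn_integral_first_leg) measurable
  also have "\<dots> = (\<integral>\<^sup>+x. ennreal (if crosses_origin sd (fst x) then 0 else 1 - hit_prob p N (advance sd x)) \<partial>leg_law p)"
  proof (intro nn_integral_cong)
    fix x
    have "(\<integral>\<^sup>+\<omega>. indicator {\<omega>. ?Z (Suc N) sd \<omega>} (case_nat x \<omega>) \<partial>drrw_space p)
      = (\<integral>\<^sup>+\<omega>. (if crosses_origin sd (fst x) then 0 else indicator {\<omega>. ?Z N (advance sd x) \<omega>} \<omega>) \<partial>drrw_space p)"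
      by (intro nn_integral_cong) (auto simp: indicator_def shift)
    also have "\<dots> = ennreal (if crosses_origin sd (fst x) then 0 else 1 - hit_prob p N (advance sd x))"
      using Suc.IH[of "advance sd x"] unfolding ind by simp
    finally show "(\<integral>\<^sup>+\<omega>. indicator {\<omega>. ?Z (Suc N) sd \<omega>} (case_nat x \<omega>) \<partial>drrw_space p)
      = ennreal (if crosses_origin sd (fst x) then 0 else 1 - hit_prob p N (advance sd x))" .
  qed
  also have "\<dots> = ennreal (1 - hit_prob p (Suc N) sd)"
    unfolding miss_prob_Suc
    by (rule nn_integral_eq_integral) (auto intro!: integrable_pmf_nonneg[where B=1] simp: hit_prob_bounds)
  finally show ?case .
qed

text \<open>The hypothesis covers every starting state, so almost surely a crossing occurs from any state,
  in particular from the state reached after \<open>m\<close> legs.\<close>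
lemma AE_infinitely_many_crossings:
  assumes lim: "\<And>sd. snd sd \<in> axis_directions \<Longrightarrow> (\<lambda>n. hit_prob p (a n) sd) \<longlonglongrightarrow> 1"
    and "snd sd \<in> axis_directions"
  shows "AE \<omega> in drrw_space p. \<exists>k\<ge>m. crosses_origin (leg_state sd k \<omega>) (fst (\<omega> k))"
  using \<open>snd sd \<in> axis_directions\<close>
proof (induction m arbitrary: sd)
  case 0
  let ?Z = "{\<omega> \<in> space (drrw_space p). \<forall>k. \<not> crosses_origin (leg_state sd k \<omega>) (fst (\<omega> k))}"
  have "emeasure (drrw_space p) ?Z \<le> ennreal (1 - hit_prob p (a n) sd)" for n
    unfolding emeasure_no_crossing[symmetric] by (intro emeasure_mono) auto
  moreover have "(\<lambda>n. ennreal (1 - hit_prob p (a n) sd)) \<longlonglongrightarrow> ennreal (1 - 1)"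
    by (intro tendsto_intros lim 0)
  ultimately have "emeasure (drrw_space p) ?Z \<le> ennreal (1 - 1)"
    by (intro LIMSEQ_le_const) auto
  then have "emeasure (drrw_space p) ?Z = 0" by simp
  then have "AE \<omega> in drrw_space p. \<omega> \<notin> ?Z" by (intro AE_not_in) (auto simp: null_sets_def)
  then show ?case by (auto elim!: eventually_mono AE_mp)
next
  case (Suc m)
  have gen: "(\<exists>k\<ge>Suc m. Q k) \<longleftrightarrow> (\<exists>k\<ge>m. Q (Suc k))" for Q
    by (metis Suc_le_D Suc_le_mono)
  have shift: "(\<exists>k\<ge>Suc m. crosses_origin (leg_state sd k (case_nat x \<omega>)) (fst (case_nat x \<omega> k)))
    \<longleftrightarrow> (\<exists>k\<ge>m. crosses_origin (leg_state (advance sd x) k \<omega>) (fst (\<omega> k)))" for x \<omega>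
    unfolding gen by (simp only: leg_state_case_nat old.nat.simps)
  show ?case
  proof (rule AE_first_leg)
    show "AE \<omega> in drrw_space p. \<exists>k\<ge>Suc m. crosses_origin (leg_state sd k (case_nat x \<omega>)) (fst (case_nat x \<omega> k))" for x
      unfolding shift by (rule Suc.IH) (rule advance_axis[OF Suc.prems])
    show "Measurable.pred (drrw_space p) (\<lambda>\<omega>. \<exists>k\<ge>Suc m. crosses_origin (leg_state sd k (case_nat x \<omega>)) (fst (case_nat x \<omega> k)))" for x
      unfolding shift by measurable
  qed measurable
qed

theorem AE_infinitely_many_returns:
  assumes lim: "\<And>sd. snd sd \<in> axis_directions \<Longrightarrow> (\<lambda>n. hit_prob p (a n) sd) \<longlonglongrightarrow> 1"
    and d: "d \<in> axis_directions"
  shows "AE \<omega> in drrw_space p. infinite {m. drrw_position d m \<omega> = (0, 0)}"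
proof -
  have "AE \<omega> in drrw_space p. \<forall>m. \<exists>k\<ge>m. crosses_origin (leg_state ((0, 0), d) k \<omega>) (fst (\<omega> k))"
    unfolding AE_all_countable using AE_infinitely_many_crossings[OF lim] d by simp
  then show ?thesis by eventually_elim (rule infinite_visits_if_infinite_crossings, blast)
qed

theorem AE_finitely_many_changes:
  assumes "summable (\<lambda>k. prob_of (walk_law p (Suc k) ((0, 0), d)) {sd. fst sd \<in> {x}})"
  shows "AE \<omega> in drrw_space p. finite (changes_at d x \<omega>)"
proof -
  define A where "A k = {\<omega> \<in> space (drrw_space p). leg_state ((0, 0), d) (Suc k) \<omega> \<in> {sd. fst sd \<in> {x}}}" for k
  have m: "measure (drrw_space p) (A k) = prob_of (walk_law p (Suc k) ((0, 0), d)) {sd. fst sd \<in> {x}}" for k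
    unfolding measure_def A_def emeasure_leg_state ..
  have "AE \<omega> in drrw_space p. eventually (\<lambda>k. \<omega> \<in> space (drrw_space p) - A k) sequentially"
  proof (rule borel_cantelli_AE1)
    show "A k \<in> sets (drrw_space p)" for k
      unfolding A_def by (rule measurable_sets_Collect) measurable
    show "emeasure (drrw_space p) (A k) < \<infinity>" for k by (simp add: drrw.emeasure_eq_measure)
    show "summable (\<lambda>k. measure (drrw_space p) (A k))" unfolding m by (rule assms)
  qed
  then show ?thesis
  proof eventually_elim
    case (elim \<omega>)
    then obtain N where N: "\<And>k. k \<ge> N \<Longrightarrow> \<omega> \<in> space (drrw_space p) - A k"
      unfolding eventually_sequentially by auto
    have "changes_at d x \<omega> \<subseteq> {..N}"
    proof
      fix k assume "k \<in> changes_at d x \<omega>"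
      then obtain j where j: "k = Suc j" "fst (leg_state ((0, 0), d) (Suc j) \<omega>) = x"
        unfolding changes_at_eq by (cases k) auto
      show "k \<in> {..N}"
      proof (rule ccontr)
        assume "k \<notin> {..N}"
        then have "j \<ge> N" using j by simp
        from N[OF this] j(2) show False unfolding A_def by (simp del: leg_state.simps)
      qed
    qed
    then show ?case by (rule finite_subset) simp
  qed
qed

end

section \<open>The waiting time distribution\<close>

text \<open>The scales of the waiting times. In the notation of the introduction
  \<open>h\<^sub>n\<close> is \<open>leg_scale n\<close>, and \<open>q\<^sub>n\<close> for \<open>n = Suc m\<close> is \<open>1 / rarity m\<close>. The exponents are chosen so that
  \<open>rarity m\<close> exceeds the number \<open>2 ^ leg_scale m\<close> of legs in phase \<open>m\<close> by the factor \<open>2 ^ (m + 2)\<close>,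
  and \<open>leg_scale (Suc m)\<close> exceeds \<open>rarity m * leg_scale m\<close> by the factor \<open>2 ^ (m + 1)\<close>.\<close>
primrec leg_scale :: "nat \<Rightarrow> nat" where
  "leg_scale 0 = 1"
| "leg_scale (Suc n) = 2 ^ (leg_scale n + 2 * n + 3) * leg_scale n"

definition rarity :: "nat \<Rightarrow> nat" where
  "rarity n = 2 ^ (leg_scale n + n + 2)"

declare leg_scale.simps(2) [simp del]

lemma leg_scale_pos: "leg_scale n > 0" by (induction n) (auto simp: leg_scale.simps)

lemma leg_scale_Suc_rarity: "leg_scale (Suc n) = 2 ^ Suc n * rarity n * leg_scale n"
proof -
  have e: "leg_scale n + 2 * n + 3 = Suc n + (leg_scale n + n + 2)" by simp
  show ?thesis
    unfolding leg_scale.simps(2) rarity_def e power_add[of "2 :: nat" "Suc n" "leg_scale n + n + 2"] ..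
qed

lemma leg_scale_Suc_ge: "2 * leg_scale n \<le> leg_scale (Suc n)"
proof -
  have "2 ^ 1 \<le> (2::nat) ^ (leg_scale n + 2 * n + 3)" by (intro power_increasing) auto
  then show ?thesis by (simp add: leg_scale.simps)
qed

lemma leg_scale_mono: "i \<le> j \<Longrightarrow> leg_scale i \<le> leg_scale j"
proof -
  have "leg_scale n \<le> leg_scale (Suc n)" for n using leg_scale_Suc_ge[of n] by linarith
  then show "i \<le> j \<Longrightarrow> leg_scale i \<le> leg_scale j" by (rule lift_Suc_mono_le)
qed

lemma rarity_ge_1: "1 \<le> real (rarity n)"
proof -
  have "0 < rarity n" by (simp add: rarity_def)
  then show ?thesis by linarith
qed

lemma two_leg_scale_le: "i < j \<Longrightarrow> 2 * leg_scale i \<le> leg_scale j"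
  using leg_scale_Suc_ge[of i] leg_scale_mono[of "Suc i" j] by simp

lemma Suc_le_leg_scale: "Suc n \<le> leg_scale n"
proof (induction n)
  case (Suc n)
  then show ?case using leg_scale_Suc_ge[of n] by linarith
qed simp

text \<open>Scale 0 takes the remaining mass.\<close>
definition scale_prob :: "nat \<Rightarrow> real" where
  "scale_prob n = (case n of 0 \<Rightarrow> 1 - (\<Sum>i. 1 / real (rarity i)) | Suc i \<Rightarrow> 1 / real (rarity i))"

lemma rarity_bound:
  assumes "n \<le> i"
  shows "1 / real (rarity i) \<le> (1 / (2 ^ leg_scale n * 4)) * (1 / 2) ^ i"
proof -
  have "(2::real) ^ leg_scale n * 4 * 2 ^ i \<le> 2 ^ leg_scale i * 4 * 2 ^ i"
    using leg_scale_mono[OF assms] by (intro mult_right_mono) auto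
  also have "\<dots> = real (rarity i)" by (simp add: rarity_def power_add)
  finally have "1 / real (rarity i) \<le> 1 / (2 ^ leg_scale n * 4 * 2 ^ i)"
    by (intro divide_left_mono) (auto simp: rarity_def)
  then show ?thesis by (simp add: power_one_over divide_simps)
qed

lemma summable_rarity: "summable (\<lambda>i. 1 / real (rarity i))"
  by (rule summable_comparison_test'[where g="\<lambda>i. (1 / (2 ^ leg_scale 0 * 4)) * (1 / 2) ^ i" and N=0])
     (intro summable_mult summable_geometric, simp, use rarity_bound[of 0] in simp)

lemma tail_rarity_le: "(\<Sum>i. 1 / real (rarity (i + n))) \<le> 1 / (2 ^ leg_scale n * 2 ^ Suc n)"
proof -
  have "(\<Sum>i. 1 / real (rarity (i + n))) \<le> (\<Sum>i. (1 / (2 ^ leg_scale n * 4 * 2 ^ n)) * (1 / 2) ^ i)"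
  proof (rule suminf_le)
    show "1 / real (rarity (i + n)) \<le> (1 / (2 ^ leg_scale n * 4 * 2 ^ n)) * (1 / 2) ^ i" for i
    proof -
      have "1 / real (rarity (i + n)) \<le> (1 / (2 ^ leg_scale n * 4)) * (1 / 2) ^ (i + n)"
        by (rule rarity_bound) simp
      also have "\<dots> = (1 / (2 ^ leg_scale n * 4 * 2 ^ n)) * (1 / 2) ^ i"
        by (simp add: power_add power_one_over)
      finally show ?thesis .
    qed
    show "summable (\<lambda>i. 1 / real (rarity (i + n)))" using summable_rarity by (rule summable_ignore_initial_segment)
  qed (auto intro!: summable_mult summable_geometric)
  also have "\<dots> = (1 / (2 ^ leg_scale n * 4 * 2 ^ n)) * 2"
    by (subst suminf_mult) (auto simp: suminf_geometric summable_geometric)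
  finally show ?thesis by (simp add: mult_ac)
qed

lemma scale_prob_nonneg: "0 \<le> scale_prob n"
  using tail_rarity_le[of 0] by (auto simp: scale_prob_def split: nat.split)

lemma scale_prob_sums: "scale_prob sums 1"
proof -
  have "(\<lambda>i. scale_prob (Suc i)) sums (\<Sum>i. 1 / real (rarity i))"
    using summable_sums[OF summable_rarity] by (simp add: scale_prob_def)
  moreover have "scale_prob 0 = 1 - (\<Sum>i. 1 / real (rarity i))" by (simp add: scale_prob_def)
  ultimately show ?thesis using sums_Suc[of scale_prob] by fastforce
qed

definition scale_law :: "nat pmf" where
  "scale_law = embed_pmf scale_prob"

lemma pmf_scale_law: "pmf scale_law n = scale_prob n"
  unfolding scale_law_def
proof (rule pmf_embed_pmf)
  show "(\<integral>\<^sup>+n. ennreal (scale_prob n) \<partial>count_space UNIV) = 1"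
    unfolding nn_integral_count_space_nat
    by (subst suminf_ennreal_eq[OF scale_prob_nonneg scale_prob_sums]) simp
qed (rule scale_prob_nonneg)

definition step_law :: "nat \<Rightarrow> nat pmf" where
  "step_law i = pmf_of_set {..<2 * leg_scale i}"

definition wait_law :: "nat pmf" where
  "wait_law = bind_pmf scale_law step_law"

text \<open>By the choice of \<open>rarity\<close>, a scale above \<open>n\<close> is unlikely to occur within \<open>2 ^ leg_scale n\<close> legs.\<close>
lemma prob_scale_gt: "prob_of scale_law {n<..} \<le> 1 / (2 ^ leg_scale n * 2 ^ Suc n)"
proof -
  have "{n<..} = UNIV - {..n}" by auto
  then have "prob_of scale_law {n<..} = 1 - prob_of scale_law {..n}"
    using measure_pmf.prob_compl[of "{..n}" scale_law] by simp
  also have "prob_of scale_law {..n} = (\<Sum>i\<le>n. scale_prob i)"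
    by (subst measure_measure_pmf_finite) (auto simp: pmf_scale_law)
  also have "1 - (\<Sum>i\<le>n. scale_prob i) = (\<Sum>i. scale_prob (i + Suc n))"
    using sums_unique[OF sums_split_initial_segment[OF scale_prob_sums, of "Suc n"]] by (simp add: lessThan_Suc_atMost)
  also have "\<dots> = (\<Sum>i. 1 / real (rarity (i + n)))" by (simp add: scale_prob_def)
  also have "\<dots> \<le> 1 / (2 ^ leg_scale n * 2 ^ Suc n)" by (rule tail_rarity_le)
  finally show ?thesis .
qed

lemma step_range_nonempty: "{..<2 * leg_scale i} \<noteq> {}" using leg_scale_pos[of i] by (simp add: lessThan_empty_iff)

lemma set_step_law: "set_pmf (step_law i) = {..<2 * leg_scale i}"
  unfolding step_law_def using step_range_nonempty by simp

lemma prob_wait_ge: "prob_of wait_law {2 * leg_scale n..} \<le> prob_of scale_law {n<..}"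
proof -
  have "prob_of wait_law {2 * leg_scale n..} = mean scale_law (\<lambda>i. prob_of (step_law i) {2 * leg_scale n..})"
    unfolding wait_law_def by (rule prob_bind_pmf)
  also have "\<dots> \<le> mean scale_law (indicator {n<..})"
  proof (intro integral_mono)
    fix i
    show "prob_of (step_law i) {2 * leg_scale n..} \<le> indicator {n<..} i"
    proof (cases "n < i")
      case False
      then have "prob_of (step_law i) {2 * leg_scale n..} = 0"
        using leg_scale_mono[of i n] by (subst measure_pmf_zero_iff) (auto simp: set_step_law)
      then show ?thesis by simp
    qed simp
  qed (auto intro!: integrable_pmf_nonneg[where B=1])
  also have "\<dots> = prob_of scale_law {n<..}" by simp
  finally show ?thesis .
qed

text \<open>Conditioning on scales up to \<open>n\<close> gives a bounded waiting time, to which the estimates for a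
  single phase apply; by \<open>cut_wait_dominated\<close> little is lost.\<close>
definition cut_law :: "nat \<Rightarrow> nat pmf" where
  "cut_law n = cond_pmf scale_law {..n}"

definition cut_wait :: "nat \<Rightarrow> nat pmf" where
  "cut_wait n = bind_pmf (cut_law n) step_law"

definition keep_prob :: "nat \<Rightarrow> real" where
  "keep_prob n = prob_of scale_law {..n}"

lemma keep_prob_ge: "1 - 1 / (2 ^ leg_scale n * 2 ^ Suc n) \<le> keep_prob n"
proof -
  have "{n<..} = UNIV - {..n}" by auto
  then have "prob_of scale_law {n<..} = 1 - keep_prob n"
    using measure_pmf.prob_compl[of "{..n}" scale_law] by (simp add: keep_prob_def)
  then show ?thesis using prob_scale_gt[of n] by linarith
qed

lemma keep_prob_pos: "0 < keep_prob n" and keep_prob_le: "keep_prob n \<le> 1"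
proof -
  have "(2::real) * 2 \<le> 2 ^ leg_scale n * 2 ^ Suc n"
    using leg_scale_pos[of n] power_increasing[of 1 "leg_scale n" "2::real"] by (intro mult_mono) auto
  then have "1 / (2 ^ leg_scale n * 2 ^ Suc n) \<le> 1 / (2 * 2 :: real)" by (intro divide_left_mono) auto
  then show "0 < keep_prob n" using keep_prob_ge[of n] by linarith
  show "keep_prob n \<le> 1" by (simp add: keep_prob_def)
qed

lemma pmf_cut_law: "pmf (cut_law n) i = (if i \<le> n then scale_prob i / keep_prob n else 0)"
proof -
  have "set_pmf scale_law \<inter> {..n} \<noteq> {}"
    using keep_prob_pos[of n] unfolding keep_prob_def by (metis less_irrefl measure_pmf_zero_iff)
  then show ?thesis unfolding cut_law_def by (subst pmf_cond) (auto simp: keep_prob_def pmf_scale_law)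
qed

lemma set_cut_law: "set_pmf (cut_law n) \<subseteq> {..n}"
  by (auto simp: set_pmf_iff pmf_cut_law split: if_splits)

lemma finite_set_cut_law: "finite (set_pmf (cut_law n))"
  by (rule finite_subset[OF set_cut_law]) simp

lemma cut_wait_dominated:
  fixes f :: "nat \<Rightarrow> real"
  assumes f: "\<And>t. 0 \<le> f t" "\<And>t. f t \<le> 1"
  shows "keep_prob n * mean (cut_wait n) f \<le> mean wait_law f"
proof -
  let ?g = "\<lambda>i. mean (step_law i) f"
  have g: "0 \<le> ?g i" for i by (rule Bochner_Integration.integral_nonneg) (rule f)
  have g1: "?g i \<le> 1" for i by (rule expectation_le_const) (rule f)+
  have "keep_prob n * mean (cut_wait n) f = keep_prob n * (\<Sum>i\<le>n. ?g i * pmf (cut_law n) i)"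
    unfolding cut_wait_def expectation_bind_pmf[of f 1, OF f]
    by (subst integral_measure_pmf_real[of "{..n}"]) (use set_cut_law in auto)
  also have "\<dots> = (\<Sum>i\<le>n. ?g i * pmf scale_law i)"
    unfolding sum_distrib_left using keep_prob_pos[of n]
    by (intro sum.cong) (auto simp: pmf_cut_law pmf_scale_law)
  also have "\<dots> = mean scale_law (\<lambda>i. ?g i * indicator {..n} i)"
    by (subst integral_measure_pmf_real[of "{..n}"]) (auto simp: indicator_def)
  also have "\<dots> \<le> mean scale_law ?g"
    by (intro integral_mono integrable_pmf_nonneg[where B=1]) (auto simp: indicator_def g g1)
  also have "\<dots> = mean wait_law f"
    unfolding wait_law_def expectation_bind_pmf[of f 1, OF f] ..
  finally show ?thesis .
qed

lemma pmf_step_law: "pmf (step_law i) t = of_bool (t < 2 * leg_scale i) / real (2 * leg_scale i)"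
  unfolding step_law_def using step_range_nonempty by (subst pmf_of_set) (auto simp: indicator_def)

lemma integrable_cut: "integrable (measure_pmf (cut_law n)) (f :: nat \<Rightarrow> real)"
  by (rule integrable_measure_pmf_finite[OF finite_set_cut_law])

text \<open>All the uniform laws in the mixture start at 0, so the weights of each of them decrease.\<close>
lemma cut_wait_decreasing: "pmf (cut_wait n) (Suc t) \<le> pmf (cut_wait n) t"
  unfolding cut_wait_def pmf_bind pmf_step_law
  by (intro integral_mono integrable_cut divide_right_mono) auto

lemma cut_wait_support: "t \<ge> 2 * leg_scale n \<Longrightarrow> pmf (cut_wait n) t = 0"
proof -
  assume t: "t \<ge> 2 * leg_scale n"
  have "t \<notin> set_pmf (cut_wait n)"
  proof
    assume "t \<in> set_pmf (cut_wait n)"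
    then obtain i where "i \<le> n" "t < 2 * leg_scale i"
      unfolding cut_wait_def using set_cut_law[of n] by (auto simp: set_step_law)
    then show False using t leg_scale_mono[of i n] by simp
  qed
  then show ?thesis by (simp add: set_pmf_iff)
qed

lemma expectation_cut_top:
  "mean (cut_law n) (\<lambda>i. c * of_bool (i = n)) = c * pmf (cut_law n) n" for c :: real
  by (subst integral_measure_pmf_real[of "{n}"]) auto

text \<open>The lower scales produce waiting times below \<open>leg_scale n\<close> only.\<close>
lemma cut_wait_half: "prob_of (cut_wait n) {leg_scale n..} = pmf (cut_law n) n / 2"
proof -
  have *: "prob_of (step_law i) {leg_scale n..} = 1/2 * of_bool (i = n)" if "i \<le> n" for i
  proof (cases "i = n")
    case True
    have "{..<2 * leg_scale n} \<inter> {leg_scale n..} = {leg_scale n..<2 * leg_scale n}" by auto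
    then have "prob_of (step_law n) {leg_scale n..} = 1/2"
      unfolding step_law_def using step_range_nonempty leg_scale_pos[of n] by (subst measure_pmf_of_set) auto
    with True show ?thesis by simp
  next
    case False
    then have "prob_of (step_law i) {leg_scale n..} = 0"
      using that two_leg_scale_le[of i n] by (subst measure_pmf_zero_iff) (auto simp: set_step_law)
    with False show ?thesis by simp
  qed
  have "prob_of (cut_wait n) {leg_scale n..} = mean (cut_law n) (\<lambda>i. 1/2 * of_bool (i = n))"
    unfolding cut_wait_def prob_bind_pmf
    by (intro integral_cong_AE AE_pmfI *) (use set_cut_law in auto)
  then show ?thesis unfolding expectation_cut_top by simp
qed

context
  fixes n :: nat
begin

lemma cut_law_top_ge: "pmf (cut_law (Suc n)) (Suc n) \<ge> 1 / real (rarity n)"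
proof -
  have "pmf (cut_law (Suc n)) (Suc n) = 1 / real (rarity n) / keep_prob (Suc n)"
    by (simp add: pmf_cut_law scale_prob_def)
  moreover have "1 / real (rarity n) * 1 \<le> 1 / real (rarity n) / keep_prob (Suc n)"
    using keep_prob_pos[of "Suc n"] keep_prob_le[of "Suc n"] by (simp add: field_simps rarity_def)
  ultimately show ?thesis by simp
qed

text \<open>The top scale dominates, because \<open>leg_scale (Suc n) \<ge> rarity n * leg_scale n\<close>.\<close>
lemma cut_wait_moment:
  "mean (cut_wait (Suc n)) (\<lambda>t. (real t)\<^sup>2)
    \<le> 8 * pmf (cut_law (Suc n)) (Suc n) * (real (leg_scale (Suc n)))\<^sup>2"
proof -
  let ?h = "real (leg_scale (Suc n))" and ?g = "real (leg_scale n)" and ?q = "pmf (cut_law (Suc n)) (Suc n)"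
  have "mean (cut_wait (Suc n)) (\<lambda>t. (real t)\<^sup>2)
     = mean (cut_law (Suc n)) (\<lambda>i. mean (step_law i) (\<lambda>t. (real t)\<^sup>2))"
    unfolding cut_wait_def
    by (rule expectation_bind_finite) (auto simp: finite_set_cut_law set_step_law)
  also have "\<dots> \<le> mean (cut_law (Suc n)) (\<lambda>i. 4 * ?g\<^sup>2 + 4 * ?h\<^sup>2 * of_bool (i = Suc n))"
  proof (intro integral_mono_AE AE_pmfI integrable_cut)
    fix i assume "i \<in> set_pmf (cut_law (Suc n))"
    then have i: "i \<le> Suc n" using set_cut_law by auto
    have "mean (step_law i) (\<lambda>t. (real t)\<^sup>2) \<le> (2 * real (leg_scale i))\<^sup>2"
    proof (rule expectation_le_const)
      fix t assume "t \<in> set_pmf (step_law i)"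
      then have "t \<le> 2 * leg_scale i" by (simp add: set_step_law)
      then have "real t \<le> real (2 * leg_scale i)" by (simp only: of_nat_le_iff)
      then show "(real t)\<^sup>2 \<le> (2 * real (leg_scale i))\<^sup>2" by (intro power_mono) auto
    qed simp
    also have "\<dots> \<le> 4 * ?g\<^sup>2 + 4 * ?h\<^sup>2 * of_bool (i = Suc n)"
    proof (cases "i = Suc n")
      case True then show ?thesis by (simp add: power_mult_distrib)
    next
      case False
      then have "leg_scale i \<le> leg_scale n" using i by (intro leg_scale_mono) simp
      then have "(real (leg_scale i))\<^sup>2 \<le> ?g\<^sup>2" by (intro power_mono) auto
      then show ?thesis using False by (simp add: power_mult_distrib)
    qed
    finally show "mean (step_law i) (\<lambda>t. (real t)\<^sup>2) \<le> 4 * ?g\<^sup>2 + 4 * ?h\<^sup>2 * of_bool (i = Suc n)" .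
  qed
  also have "\<dots> = 4 * ?g\<^sup>2 + 4 * ?h\<^sup>2 * ?q"
    unfolding expectation_cut_top[symmetric] by (subst Bochner_Integration.integral_add) (auto simp: integrable_cut)
  also have "?g\<^sup>2 \<le> ?q * ?h\<^sup>2"
  proof -
    note R = rarity_ge_1[of n]
    have "leg_scale (Suc n) \<ge> rarity n * leg_scale n" unfolding leg_scale_Suc_rarity by simp
    then have "real (rarity n * leg_scale n) \<le> ?h" by (simp only: of_nat_le_iff)
    then have "(real (rarity n) * ?g)\<^sup>2 \<le> ?h\<^sup>2" by (intro power_mono) auto
    then have "1 / real (rarity n) * (real (rarity n) * ?g)\<^sup>2 \<le> ?q * ?h\<^sup>2"
      using cut_law_top_ge by (intro mult_mono) auto
    moreover have "?g\<^sup>2 * 1 \<le> ?g\<^sup>2 * real (rarity n)" using R by (intro mult_left_mono) auto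
    moreover have "1 / real (rarity n) * (real (rarity n) * ?g)\<^sup>2 = ?g\<^sup>2 * real (rarity n)"
      using R by (simp add: power2_eq_square)
    ultimately show ?thesis by simp
  qed
  finally show ?thesis by simp
qed

end

text \<open>The square of \<open>10 ^ 10 * rarity n\<close> must not exceed \<open>2 ^ leg_scale (Suc n)\<close>; as \<open>10 ^ 10 \<le> 2 ^ 34\<close>,
  comparing exponents leads to this inequality.\<close>
lemma leg_scale_growth: "n \<ge> 1 \<Longrightarrow> 2 * leg_scale n + 2 * n + 72 \<le> leg_scale (Suc n)"
proof -
  assume n: "n \<ge> 1"
  define x where "x = leg_scale n + 2 * n + 3"
  have lin: "2 * y + 75 \<le> (2::nat) ^ y" if "y \<ge> 7" for y
    using that by (induction y rule: dec_induct) auto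
  have "x \<ge> 7" using n Suc_le_leg_scale[of n] by (simp add: x_def)
  then have "2 * x + 75 \<le> 2 ^ x" by (rule lin)
  also have "2 ^ x \<le> leg_scale (Suc n)" using leg_scale_pos[of n] by (simp add: x_def leg_scale.simps)
  finally show ?thesis by (simp add: x_def)
qed

lemma hit_prob_cut_wait_ge:
  assumes n: "n \<ge> 1" and sd: "snd sd \<in> axis_directions" "in_box (leg_scale (Suc n)) (fst sd)"
  shows "1 / 10 ^ 8 \<le> hit_prob (cut_wait (Suc n)) (2 ^ leg_scale (Suc n)) sd"
proof -
  let ?h = "leg_scale (Suc n)" and ?q = "pmf (cut_law (Suc n)) (Suc n)"
  \<comment> \<open>from this time on \<open>pmf_walk_from_ge\<close> applies, whatever the exact probability of the top scale\<close>
  define K where "K = 10 ^ 10 * rarity n"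
  have R: "real (rarity n) > 0" by (simp add: rarity_def)
  have q: "?q > 0" using cut_law_top_ge[of n] R by (meson divide_pos_pos less_le_trans zero_less_one)
  have "1 / real (rarity n) * real K \<le> ?q * real K" using cut_law_top_ge[of n] by (intro mult_right_mono) auto
  then have X: "?q * real K \<ge> 10 ^ 10" using R by (simp add: K_def)
  have K2: "K \<ge> 2" using rarity_ge_1[of n] unfolding K_def by simp
  have "K ^ 2 \<le> (2 ^ 34 * rarity n) ^ 2" unfolding K_def by (intro power_mono mult_right_mono) auto
  also have "2 ^ 34 * rarity n = 2 ^ (34 + (leg_scale n + n + 2))"
    unfolding rarity_def by (simp only: power_add)
  also have "(2 ^ (34 + (leg_scale n + n + 2))) ^ 2 = (2 :: nat) ^ ((34 + (leg_scale n + n + 2)) * 2)"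
    by (simp only: power_mult)
  also have "\<dots> \<le> 2 ^ ?h" using leg_scale_growth[OF n] by (intro power_increasing) auto
  finally have KK: "K ^ 2 \<le> 2 ^ ?h" .
  have h8: "?h \<ge> 8" using leg_scale_growth[OF n] by simp
  have "hit_prob (cut_wait (Suc n)) (2 ^ ?h) (fst sd, snd sd) \<ge> 1 / 10 ^ 8"
    by (rule hit_prob_ge[OF cut_wait_def step_law_def leg_scale_pos q cut_wait_half cut_wait_decreasing cut_wait_support cut_wait_moment sd(1) _ _ K2 X KK h8])
       (use sd(2) in \<open>auto simp: in_box_def\<close>)
  then show ?thesis by simp
qed

lemma hit_prob_wait_ge:
  assumes "n \<ge> 1" "snd sd \<in> axis_directions" "in_box (leg_scale (Suc n)) (fst sd)"
  shows "1 / (2 * 10 ^ 8) \<le> hit_prob wait_law (2 ^ leg_scale (Suc n)) sd"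
proof -
  let ?N = "2 ^ leg_scale (Suc n) :: nat"
  have "1 / 2 \<le> 1 + real ?N * (keep_prob (Suc n) - 1)"
  proof -
    define y where "y = real ?N"
    have "(2::real) ^ 1 \<le> 2 ^ Suc (Suc n)" by (intro power_increasing) auto
    then have half: "1 / 2 ^ Suc (Suc n) \<le> (1 / 2 ^ 1 :: real)" by (intro divide_left_mono) auto
    have "y * (1 - keep_prob (Suc n)) \<le> y * (1 / (2 ^ leg_scale (Suc n) * 2 ^ Suc (Suc n)))"
      using keep_prob_ge[of "Suc n"] by (intro mult_left_mono) (auto simp: y_def)
    also have "\<dots> = 1 / 2 ^ Suc (Suc n)" by (simp add: y_def)
    also note half
    finally have "y * (1 - keep_prob (Suc n)) \<le> 1 / 2" by simp
    then show ?thesis unfolding y_def[symmetric] by (simp add: algebra_simps)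
  qed
  also have "\<dots> \<le> (1 + (keep_prob (Suc n) - 1)) ^ ?N"
    using keep_prob_pos[of "Suc n"] by (intro Bernoulli_inequality) simp
  finally have "1 / 2 \<le> keep_prob (Suc n) ^ ?N" by simp
  then have "1 / 2 * (1 / 10 ^ 8) \<le> keep_prob (Suc n) ^ ?N * hit_prob (cut_wait (Suc n)) ?N sd"
    using hit_prob_cut_wait_ge[OF assms] by (intro mult_mono) auto
  also have "\<dots> \<le> hit_prob wait_law ?N sd"
    by (rule hit_prob_dominated) (use cut_wait_dominated keep_prob_pos[of "Suc n"] keep_prob_le in auto)
  finally show ?thesis by simp
qed

text \<open>Phase \<open>n\<close> consists of \<open>2 ^ leg_scale n\<close> legs.\<close>
primrec phase_start :: "nat \<Rightarrow> nat" where
  "phase_start 0 = 0"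
| "phase_start (Suc n) = phase_start n + 2 ^ leg_scale n"

declare phase_start.simps(2) [simp del]

lemma phase_start_Suc_le: "phase_start (Suc n) \<le> 2 * 2 ^ leg_scale n"
proof (induction n)
  case (Suc n)
  have "2 * 2 ^ leg_scale n \<le> (2::nat) ^ leg_scale (Suc n)"
    using power_increasing[of "Suc (leg_scale n)" "leg_scale (Suc n)" "2::nat"] leg_scale_Suc_ge[of n] leg_scale_pos[of n] by simp
  then show ?case using Suc by (simp add: phase_start.simps(2)[of "Suc n"])
qed (simp add: phase_start.simps)

text \<open>In phase \<open>n \<ge> 2\<close> the origin is crossed with probability bounded below, provided that the walk
  is within distance \<open>leg_scale n\<close> when the phase begins. It is so unless a scale
  \<open>n\<close> or higher has occurred before.\<close>
lemma hit_prob_wait_tendsto_1: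
  assumes d: "snd sd \<in> axis_directions"
  shows "(\<lambda>n. hit_prob wait_law (phase_start n) sd) \<longlonglongrightarrow> 1"
proof (rule hit_prob_tendsto_1[where b="\<lambda>n. 2 ^ leg_scale n" and c="1 / (2 * 10 ^ 8)" and H=leg_scale and ?n0.0=2])
  fix n :: nat and sd assume "2 \<le> n" "snd sd \<in> axis_directions" "in_box (leg_scale n) (fst sd)"
  then show "1 / (2 * 10 ^ 8) \<le> hit_prob wait_law (2 ^ leg_scale n) sd"
    using hit_prob_wait_ge[of "n - 1" sd] by simp
next
  let ?far = "\<lambda>n. prob_of (walk_law wait_law (phase_start n) sd) {sd. \<not> in_box (leg_scale n) (fst sd)}"
  define B where "B = nat (max \<bar>fst (fst sd)\<bar> \<bar>snd (fst sd)\<bar>)"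
  have "?far (Suc n) \<le> (1 / 2) ^ n" if "n \<ge> B" for n
  proof -
    have fit: "B + 2 * leg_scale n * phase_start (Suc n) \<le> leg_scale (Suc n)"
    proof -
      have "B \<le> leg_scale n" using that Suc_le_leg_scale[of n] by simp
      also have "\<dots> \<le> 2 ^ leg_scale n * leg_scale n" by simp
      finally have "B + 2 * leg_scale n * phase_start (Suc n) \<le> 2 ^ leg_scale n * leg_scale n + 2 * leg_scale n * (2 * 2 ^ leg_scale n)"
        using phase_start_Suc_le[of n] by (intro add_mono mult_left_mono) auto
      also have "\<dots> \<le> 8 * 2 ^ leg_scale n * leg_scale n" by simp
      also have "\<dots> = 2 ^ (leg_scale n + 3) * leg_scale n" by (simp add: power_add)
      also have "\<dots> \<le> leg_scale (Suc n)" unfolding leg_scale.simps by (intro mult_right_mono power_increasing) auto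
      finally show ?thesis .
    qed
    have B: "\<bar>fst (fst sd)\<bar> \<le> int B" "\<bar>snd (fst sd)\<bar> \<le> int B" by (auto simp: B_def)
    have fit': "int B + int (2 * leg_scale n * phase_start (Suc n)) \<le> int (leg_scale (Suc n))"
      using fit by (simp only: of_nat_add[symmetric] of_nat_le_iff)
    have "?far (Suc n) \<le> real (phase_start (Suc n)) * prob_of wait_law {2 * leg_scale n..}"
    proof -
      have "\<bar>fst (fst sd)\<bar> + int (2 * leg_scale n * phase_start (Suc n)) \<le> int (leg_scale (Suc n))"
        "\<bar>snd (fst sd)\<bar> + int (2 * leg_scale n * phase_start (Suc n)) \<le> int (leg_scale (Suc n))"
        using B fit' by linarith+
      from prob_leave_box_le[OF d this, of wait_law] show ?thesis by (simp only: prod.collapse)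
    qed
    also have "\<dots> \<le> real (2 * 2 ^ leg_scale n) * (1 / (2 ^ leg_scale n * 2 ^ Suc n))"
      using phase_start_Suc_le[of n] prob_wait_ge[of n] prob_scale_gt[of n]
      by (intro mult_mono) (simp_all only: of_nat_le_iff, auto)
    also have "\<dots> = (1 / 2) ^ n" by (simp add: power_one_over)
    finally show ?thesis .
  qed
  then have "(\<lambda>n. ?far (Suc n)) \<longlonglongrightarrow> 0"
    by (intro tendsto_sandwich[OF _ _ tendsto_const LIMSEQ_power_zero[of "1/2 :: real"]])
       (auto simp: eventually_sequentially)
  then show "?far \<longlonglongrightarrow> 0" by (rule LIMSEQ_imp_Suc)
qed (use d in \<open>auto simp: phase_start.simps\<close>)

section \<open>Summability of the visit probabilities\<close>

lemma summable_if_block_sums: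
  fixes f b :: "nat \<Rightarrow> real" and K :: "nat \<Rightarrow> nat"
  assumes f: "\<And>k. 0 \<le> f k" and K: "\<And>n. n \<le> K n" "\<And>n. K n \<le> K (Suc n)"
    and block: "\<And>n. (\<Sum>k\<in>{K n..<K (Suc n)}. f k) \<le> b n"
    and b: "summable b"
  shows "summable f"
proof (rule summableI_nonneg_bounded)
  have b0: "0 \<le> b n" for n using block[of n] f by (meson order_trans sum_nonneg)
  have part: "(\<Sum>k<K n. f k) \<le> (\<Sum>k<K 0. f k) + (\<Sum>i<n. b i)" for n
  proof (induction n)
    case (Suc n)
    have "(\<Sum>k<K (Suc n). f k) = (\<Sum>k<K n. f k) + (\<Sum>k\<in>{K n..<K (Suc n)}. f k)"
      using K(2)[of n] by (subst sum.union_disjoint[symmetric]) (auto intro: sum.cong)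
    then show ?case using Suc block[of n] by simp
  qed simp
  show "(\<Sum>k<N. f k) \<le> (\<Sum>k<K 0. f k) + suminf b" for N
  proof -
    have "(\<Sum>k<N. f k) \<le> (\<Sum>k<K N. f k)" using K(1)[of N] f by (intro sum_mono2) auto
    also note part[of N]
    also have "(\<Sum>i<N. b i) \<le> suminf b" using b b0 by (intro sum_le_suminf) auto
    finally show ?thesis by simp
  qed
qed (rule f)

lemma sum_geometric_tail_le:
  fixes x :: real
  assumes "0 \<le> x" "x < 1"
  shows "(\<Sum>k\<in>{a..<b}. x ^ k) \<le> x ^ a / (1 - x)"
proof (cases "a \<le> b")
  case True
  then have "(\<Sum>k\<in>{a..<b}. x ^ k) * (1 - x) = x ^ a - x ^ b"
  proof (induction b rule: dec_induct)
    case (step n)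
    have "(\<Sum>k\<in>{a..<Suc n}. x ^ k) * (1 - x) = (\<Sum>k\<in>{a..<n}. x ^ k) * (1 - x) + x ^ n * (1 - x)"
      using step(1) by (simp add: distrib_right)
    also have "\<dots> = x ^ a - x ^ Suc n" unfolding step.IH by (simp add: algebra_simps)
    finally show ?case .
  qed simp
  also have "\<dots> \<le> x ^ a" using assms by simp
  finally show ?thesis using assms by (simp add: pos_le_divide_eq)
qed (use assms in auto)

text \<open>Only a polynomial bound on the exponentially small left-hand side is needed, which comes from the
  quadratic Taylor bound for \<open>exp\<close>.\<close>
lemma power_square_le:
  fixes R :: nat
  assumes "R > 0"
  shows "(1 - 1 / (3 * real R)) ^ (R\<^sup>2) \<le> 18 / (real R)\<^sup>2"
proof -
  have R: "real R \<ge> 1" using assms by simp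
  have "(1 - 1 / (3 * real R)) ^ (R\<^sup>2) \<le> exp (- (1 / (3 * real R))) ^ (R\<^sup>2)"
    using R exp_ge_add_one_self[of "- (1 / (3 * real R))"] by (intro power_mono) (auto simp: field_simps)
  also have "\<dots> = exp (- (real R / 3))"
    using R by (simp add: exp_of_nat_mult[symmetric] power2_eq_square)
  also have "\<dots> = 1 / exp (real R / 3)" by (simp add: exp_minus field_simps)
  also have "\<dots> \<le> 1 / ((real R)\<^sup>2 / 18)"
  proof (intro divide_left_mono)
    have "(real R / 3)\<^sup>2 / 2 \<le> 1 + real R / 3 + (real R / 3)\<^sup>2 / 2" by simp
    also have "\<dots> \<le> exp (real R / 3)" by (rule exp_lower_Taylor_quadratic) simp
    finally show "(real R)\<^sup>2 / 18 \<le> exp (real R / 3)" by (simp add: power_divide)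
  qed (use R in auto)
  finally show ?thesis by simp
qed

context
  fixes d x :: "site"
  assumes d: "d \<in> axis_directions"
begin

lemma prob_visit_le:
  "prob_of (walk_law wait_law (Suc k) ((0, 0), d)) {sd. fst sd \<in> {x}}
    \<le> 2 * (1 - 1 / (3 * real (rarity n))) ^ k
      + 12 * real (rarity n) / (real (leg_scale (Suc n)))\<^sup>2 * (1 / (real k + 1))"
proof -
  let ?R = "real (rarity n)" and ?h = "real (leg_scale (Suc n))"
  have R: "?R \<ge> 1" by (rule rarity_ge_1)
  have q: "pmf scale_law (Suc n) = 1 / ?R" by (simp add: pmf_scale_law scale_prob_def)
  have "2 * (1 / ?h\<^sup>2) / (1 + 1 / ?R * real k / 6) \<le> 2 * (1 / ?h\<^sup>2) / ((real k + 1) / (6 * ?R))"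
  proof (rule divide_left_mono)
    show "(real k + 1) / (6 * ?R) \<le> 1 + 1 / ?R * real k / 6" using R by (simp add: field_simps)
    show "0 < (1 + 1 / ?R * real k / 6) * ((real k + 1) / (6 * ?R))"
    proof (rule mult_pos_pos)
      show "0 < 1 + 1 / ?R * real k / 6" using R by (intro add_pos_nonneg) auto
      show "0 < (real k + 1) / (6 * ?R)" using R by (intro divide_pos_pos) auto
    qed
  qed simp
  also have "\<dots> = 12 * ?R / ?h\<^sup>2 * (1 / (real k + 1))" using R by (simp add: field_simps)
  finally have second: "2 * (1 / ?h\<^sup>2) / (1 + 1 / ?R * real k / 6) \<le> 12 * ?R / ?h\<^sup>2 * (1 / (real k + 1))" .
  have "prob_of (walk_law wait_law (Suc k) ((0, 0), d)) {sd. fst sd \<in> {x}}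
    \<le> 2 * (1 - pmf scale_law (Suc n) / 3) ^ k
      + 2 * (real (card {x}) / ?h\<^sup>2) / (1 + pmf scale_law (Suc n) * real k / 6)"
    by (rule prob_walk_position_le[OF wait_law_def step_law_def leg_scale_pos d]) simp
  also have "\<dots> = 2 * (1 - 1 / (3 * ?R)) ^ k + 2 * (1 / ?h\<^sup>2) / (1 + 1 / ?R * real k / 6)"
    unfolding q by (simp add: mult.commute)
  finally show ?thesis using second by linarith
qed

text \<open>From leg \<open>(rarity n)\<^sup>2\<close> on, scale \<open>Suc n\<close> has moved both coordinates with high probability and
  gives the best bound, until the next scale takes over. The logarithm of the length of the
  block is of the order of \<open>leg_scale (Suc n)\<close>, so the sum is of the order of
  \<open>rarity n / leg_scale (Suc n)\<close>, up to the geometric term.\<close>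
lemma sum_visit_prob_block_le:
  "(\<Sum>k\<in>{(rarity n)\<^sup>2..<(rarity (Suc n))\<^sup>2}. prob_of (walk_law wait_law (Suc k) ((0, 0), d)) {sd. fst sd \<in> {x}})
    \<le> 150 * (1 / 2) ^ n"
proof -
  let ?R = "real (rarity n)" and ?h = "real (leg_scale (Suc n))"
  let ?I = "{(rarity n)\<^sup>2..<(rarity (Suc n))\<^sup>2}" and ?y = "1 - 1 / (3 * real (rarity n))"
  have R: "?R \<ge> 1" by (rule rarity_ge_1)
  have y: "0 \<le> ?y" "?y < 1" using R by (auto simp: field_simps)
  have R2: "2 ^ n \<le> ?R"
  proof -
    have "2 ^ n \<le> rarity n" unfolding rarity_def by (intro power_increasing) auto
    then have "real (2 ^ n) \<le> ?R" by (simp only: of_nat_le_iff)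
    then show ?thesis by simp
  qed
  have hR: "2 ^ Suc n * ?R \<le> ?h"
  proof -
    have "2 ^ Suc n * rarity n \<le> leg_scale (Suc n)" unfolding leg_scale_Suc_rarity using leg_scale_pos[of n] by simp
    then have "real (2 ^ Suc n * rarity n) \<le> ?h" by (simp only: of_nat_le_iff)
    then show ?thesis by simp
  qed
  have h: "?h \<ge> real n + 2" using Suc_le_leg_scale[of "Suc n"] by linarith
  have "(\<Sum>k\<in>?I. prob_of (walk_law wait_law (Suc k) ((0, 0), d)) {sd. fst sd \<in> {x}})
    \<le> (\<Sum>k\<in>?I. 2 * ?y ^ k + 12 * ?R / ?h\<^sup>2 * (1 / (real k + 1)))"
    by (intro sum_mono prob_visit_le)
  also have "\<dots> = 2 * (\<Sum>k\<in>?I. ?y ^ k) + 12 * ?R / ?h\<^sup>2 * (\<Sum>k\<in>?I. 1 / (real k + 1))"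
    by (simp only: sum.distrib sum_distrib_left)
  also have "\<dots> \<le> 108 * (1 / 2) ^ n + 42 * (1 / 2) ^ n"
  proof (rule add_mono)
    have "2 * (\<Sum>k\<in>?I. ?y ^ k) \<le> 2 * (?y ^ ((rarity n)\<^sup>2) / (1 - ?y))"
      by (intro mult_left_mono sum_geometric_tail_le y) simp
    also have "\<dots> = 6 * ?R * ?y ^ ((rarity n)\<^sup>2)" using R by (simp add: field_simps)
    also have "\<dots> \<le> 6 * ?R * (18 / ?R\<^sup>2)"
      using R by (intro mult_left_mono power_square_le) auto
    also have "\<dots> = 108 / ?R" using R by (simp add: power2_eq_square)
    also have "\<dots> \<le> 108 / 2 ^ n" using R R2 by (intro divide_left_mono mult_pos_pos) auto
    finally show "2 * (\<Sum>k\<in>?I. ?y ^ k) \<le> 108 * (1 / 2) ^ n" by (simp add: power_one_over)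
  next
    have pos: "0 < rarity (Suc n)" by (simp add: rarity_def)
    have "(\<Sum>k\<in>?I. 1 / (real k + 1)) \<le> (\<Sum>k<(rarity (Suc n))\<^sup>2. 1 / (real k + 1))"
      by (intro sum_mono2) auto
    also have "\<dots> \<le> 1 + ln (real ((rarity (Suc n))\<^sup>2))"
      using harmonic_le[of "(rarity (Suc n))\<^sup>2"] pos by (simp add: max_def)
    also have "\<dots> = 1 + 2 * ((?h + real n + 3) * ln 2)"
    proof -
      have e: "real ((rarity (Suc n))\<^sup>2) = 2 ^ ((leg_scale (Suc n) + Suc n + 2) * 2)"
        unfolding rarity_def by (simp only: of_nat_power of_nat_numeral power_mult)
      show ?thesis unfolding e by (subst ln_realpow) (simp_all add: algebra_simps)
    qed
    also have "\<dots> \<le> 1 + 2 * ((?h + real n + 3) * 1)"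
      using ln_2_less_1 by (intro add_mono mult_left_mono) auto
    also have "\<dots> \<le> 7 * ?h" using h by simp
    finally have "12 * ?R / ?h\<^sup>2 * (\<Sum>k\<in>?I. 1 / (real k + 1)) \<le> 12 * ?R / ?h\<^sup>2 * (7 * ?h)"
      by (intro mult_left_mono) auto
    also have "\<dots> = 84 * ?R / ?h" using h by (simp add: power2_eq_square)
    also have "\<dots> \<le> 84 * ?R / (2 ^ Suc n * ?R)"
      using hR R h by (intro divide_left_mono) (auto intro!: mult_pos_pos)
    also have "\<dots> = 42 * (1 / 2) ^ n" using R by (simp add: power_one_over)
    finally show "12 * ?R / ?h\<^sup>2 * (\<Sum>k\<in>?I. 1 / (real k + 1)) \<le> 42 * (1 / 2) ^ n" .
  qed
  finally show ?thesis by simp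
qed

lemma summable_visit_prob:
  "summable (\<lambda>k. prob_of (walk_law wait_law (Suc k) ((0, 0), d)) {sd. fst sd \<in> {x}})"
proof (rule summable_if_block_sums[where K="\<lambda>n. (rarity n)\<^sup>2" and b="\<lambda>n. 150 * (1 / 2) ^ n"])
  fix n
  show "n \<le> (rarity n)\<^sup>2"
  proof -
    have "n < 2 ^ n" by (rule less_exp)
    also have "\<dots> \<le> rarity n" unfolding rarity_def by (intro power_increasing) auto
    also have "\<dots> \<le> (rarity n)\<^sup>2" by (simp add: power2_eq_square)
    finally show ?thesis by simp
  qed
  show "(rarity n)\<^sup>2 \<le> (rarity (Suc n))\<^sup>2"
    unfolding rarity_def using leg_scale_mono[of n "Suc n"] by (intro power_mono power_increasing) auto
qed (rule measure_nonneg, rule sum_visit_prob_block_le, intro summable_mult summable_geometric, simp)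

end

lemma prob_wait_pos: "prob_of wait_law {t. t > 0} > 0"
proof -
  have "Suc 0 \<in> set_pmf scale_law"
    using rarity_ge_1[of 0] by (simp add: set_pmf_iff pmf_scale_law scale_prob_def)
  then have "1 \<in> set_pmf wait_law"
    unfolding wait_law_def using Suc_le_leg_scale[of "Suc 0"] by (auto simp: set_step_law intro!: bexI[of _ "Suc 0"])
  then have "prob_of wait_law {t. t > 0} \<noteq> 0" by (auto simp: measure_pmf_zero_iff)
  then show ?thesis using measure_nonneg[of wait_law "{t. t > 0}"] by linarith
qed

theorem theorem4:
  "\<exists>p :: nat pmf.
     measure_pmf.prob p {t. t > 0} > 0 \<and>
     (\<forall>d\<in>horizontal_directions.
        (AE \<omega> in drrw_space p. infinite {m. drrw_position d m \<omega> = (0, 0)}) \<and>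
        (\<forall>x :: int \<times> int. AE \<omega> in drrw_space p. finite (changes_at d x \<omega>)))"
proof (intro exI[of _ wait_law] conjI ballI allI)
  show "measure_pmf.prob wait_law {t. t > 0} > 0" by (rule prob_wait_pos)
  fix d assume "d \<in> horizontal_directions"
  then have d: "d \<in> axis_directions" by (auto simp: horizontal_directions_def axis_directions_def)
  show "AE \<omega> in drrw_space wait_law. infinite {m. drrw_position d m \<omega> = (0, 0)}"
    by (rule AE_infinitely_many_returns[OF hit_prob_wait_tendsto_1 d])
  show "AE \<omega> in drrw_space wait_law. finite (changes_at d x \<omega>)" for x
    by (rule AE_finitely_many_changes[OF summable_visit_prob[OF d]])
qed

end
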